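(* Let $\Lambda$ be a finite, strongly connected $k$-graph, let $(\alpha_q)_{q\in\mathbb{N}}$ be an increasing sequence of positive reals with $\lim_{q\to\infty}\alpha_q=\infty$ for which there is $C\ge0$ with $|\alpha_{q+1}-\alpha_q|\le C$ for all $q$, and let $(\mathcal{A}_\Lambda,L^2(\Lambda^\infty,M),D)$ be the spectral triple with Dirac operator $D=\sum_{q\in\mathbb{N}}\alpha_q\widehat{\Xi}_{q,q-1}$. Then the eigenspaces of $D$ agree with the wavelet decomposition $$L^2(\Lambda^\infty,M)=\mathscr{V}_0\oplus\bigoplus_{q=0}^\infty\mathcal{W}_q:$$ we have $\mathscr{V}_0=(\mathcal{R}_0\cap\mathcal{R}_{-1}^\perp)\oplus\mathcal{R}_{-1}$ and, for all $q\in\mathbb{N}$, $$\mathcal{W}_q=\mathcal{R}_{q+1}\cap\mathcal{R}_q^\perp.$$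
   Context: $\mathbb{N}=\{0,1,2,\dots\}$. A $k$-graph is a countable small category $\Lambda$ with a functor $d:\Lambda\to\mathbb{N}^k$ ($\mathbb{N}^k$ viewed as a one-object category) satisfying the factorization property: if $d(\lambda)=m+n$, there are unique $\mu,\nu\in\Lambda$ with $d(\mu)=m$, $d(\nu)=n$ and $\lambda=\mu\nu$. $r,s$ denote range and source of morphisms; $\Lambda^n=d^{-1}(n)$; $\Lambda^0$ is the set of vertices; $v\Lambda^n=\{\lambda\in\Lambda^n:r(\lambda)=v\}$. $\Lambda$ is finite if every $\Lambda^n$ is finite, and strongly connected if for all $v,w\in\Lambda^0$ there is a morphism with range $v$ and source $w$. $\Lambda$ has no sources: $v\Lambda^n\ne\emptyset$ for all $v\in\Lambda^0,n\in\mathbb{N}^k$. $A_i(v,w)=\#\{\lambda\in\Lambda^{e_i}: r(\lambda)=v,s(\lambda)=w\}$, $\rho_i$ is the spectral radius of $A_i$; $x^\Lambda\in(0,\infty)^{\Lambda^0}$ is the unique positive vector with $\sum_v x^\Lambda_v=1$ and $A_ix^\Lambda=\rho_ix^\Lambda$ for all $i$; $\rho(\Lambda)^n=\rho_1^{n_1}\cdots\rho_k^{n_k}$. $\Omega_k$ is the $k$-graph with objects $\mathbb{N}^k$, morphisms $\{(m,n):m\le n\}$, $r(m,n)=m$, $s(m,n)=n$, $d(m,n)=n-m$; $\Lambda^\infty$ is the set of degree-preserving functors $x:\Omega_k\to\Lambda$, topologized by the cylinder sets $[\lambda]=\{x:x(0,d(\lambda))=\lambda\}$. $M$ is the Borel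 probability measure on $\Lambda^\infty$ with $M([\lambda])=\rho(\Lambda)^{-d(\lambda)}x^\Lambda_{s(\lambda)}$. $\mathcal{A}_\Lambda$ is the span of $\{s_\lambda s_\eta^*\}$ in the $k$-graph algebra $C^*(\Lambda)$ (universal for partial isometries $s_\lambda$ with: $s_v$, $v\in\Lambda^0$, mutually orthogonal projections; $s_\lambda s_\eta=s_{\lambda\eta}$ if $s(\lambda)=r(\eta)$; $s_\lambda^*s_\lambda=s_{s(\lambda)}$; $\sum_{\lambda\in v\Lambda^n}s_\lambda s_\lambda^*=s_v$), represented on $L^2(\Lambda^\infty,M)$ by $s_\lambda\mapsto S_\lambda$, where $S_\lambda\chi_{[\eta]}=\rho(\Lambda)^{d(\lambda)/2}\chi_{[\lambda\eta]}$ if $s(\lambda)=r(\eta)$ and $0$ otherwise. $\mathcal{R}_{-1}\subset L^2(\Lambda^\infty,M)$ is the space of constant functions; for $s\in\mathbb{N}$, $\mathcal{R}_s=\operatorname{span}\{\chi_{[\eta]}:\eta\in\Lambda,\ \max_id(\eta)_i\le s\}$. $\Xi_s$ is the orthogonal projection onto $\mathcal{R}_s$ and $\widehat{\Xi}_{q,q-1}=\Xi_q-\Xi_{q-1}$. Thus $D$ acts as $0$ on $\mathcal{R}_{-1}$ and as $\alpha_q$ on $\mathcal{R}_q\cap\mathcal{R}_{q-1}^\perp$, $q\in\mathbb{N}$. Wavelet spaces: $\mathscr{V}_n=\operatorname{span}\{\chi_{[\lambda]}:d(\lambda)=(n,\dots,n)\}$, $\mathcal{W}_0=\mathscr{V}_1\cap\mathscr{V}_0^\perp$,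 and $\mathcal{W}_q=\operatorname{span}\{S_\lambda f:f\in\mathcal{W}_0,\ d(\lambda)=(q,\dots,q)\}$ (which equals $\mathscr{V}_{q+1}\cap\mathscr{V}_q^\perp$). *)

theory Defs
  imports "HOL-Probability.Probability" "Jordan_Normal_Form.Spectral_Radius"
begin

no_notation Matrix.vec_index (infixl \<open>$\<close> 100)

section \<open>Higher-rank graphs\<close>

text \<open>
  Categories are encoded by their morphisms alone: an object is identified with its identity
  morphism, so \<open>rng\<close> and \<open>src\<close> take values in the morphisms and \<open>cmp \<mu> \<nu>\<close> is meaningful
  only when \<open>src \<mu> = rng \<nu>\<close>. In a k-graph the identities are exactly the morphisms of degree 0,
  so this is the usual identification of the objects with \<open>\<Lambda>\<^sup>0\<close>.
  The rank k is the cardinality of the finite index type \<open>'k\<close>.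
\<close>

record 'a cat =
  Mor :: "'a set"
  rng :: "'a \<Rightarrow> 'a"
  src :: "'a \<Rightarrow> 'a"
  cmp :: "'a \<Rightarrow> 'a \<Rightarrow> 'a"

record ('a, 'k) kgraph = "'a cat" +
  dgr :: "'a \<Rightarrow> nat ^ 'k"

definition small_category :: "('a, 'z) cat_scheme \<Rightarrow> bool" where
  "small_category \<C> \<longleftrightarrow>
     (\<forall>\<mu>\<in>Mor \<C>. rng \<C> \<mu> \<in> Mor \<C> \<and> src \<C> \<mu> \<in> Mor \<C>
        \<and> rng \<C> (rng \<C> \<mu>) = rng \<C> \<mu> \<and> src \<C> (rng \<C> \<mu>) = rng \<C> \<mu>
        \<and> rng \<C> (src \<C> \<mu>) = src \<C> \<mu> \<and> src \<C> (src \<C> \<mu>) = src \<C> \<mu>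
        \<and> cmp \<C> (rng \<C> \<mu>) \<mu> = \<mu> \<and> cmp \<C> \<mu> (src \<C> \<mu>) = \<mu>) \<and>
     (\<forall>\<mu>\<in>Mor \<C>. \<forall>\<nu>\<in>Mor \<C>. src \<C> \<mu> = rng \<C> \<nu> \<longrightarrow>
        cmp \<C> \<mu> \<nu> \<in> Mor \<C> \<and> rng \<C> (cmp \<C> \<mu> \<nu>) = rng \<C> \<mu> \<and> src \<C> (cmp \<C> \<mu> \<nu>) = src \<C> \<nu>) \<and>
     (\<forall>\<mu>\<in>Mor \<C>. \<forall>\<nu>\<in>Mor \<C>. \<forall>\<kappa>\<in>Mor \<C>. src \<C> \<mu> = rng \<C> \<nu> \<longrightarrow> src \<C> \<nu> = rng \<C> \<kappa> \<longrightarrow>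
        cmp \<C> (cmp \<C> \<mu> \<nu>) \<kappa> = cmp \<C> \<mu> (cmp \<C> \<nu> \<kappa>))"

definition cat_functor :: "('a, 'z) cat_scheme \<Rightarrow> ('b, 'y) cat_scheme \<Rightarrow> ('a \<Rightarrow> 'b) \<Rightarrow> bool" where
  "cat_functor \<C> \<D> F \<longleftrightarrow>
     (\<forall>\<mu>\<in>Mor \<C>. F \<mu> \<in> Mor \<D> \<and> F (rng \<C> \<mu>) = rng \<D> (F \<mu>) \<and> F (src \<C> \<mu>) = src \<D> (F \<mu>)) \<and>
     (\<forall>\<mu>\<in>Mor \<C>. \<forall>\<nu>\<in>Mor \<C>. src \<C> \<mu> = rng \<C> \<nu> \<longrightarrow> F (cmp \<C> \<mu> \<nu>) = cmp \<D> (F \<mu>) (F \<nu>))"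

definition k_graph :: "('a, 'k::finite) kgraph \<Rightarrow> bool" where
  "k_graph \<Lambda> \<longleftrightarrow>
     small_category \<Lambda> \<and> countable (Mor \<Lambda>) \<and>
     (\<forall>\<mu>\<in>Mor \<Lambda>. dgr \<Lambda> (rng \<Lambda> \<mu>) = 0 \<and> dgr \<Lambda> (src \<Lambda> \<mu>) = 0) \<and>
     (\<forall>\<mu>\<in>Mor \<Lambda>. \<forall>\<nu>\<in>Mor \<Lambda>. src \<Lambda> \<mu> = rng \<Lambda> \<nu> \<longrightarrow> dgr \<Lambda> (cmp \<Lambda> \<mu> \<nu>) = dgr \<Lambda> \<mu> + dgr \<Lambda> \<nu>) \<and>
     (\<forall>\<kappa>\<in>Mor \<Lambda>. \<forall>m n. dgr \<Lambda> \<kappa> = m + n \<longrightarrow>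
        (\<exists>!(\<mu>, \<nu>). \<mu> \<in> Mor \<Lambda> \<and> \<nu> \<in> Mor \<Lambda> \<and> dgr \<Lambda> \<mu> = m \<and> dgr \<Lambda> \<nu> = n
           \<and> src \<Lambda> \<mu> = rng \<Lambda> \<nu> \<and> \<kappa> = cmp \<Lambda> \<mu> \<nu>))"

definition of_degree :: "('a, 'k::finite) kgraph \<Rightarrow> nat ^ 'k \<Rightarrow> 'a set" where
  "of_degree \<Lambda> n = {\<mu> \<in> Mor \<Lambda>. dgr \<Lambda> \<mu> = n}"

abbreviation vertices :: "('a, 'k::finite) kgraph \<Rightarrow> 'a set" where
  "vertices \<Lambda> \<equiv> of_degree \<Lambda> 0"

definition finite_kgraph :: "('a, 'k::finite) kgraph \<Rightarrow> bool" where
  "finite_kgraph \<Lambda> \<longleftrightarrow> (\<forall>n. finite (of_degree \<Lambda> n))"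

definition strongly_connected :: "('a, 'k::finite) kgraph \<Rightarrow> bool" where
  "strongly_connected \<Lambda> \<longleftrightarrow>
     (\<forall>v\<in>vertices \<Lambda>. \<forall>w\<in>vertices \<Lambda>. \<exists>\<mu>\<in>Mor \<Lambda>. rng \<Lambda> \<mu> = v \<and> src \<Lambda> \<mu> = w)"

definition no_sources :: "('a, 'k::finite) kgraph \<Rightarrow> bool" where
  "no_sources \<Lambda> \<longleftrightarrow> (\<forall>v\<in>vertices \<Lambda>. \<forall>n. {\<mu> \<in> of_degree \<Lambda> n. rng \<Lambda> \<mu> = v} \<noteq> {})"

definition vertex_matrix :: "('a, 'k::finite) kgraph \<Rightarrow> 'k \<Rightarrow> 'a \<Rightarrow> 'a \<Rightarrow> nat" where
  "vertex_matrix \<Lambda> i v w =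
     card {\<mu> \<in> of_degree \<Lambda> (axis i 1). rng \<Lambda> \<mu> = v \<and> src \<Lambda> \<mu> = w}"

text \<open>
  The matrix library indexes by initial segments of the naturals, so the (finitely many) vertices
  are enumerated by \<open>from_nat_into\<close>; the spectral radius does not depend on the enumeration.
\<close>

definition rho :: "('a, 'k::finite) kgraph \<Rightarrow> 'k \<Rightarrow> real" where
  "rho \<Lambda> i =
     (let N = card (vertices \<Lambda>); e = from_nat_into (vertices \<Lambda>)
      in spectral_radius (mat N N (\<lambda>(a, b). of_nat (vertex_matrix \<Lambda> i (e a) (e b)))))"

definition rho_pow :: "('a, 'k::finite) kgraph \<Rightarrow> nat ^ 'k \<Rightarrow> real" where
  "rho_pow \<Lambda> n = (\<Prod>i\<in>UNIV. rho \<Lambda> i ^ (n $ i))"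

definition perron_frobenius_vector :: "('a, 'k::finite) kgraph \<Rightarrow> ('a \<Rightarrow> real) \<Rightarrow> bool" where
  "perron_frobenius_vector \<Lambda> x \<longleftrightarrow>
     (\<forall>v\<in>vertices \<Lambda>. x v > 0) \<and> (\<Sum>v\<in>vertices \<Lambda>. x v) = 1 \<and>
     (\<forall>i. \<forall>v\<in>vertices \<Lambda>. (\<Sum>w\<in>vertices \<Lambda>. real (vertex_matrix \<Lambda> i v w) * x w) = rho \<Lambda> i * x v)"


section \<open>The infinite path space and its measure\<close>

definition Omega :: "((nat ^ 'k::finite) \<times> (nat ^ 'k), 'k) kgraph" where
  "Omega = \<lparr>Mor = {(m, n). m \<le> n}, rng = (\<lambda>(m, n). (m, m)), src = (\<lambda>(m, n). (n, n)),
            cmp = (\<lambda>(m, n) (m', n'). (m, n')), dgr = (\<lambda>(m, n). n - m)\<rparr>"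

type_synonym ('a, 'k) path = "(nat ^ 'k) \<times> (nat ^ 'k) \<Rightarrow> 'a"

text \<open>Extensionality makes equality of paths as functions coincide with equality of functors on
  \<open>Omega\<close>.\<close>

definition infinite_paths :: "('a, 'k::finite) kgraph \<Rightarrow> ('a, 'k) path set" where
  "infinite_paths \<Lambda> =
     {x \<in> extensional (Mor Omega). cat_functor Omega \<Lambda> x \<and>
        (\<forall>p\<in>Mor Omega. dgr \<Lambda> (x p) = dgr Omega p)}"

definition cylinder :: "('a, 'k::finite) kgraph \<Rightarrow> 'a \<Rightarrow> ('a, 'k) path set" where
  "cylinder \<Lambda> \<mu> = {x \<in> infinite_paths \<Lambda>. x (0, dgr \<Lambda> \<mu>) = \<mu>}"

definition path_topology :: "('a, 'k::finite) kgraph \<Rightarrow> ('a, 'k) path topology" where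
  "path_topology \<Lambda> = topology_generated_by (cylinder \<Lambda> ` Mor \<Lambda>)"

definition path_measure ::
  "('a, 'k::finite) kgraph \<Rightarrow> ('a \<Rightarrow> real) \<Rightarrow> ('a, 'k) path measure \<Rightarrow> bool" where
  "path_measure \<Lambda> x M \<longleftrightarrow>
     prob_space M \<and>
     sets M = sets (sigma (infinite_paths \<Lambda>) {U. openin (path_topology \<Lambda>) U}) \<and>
     (\<forall>\<mu>\<in>Mor \<Lambda>. measure M (cylinder \<Lambda> \<mu>) = inverse (rho_pow \<Lambda> (dgr \<Lambda> \<mu>)) * x (src \<Lambda> \<mu>))"


section \<open>Square-integrable functions\<close>

text \<open>
  Elements of \<open>L\<^sup>2(M)\<close> are represented by square-integrable functions. A subspace of \<open>L\<^sup>2(M)\<close> is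
  represented by the set of all representatives of its elements, that is, by a set closed under
  equality almost everywhere; thus equality and intersection of such sets are equality and
  intersection of the subspaces, and the zero subspace is the set of almost everywhere vanishing
  functions. Operators are maps on representatives, determined up to equality almost everywhere.
\<close>

definition L2 :: "'b measure \<Rightarrow> ('b \<Rightarrow> complex) set" where
  "L2 M = {f \<in> borel_measurable M. integrable M (\<lambda>x. (cmod (f x))\<^sup>2)}"

definition L2_inner :: "'b measure \<Rightarrow> ('b \<Rightarrow> complex) \<Rightarrow> ('b \<Rightarrow> complex) \<Rightarrow> complex" where
  "L2_inner M f g = (\<integral>x. f x * cnj (g x) \<partial>M)"

definition L2_norm :: "'b measure \<Rightarrow> ('b \<Rightarrow> complex) \<Rightarrow> real" where
  "L2_norm M f = sqrt (\<integral>x. (cmod (f x))\<^sup>2 \<partial>M)"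

definition L2_span :: "'b measure \<Rightarrow> ('b \<Rightarrow> complex) set \<Rightarrow> ('b \<Rightarrow> complex) set" where
  "L2_span M B =
     {f \<in> L2 M. \<exists>F c. finite F \<and> F \<subseteq> B \<and> (AE x in M. f x = (\<Sum>g\<in>F. c g * g x))}"

definition L2_closure :: "'b measure \<Rightarrow> ('b \<Rightarrow> complex) set \<Rightarrow> ('b \<Rightarrow> complex) set" where
  "L2_closure M U = {f \<in> L2 M. \<forall>\<epsilon>>0. \<exists>g\<in>U. L2_norm M (\<lambda>x. f x - g x) < \<epsilon>}"

definition L2_perp :: "'b measure \<Rightarrow> ('b \<Rightarrow> complex) set \<Rightarrow> ('b \<Rightarrow> complex) set" where
  "L2_perp M U = {f \<in> L2 M. \<forall>g\<in>U. L2_inner M f g = 0}"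

definition L2_orthogonal ::
  "'b measure \<Rightarrow> ('b \<Rightarrow> complex) set \<Rightarrow> ('b \<Rightarrow> complex) set \<Rightarrow> bool" where
  "L2_orthogonal M U W \<longleftrightarrow> (\<forall>f\<in>U. \<forall>g\<in>W. L2_inner M f g = 0)"

text \<open>\<open>X = U \<oplus> W\<close>, an orthogonal direct sum of two subspaces.\<close>

definition L2_direct_sum ::
  "'b measure \<Rightarrow> ('b \<Rightarrow> complex) set \<Rightarrow> ('b \<Rightarrow> complex) set \<Rightarrow> ('b \<Rightarrow> complex) set \<Rightarrow> bool" where
  "L2_direct_sum M X U W \<longleftrightarrow>
     L2_orthogonal M U W \<and>
     X = {f \<in> L2 M. \<exists>u\<in>U. \<exists>w\<in>W. AE x in M. f x = u x + w x}"

text \<open>\<open>X\<close> is the Hilbert space direct sum of the sequence of subspaces \<open>U 0, U 1, \<dots>\<close>.\<close>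

definition L2_hilbert_sum ::
  "'b measure \<Rightarrow> ('b \<Rightarrow> complex) set \<Rightarrow> (nat \<Rightarrow> ('b \<Rightarrow> complex) set) \<Rightarrow> bool" where
  "L2_hilbert_sum M X U \<longleftrightarrow>
     (\<forall>m n. m \<noteq> n \<longrightarrow> L2_orthogonal M (U m) (U n)) \<and>
     X = L2_closure M (L2_span M (\<Union>n. U n))"

definition L2_projection ::
  "'b measure \<Rightarrow> ('b \<Rightarrow> complex) set \<Rightarrow> ('b \<Rightarrow> complex) \<Rightarrow> ('b \<Rightarrow> complex)" where
  "L2_projection M U f = (SOME g. g \<in> U \<and> (\<lambda>x. f x - g x) \<in> L2_perp M U)"

definition L2_bounded_operator :: "'b measure \<Rightarrow> (('b \<Rightarrow> complex) \<Rightarrow> ('b \<Rightarrow> complex)) \<Rightarrow> bool" where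
  "L2_bounded_operator M T \<longleftrightarrow>
     (\<forall>f\<in>L2 M. T f \<in> L2 M) \<and>
     (\<forall>f\<in>L2 M. \<forall>g\<in>L2 M. \<forall>a b.
        AE x in M. T (\<lambda>y. a * f y + b * g y) x = a * T f x + b * T g x) \<and>
     (\<exists>K. \<forall>f\<in>L2 M. L2_norm M (T f) \<le> K * L2_norm M f)"


section \<open>The Dirac operator and the wavelet spaces\<close>

abbreviation chi :: "('a, 'k::finite) kgraph \<Rightarrow> 'a \<Rightarrow> ('a, 'k) path \<Rightarrow> complex" where
  "chi \<Lambda> \<mu> \<equiv> indicator (cylinder \<Lambda> \<mu>)"

definition R_space ::
  "('a, 'k::finite) kgraph \<Rightarrow> ('a, 'k) path measure \<Rightarrow> int \<Rightarrow> (('a, 'k) path \<Rightarrow> complex) set" where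
  "R_space \<Lambda> M s =
     (if s = -1 then L2_span M {\<lambda>x. 1}
      else L2_span M {chi \<Lambda> \<eta> |\<eta>. \<eta> \<in> Mor \<Lambda> \<and> Max (range (\<lambda>i. int (dgr \<Lambda> \<eta> $ i))) \<le> s})"

definition Xi ::
  "('a, 'k::finite) kgraph \<Rightarrow> ('a, 'k) path measure \<Rightarrow> int \<Rightarrow>
     (('a, 'k) path \<Rightarrow> complex) \<Rightarrow> (('a, 'k) path \<Rightarrow> complex)" where
  "Xi \<Lambda> M s = L2_projection M (R_space \<Lambda> M s)"

definition Xi_hat ::
  "('a, 'k::finite) kgraph \<Rightarrow> ('a, 'k) path measure \<Rightarrow> nat \<Rightarrow>
     (('a, 'k) path \<Rightarrow> complex) \<Rightarrow> (('a, 'k) path \<Rightarrow> complex)" where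
  "Xi_hat \<Lambda> M q f = (\<lambda>x. Xi \<Lambda> M (int q) f x - Xi \<Lambda> M (int q - 1) f x)"

text \<open>
  \<open>dirac \<Lambda> M \<alpha> f g\<close> means that \<open>f\<close> is in the domain of the unbounded operator \<open>D\<close> and \<open>D f = g\<close>.
  The series defining \<open>D\<close> is understood as converging strongly, on the domain of all vectors for
  which it converges.
\<close>

definition dirac ::
  "('a, 'k::finite) kgraph \<Rightarrow> ('a, 'k) path measure \<Rightarrow> (nat \<Rightarrow> real) \<Rightarrow>
     (('a, 'k) path \<Rightarrow> complex) \<Rightarrow> (('a, 'k) path \<Rightarrow> complex) \<Rightarrow> bool" where
  "dirac \<Lambda> M \<alpha> f g \<longleftrightarrow>
     f \<in> L2 M \<and> g \<in> L2 M \<and>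
     (\<lambda>N. L2_norm M (\<lambda>x. (\<Sum>q<N. complex_of_real (\<alpha> q) * Xi_hat \<Lambda> M q f x) - g x))
       \<longlonglongrightarrow> 0"

definition dirac_eigenspace ::
  "('a, 'k::finite) kgraph \<Rightarrow> ('a, 'k) path measure \<Rightarrow> (nat \<Rightarrow> real) \<Rightarrow> complex \<Rightarrow>
     (('a, 'k) path \<Rightarrow> complex) set" where
  "dirac_eigenspace \<Lambda> M \<alpha> c = {f. dirac \<Lambda> M \<alpha> f (\<lambda>x. c * f x)}"

definition V_space ::
  "('a, 'k::finite) kgraph \<Rightarrow> ('a, 'k) path measure \<Rightarrow> nat \<Rightarrow> (('a, 'k) path \<Rightarrow> complex) set" where
  "V_space \<Lambda> M n = L2_span M (chi \<Lambda> ` of_degree \<Lambda> (\<chi> i. n))"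

text \<open>
  The square root below is \<open>\<rho>(\<Lambda>)\<close> raised to \<open>d(\<lambda>)/2\<close>. The stated values determine the bounded
  operator (up to equality almost everywhere), as the cylinder functions span a dense subspace.
\<close>

definition S_op ::
  "('a, 'k::finite) kgraph \<Rightarrow> ('a, 'k) path measure \<Rightarrow> 'a \<Rightarrow>
     (('a, 'k) path \<Rightarrow> complex) \<Rightarrow> (('a, 'k) path \<Rightarrow> complex)" where
  "S_op \<Lambda> M \<mu> =
     (SOME T. L2_bounded_operator M T \<and>
        (\<forall>\<eta>\<in>Mor \<Lambda>. AE x in M. T (chi \<Lambda> \<eta>) x =
           (if src \<Lambda> \<mu> = rng \<Lambda> \<eta>
            then complex_of_real (sqrt (rho_pow \<Lambda> (dgr \<Lambda> \<mu>))) * chi \<Lambda> (cmp \<Lambda> \<mu> \<eta>) x else 0)))"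

primrec W_space ::
  "('a, 'k::finite) kgraph \<Rightarrow> ('a, 'k) path measure \<Rightarrow> nat \<Rightarrow> (('a, 'k) path \<Rightarrow> complex) set" where
  "W_space \<Lambda> M 0 = V_space \<Lambda> M 1 \<inter> L2_perp M (V_space \<Lambda> M 0)"
| "W_space \<Lambda> M (Suc q) =
     L2_span M {S_op \<Lambda> M \<mu> f |\<mu> f. \<mu> \<in> of_degree \<Lambda> (\<chi> i. Suc q) \<and>
                  f \<in> V_space \<Lambda> M 1 \<inter> L2_perp M (V_space \<Lambda> M 0)}"

end

theory Submission
  imports Defs
begin

text \<open>
  Splitting a cylinder according to the extensions of its path shows \<open>\<R>\<^sub>q = \<V>\<^sub>q\<close> for \<open>q \<ge> 0\<close>, so both
  decompositions come from the increasing chain of the \<open>\<V>\<^sub>q\<close>, whose union is dense. The identity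
  \<open>\<W>\<^sub>q = \<V>\<^sub>q\<^sub>+\<^sub>1 \<inter> \<V>\<^sub>q\<^sup>\<bottom>\<close> rests on the self-similarity of \<open>M\<close>: the shift carries \<open>M\<close> on the cylinder of
  \<open>\<mu>\<close> to a multiple of \<open>M\<close> on the cylinder of \<open>s(\<mu>)\<close>, so that \<open>S\<^sub>\<mu>\<close> exists and preserves the relevant
  orthogonality. A vector is an eigenvector of \<open>D\<close> for \<open>c\<close> iff its components in the layers with
  \<open>\<alpha>\<^sub>q \<noteq> c\<close> vanish (and so does its mean value, if \<open>c \<noteq> 0\<close>), which is read off by pairing \<open>D f = c f\<close>
  with these components.
\<close>

section \<open>Subspaces of square-integrable functions\<close>

text \<open>Functions stand for their classes, so projections and the operators \<open>S_op\<close>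
  are mere choices, fixed only almost everywhere: each of their properties goes through a uniqueness
  argument or an explicit witness. Orthogonal projections exist because every space in the chains is
  spanned by finitely many pairwise orthogonal functions of nonzero norm; cylinders of one degree
  are disjoint and have positive measure. Two chains occur, since the wavelet decomposition begins
  with \<open>V 0\<close> while D also splits off the constants. The second chain begins one step
  earlier, which is why W_q belongs to \<open>\<alpha> (q + 1)\<close>. Divergence of
  \<open>\<alpha>\<close> leaves finitely many q with \<open>\<alpha> q = c\<close>; hence the
  eigenspace of a nonzero c is a finite sum of layers without any closure, and a single layer if the
  values are distinct. Cylinders of arbitrary degrees may overlap without being nested, but those of
  the diagonal degrees (n,...,n) are nested or disjoint. These countably many sets form the
  pi-system on which density and self-similarity rest.\<close>

lemma L2_measurable: "f \<in> L2 M \<Longrightarrow> f \<in> borel_measurable M"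
  by (simp add: L2_def)

lemma L2_integrable_square: "f \<in> L2 M \<Longrightarrow> integrable M (\<lambda>x. (cmod (f x))\<^sup>2)"
  by (simp add: L2_def)

lemma borel_measurable_cnj [measurable]: "cnj \<in> borel_measurable borel"
  by (intro borel_measurable_continuous_onI continuous_on_cnj continuous_on_id)

lemma L2_integrable_mult:
  assumes "f \<in> L2 M" "g \<in> L2 M"
  shows "integrable M (\<lambda>x. f x * cnj (g x))"
proof (rule Bochner_Integration.integrable_bound)
  show "integrable M (\<lambda>x. (cmod (f x))\<^sup>2 + (cmod (g x))\<^sup>2)"
    using assms by (intro Bochner_Integration.integrable_add L2_integrable_square)
  show "(\<lambda>x. f x * cnj (g x)) \<in> borel_measurable M"
    using assms[THEN L2_measurable] by measurable
  have "cmod a * cmod b \<le> (cmod a)\<^sup>2 + (cmod b)\<^sup>2" for a b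
    using sum_squares_bound[of "cmod a" "cmod b"] mult_nonneg_nonneg[of "cmod a" "cmod b"]
      norm_ge_zero[of a] norm_ge_zero[of b] by linarith
  then show "AE x in M. norm (f x * cnj (g x)) \<le> norm ((cmod (f x))\<^sup>2 + (cmod (g x))\<^sup>2)"
    by (simp add: norm_mult)
qed

lemma L2_scale:
  assumes "f \<in> L2 M" shows "(\<lambda>x. a * f x) \<in> L2 M"
  using assms by (auto simp: L2_def norm_mult power_mult_distrib)

lemma L2_add:
  assumes "f \<in> L2 M" "g \<in> L2 M"
  shows "(\<lambda>x. f x + g x) \<in> L2 M"
proof -
  have meas: "(\<lambda>x. f x + g x) \<in> borel_measurable M"
    using assms[THEN L2_measurable] by measurable
  moreover have "integrable M (\<lambda>x. (cmod (f x + g x))\<^sup>2)"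
  proof (rule Bochner_Integration.integrable_bound)
    show "integrable M (\<lambda>x. 2 * (cmod (f x))\<^sup>2 + 2 * (cmod (g x))\<^sup>2)"
      using assms by (intro Bochner_Integration.integrable_add integrable_mult_right L2_integrable_square)
    show "(\<lambda>x. (cmod (f x + g x))\<^sup>2) \<in> borel_measurable M"
      using meas by measurable
    have "(cmod (a + b))\<^sup>2 \<le> 2 * (cmod a)\<^sup>2 + 2 * (cmod b)\<^sup>2" for a b
    proof -
      have "(cmod (a + b))\<^sup>2 \<le> (cmod a + cmod b)\<^sup>2"
        by (intro power_mono norm_triangle_ineq) auto
      also have "\<dots> \<le> 2 * (cmod a)\<^sup>2 + 2 * (cmod b)\<^sup>2"
        using sum_squares_bound[of "cmod a" "cmod b"] by (simp add: power2_sum)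
      finally show ?thesis .
    qed
    then show "AE x in M. norm ((cmod (f x + g x))\<^sup>2) \<le> norm (2 * (cmod (f x))\<^sup>2 + 2 * (cmod (g x))\<^sup>2)"
      by simp
  qed
  ultimately show ?thesis by (simp add: L2_def)
qed

lemma L2_lincomb:
  assumes "f \<in> L2 M" "g \<in> L2 M"
  shows "(\<lambda>x. a * f x + b * g x) \<in> L2 M"
  using assms by (intro L2_add L2_scale)

lemma L2_diff:
  assumes "f \<in> L2 M" "g \<in> L2 M"
  shows "(\<lambda>x. f x - g x) \<in> L2 M"
  using L2_lincomb[OF assms, of 1 "-1"] by simp

lemma L2_zero: "(\<lambda>_. 0) \<in> L2 M"
  by (simp add: L2_def)

lemma L2_sum:
  assumes "\<And>i. i \<in> I \<Longrightarrow> f i \<in> L2 M"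
  shows "(\<lambda>x. \<Sum>i\<in>I. f i x) \<in> L2 M"
  using assms by (induction I rule: infinite_finite_induct) (auto intro: L2_zero L2_add)

section \<open>Inner product and norm, up to Cauchy-Schwarz and the triangle inequality\<close>

lemma L2_inner_lincomb_left:
  assumes "f \<in> L2 M" "g \<in> L2 M" "h \<in> L2 M"
  shows "L2_inner M (\<lambda>x. a * f x + b * g x) h = a * L2_inner M f h + b * L2_inner M g h"
  using L2_integrable_mult[OF assms(1,3)] L2_integrable_mult[OF assms(2,3)]
  by (simp add: L2_inner_def algebra_simps)

lemma L2_inner_diff_left:
  assumes "f \<in> L2 M" "g \<in> L2 M" "h \<in> L2 M"
  shows "L2_inner M (\<lambda>x. f x - g x) h = L2_inner M f h - L2_inner M g h"
  using L2_inner_lincomb_left[OF assms, of 1 "-1"] by simp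

lemma L2_inner_add_left:
  assumes "f \<in> L2 M" "g \<in> L2 M" "h \<in> L2 M"
  shows "L2_inner M (\<lambda>x. f x + g x) h = L2_inner M f h + L2_inner M g h"
  using L2_inner_lincomb_left[OF assms, of 1 1] by simp

lemma L2_inner_scale_left: "L2_inner M (\<lambda>x. a * f x) h = a * L2_inner M f h"
  by (simp add: L2_inner_def mult.assoc)

lemma L2_inner_zero_left [simp]: "L2_inner M (\<lambda>x. 0) h = 0"
  by (simp add: L2_inner_def)

lemma L2_inner_cnj: "L2_inner M g f = cnj (L2_inner M f g)"
  unfolding L2_inner_def Bochner_Integration.integral_cnj[symmetric] by (simp add: mult.commute)

lemma L2_inner_eq_0_sym: "L2_inner M f g = 0 \<Longrightarrow> L2_inner M g f = 0"
  by (subst L2_inner_cnj) simp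

lemma L2_inner_sum_left:
  assumes "\<And>i. i \<in> I \<Longrightarrow> f i \<in> L2 M" "h \<in> L2 M"
  shows "L2_inner M (\<lambda>x. \<Sum>i\<in>I. f i x) h = (\<Sum>i\<in>I. L2_inner M (f i) h)"
  using assms
  by (induction I rule: infinite_finite_induct) (simp_all add: L2_inner_add_left L2_sum)

lemma L2_inner_cong_AE:
  assumes "f \<in> L2 M" "f' \<in> L2 M" "g \<in> L2 M" "g' \<in> L2 M"
    and "AE x in M. f x = f' x" "AE x in M. g x = g' x"
  shows "L2_inner M f g = L2_inner M f' g'"
  unfolding L2_inner_def
proof (rule integral_cong_AE)
  show "(\<lambda>x. f x * cnj (g x)) \<in> borel_measurable M" "(\<lambda>x. f' x * cnj (g' x)) \<in> borel_measurable M"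
    using assms(1-4)[THEN L2_measurable] by measurable
  show "AE x in M. f x * cnj (g x) = f' x * cnj (g' x)"
    using assms(5,6) by eventually_elim simp
qed

lemma L2_norm_cong_AE:
  assumes "f \<in> L2 M" "g \<in> L2 M" "AE x in M. f x = g x"
  shows "L2_norm M f = L2_norm M g"
  unfolding L2_norm_def
proof (rule arg_cong[of _ _ sqrt], rule integral_cong_AE)
  show "(\<lambda>x. (cmod (f x))\<^sup>2) \<in> borel_measurable M" "(\<lambda>x. (cmod (g x))\<^sup>2) \<in> borel_measurable M"
    using assms(1-2)[THEN L2_measurable] by measurable
  show "AE x in M. (cmod (f x))\<^sup>2 = (cmod (g x))\<^sup>2"
    using assms(3) by eventually_elim simp
qed

lemma L2_norm_nonneg [simp]: "0 \<le> L2_norm M f"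
  by (simp add: L2_norm_def)

lemma L2_norm_square: "(L2_norm M f)\<^sup>2 = (\<integral>x. (cmod (f x))\<^sup>2 \<partial>M)"
  by (simp add: L2_norm_def)

lemma L2_inner_self: "L2_inner M f f = complex_of_real ((L2_norm M f)\<^sup>2)"
  unfolding L2_inner_def L2_norm_square integral_complex_of_real[symmetric]
  by (simp only: complex_norm_square)

lemma L2_norm_eq_0_iff:
  assumes "f \<in> L2 M"
  shows "L2_norm M f = 0 \<longleftrightarrow> (AE x in M. f x = 0)"
  using integral_nonneg_eq_0_iff_AE[OF L2_integrable_square[OF assms]]
  by (simp add: L2_norm_def)

lemma L2_norm_scale: "L2_norm M (\<lambda>x. a * f x) = cmod a * L2_norm M f"
  by (simp add: L2_norm_def norm_mult power_mult_distrib real_sqrt_mult)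

lemma L2_Cauchy_Schwarz:
  assumes "f \<in> L2 M" "g \<in> L2 M"
  shows "cmod (L2_inner M f g) \<le> L2_norm M f * L2_norm M g"
proof (cases "L2_norm M g = 0")
  case True
  then have "AE x in M. g x = 0" using assms by (simp add: L2_norm_eq_0_iff)
  then have "L2_inner M f g = L2_inner M f (\<lambda>x. 0)"
    using assms by (intro L2_inner_cong_AE) (auto simp: L2_zero)
  then show ?thesis by (simp add: L2_inner_def)
next
  case False
  define N where "N = (L2_norm M g)\<^sup>2"
  define p where "p = L2_inner M f g"
  \<comment> \<open>\<open>h\<close> is the component of \<open>f\<close> orthogonal to
    \<open>g\<close>, multiplied by \<open>N\<close> to avoid a division. Hence its squared norm is
    \<open>N\<close> times its pairing with \<open>f\<close>, and nonnegativity of this number is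
    the claim.\<close>
  define h where "h = (\<lambda>x. complex_of_real N * f x + (- p) * g x)"
  have h: "h \<in> L2 M" unfolding h_def using assms by (rule L2_lincomb)
  have fh: "L2_inner M f h = of_real N * of_real ((L2_norm M f)\<^sup>2) - cnj p * p"
  proof -
    have "L2_inner M h f = of_real N * of_real ((L2_norm M f)\<^sup>2) - p * L2_inner M g f"
      unfolding h_def using assms by (subst L2_inner_lincomb_left) (auto simp: L2_inner_self)
    also have "L2_inner M g f = cnj p" unfolding p_def by (rule L2_inner_cnj)
    finally have "cnj (L2_inner M h f) = of_real N * of_real ((L2_norm M f)\<^sup>2) - cnj p * p"
      by simp
    then show ?thesis by (simp add: L2_inner_cnj[of M f h])
  qed
  have gh: "L2_inner M g h = 0"
  proof -
    have "L2_inner M h g = of_real N * p - p * of_real N"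
      unfolding h_def using assms by (subst L2_inner_lincomb_left) (auto simp: L2_inner_self p_def N_def)
    then show ?thesis by (subst L2_inner_cnj) simp
  qed
  have "complex_of_real ((L2_norm M h)\<^sup>2) = L2_inner M h h" by (simp add: L2_inner_self)
  also have "\<dots> = L2_inner M (\<lambda>x. complex_of_real N * f x + (- p) * g x) h"
    by (simp add: h_def)
  also have "\<dots> = complex_of_real N * L2_inner M f h + (- p) * L2_inner M g h"
    by (rule L2_inner_lincomb_left[OF assms h])
  also have "\<dots> = of_real (N * (N * (L2_norm M f)\<^sup>2 - (cmod p)\<^sup>2))"
    using complex_norm_square[of p] by (simp add: gh fh algebra_simps)
  finally have "0 \<le> N * (N * (L2_norm M f)\<^sup>2 - (cmod p)\<^sup>2)"
    by (metis of_real_eq_iff zero_le_power2)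
  moreover have "N > 0" using False by (simp add: N_def)
  ultimately have "(cmod p)\<^sup>2 \<le> N * (L2_norm M f)\<^sup>2"
    by (simp add: zero_le_mult_iff)
  then have "(cmod p)\<^sup>2 \<le> (L2_norm M f * L2_norm M g)\<^sup>2"
    by (simp add: N_def power_mult_distrib mult.commute)
  then show ?thesis unfolding p_def by (rule power2_le_imp_le) simp
qed

lemma L2_norm_add_square:
  assumes "f \<in> L2 M" "g \<in> L2 M"
  shows "(L2_norm M (\<lambda>x. f x + g x))\<^sup>2
    = (L2_norm M f)\<^sup>2 + (L2_norm M g)\<^sup>2 + 2 * Re (L2_inner M f g)"
proof -
  have fg: "(\<lambda>x. f x + g x) \<in> L2 M" using assms by (rule L2_add)
  have "L2_inner M (\<lambda>x. f x + g x) (\<lambda>x. f x + g x)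
     = L2_inner M f (\<lambda>x. f x + g x) + L2_inner M g (\<lambda>x. f x + g x)"
    using assms fg by (intro L2_inner_add_left)
  also have "L2_inner M f (\<lambda>x. f x + g x) = cnj (L2_inner M f f + L2_inner M g f)"
    by (subst L2_inner_cnj) (use assms in \<open>simp add: L2_inner_add_left\<close>)
  also have "L2_inner M g (\<lambda>x. f x + g x) = cnj (L2_inner M f g + L2_inner M g g)"
    by (subst L2_inner_cnj) (use assms in \<open>simp add: L2_inner_add_left\<close>)
  also have "L2_inner M g f = cnj (L2_inner M f g)" by (rule L2_inner_cnj)
  finally have "Re (L2_inner M (\<lambda>x. f x + g x) (\<lambda>x. f x + g x))
    = Re (L2_inner M f f) + Re (L2_inner M g g) + 2 * Re (L2_inner M f g)"
    by simp
  then show ?thesis unfolding L2_inner_self by simp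
qed

lemma L2_norm_triangle:
  assumes "f \<in> L2 M" "g \<in> L2 M"
  shows "L2_norm M (\<lambda>x. f x + g x) \<le> L2_norm M f + L2_norm M g"
proof (rule power2_le_imp_le)
  have "Re (L2_inner M f g) \<le> L2_norm M f * L2_norm M g"
    using L2_Cauchy_Schwarz[OF assms] complex_Re_le_cmod order_trans by blast
  then show "(L2_norm M (\<lambda>x. f x + g x))\<^sup>2 \<le> (L2_norm M f + L2_norm M g)\<^sup>2"
    by (simp add: L2_norm_add_square[OF assms] power2_sum)
qed simp

lemma L2_norm_triangle_diff:
  assumes "f \<in> L2 M" "g \<in> L2 M" "h \<in> L2 M"
  shows "L2_norm M (\<lambda>x. f x - h x) \<le> L2_norm M (\<lambda>x. f x - g x) + L2_norm M (\<lambda>x. g x - h x)"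
  using L2_norm_triangle[of "\<lambda>x. f x - g x" M "\<lambda>x. g x - h x"] assms
  by (simp add: L2_diff)

text \<open>The full preimage, among representatives, of a linear subspace of the quotient.
  Topological closedness is not demanded, so that dense unions of chains qualify as well.\<close>

definition L2_subspace :: "'b measure \<Rightarrow> ('b \<Rightarrow> complex) set \<Rightarrow> bool" where
  "L2_subspace M U \<longleftrightarrow> U \<subseteq> L2 M \<and> (\<lambda>_. 0) \<in> U \<and>
     (\<forall>f\<in>U. \<forall>g\<in>U. \<forall>a b. (\<lambda>x. a * f x + b * g x) \<in> U) \<and>
     (\<forall>f\<in>U. \<forall>g\<in>L2 M. (AE x in M. g x = f x) \<longrightarrow> g \<in> U)"

lemma L2_subspaceD:
  assumes "L2_subspace M U"
  shows L2_subspace_L2: "f \<in> U \<Longrightarrow> f \<in> L2 M"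
    and L2_subspace_zero: "(\<lambda>_. 0) \<in> U"
    and L2_subspace_lincomb: "f \<in> U \<Longrightarrow> g \<in> U \<Longrightarrow> (\<lambda>x. a * f x + b * g x) \<in> U"
    and L2_subspace_AE: "f \<in> U \<Longrightarrow> g \<in> L2 M \<Longrightarrow> (AE x in M. g x = f x) \<Longrightarrow> g \<in> U"
  using assms unfolding L2_subspace_def by blast+

lemma L2_subspace_scale: "L2_subspace M U \<Longrightarrow> f \<in> U \<Longrightarrow> (\<lambda>x. a * f x) \<in> U"
  using L2_subspace_lincomb[of M U f f a 0] by simp

lemma L2_subspace_add: "L2_subspace M U \<Longrightarrow> f \<in> U \<Longrightarrow> g \<in> U \<Longrightarrow> (\<lambda>x. f x + g x) \<in> U"
  using L2_subspace_lincomb[of M U f g 1 1] by simp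

lemma L2_subspace_diff: "L2_subspace M U \<Longrightarrow> f \<in> U \<Longrightarrow> g \<in> U \<Longrightarrow> (\<lambda>x. f x - g x) \<in> U"
  using L2_subspace_lincomb[of M U f g 1 "-1"] by simp

lemma L2_subspace_sum:
  assumes "L2_subspace M U" "\<And>i. i \<in> I \<Longrightarrow> f i \<in> U"
  shows "(\<lambda>x. \<Sum>i\<in>I. f i x) \<in> U"
  using assms(2)
  by (induction I rule: infinite_finite_induct)
    (auto intro: L2_subspace_zero L2_subspace_add assms(1))

lemma L2_subspace_Int:
  "L2_subspace M U \<Longrightarrow> L2_subspace M W \<Longrightarrow> L2_subspace M (U \<inter> W)"
  unfolding L2_subspace_def by blast

lemma L2_subspace_perp:
  assumes "U \<subseteq> L2 M"
  shows "L2_subspace M (L2_perp M U)"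
  unfolding L2_subspace_def
proof (intro conjI ballI allI impI)
  show "L2_perp M U \<subseteq> L2 M" by (auto simp: L2_perp_def)
  show "(\<lambda>_. 0) \<in> L2_perp M U" by (simp add: L2_perp_def L2_zero)
next
  fix f g a b assume "f \<in> L2_perp M U" "g \<in> L2_perp M U"
  then show "(\<lambda>x. a * f x + b * g x) \<in> L2_perp M U"
    using assms by (auto simp: L2_perp_def L2_lincomb L2_inner_lincomb_left subset_iff)
next
  fix f g assume *: "f \<in> L2_perp M U" "g \<in> L2 M" "AE x in M. g x = f x"
  have "L2_inner M g u = L2_inner M f u" if "u \<in> U" for u
    using * assms that by (intro L2_inner_cong_AE) (auto simp: L2_perp_def)
  then show "g \<in> L2_perp M U" using * by (auto simp: L2_perp_def)
qed

lemma L2_subspace_span: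
  assumes "B \<subseteq> L2 M"
  shows "L2_subspace M (L2_span M B)"
  unfolding L2_subspace_def
proof (intro conjI ballI allI impI)
  show "L2_span M B \<subseteq> L2 M" by (auto simp: L2_span_def)
  show "(\<lambda>_. 0) \<in> L2_span M B"
    by (auto simp: L2_span_def L2_zero intro!: exI[of _ "{}"])
next
  fix f g a b assume "f \<in> L2_span M B" "g \<in> L2_span M B"
  then obtain F c G d where F: "finite F" "F \<subseteq> B" "AE x in M. f x = (\<Sum>h\<in>F. c h * h x)"
    and G: "finite G" "G \<subseteq> B" "AE x in M. g x = (\<Sum>h\<in>G. d h * h x)"
    and fg: "f \<in> L2 M" "g \<in> L2 M"
    unfolding L2_span_def by blast
  \<comment> \<open>The two expansions live on different finite sets; extended by 0 they share the
    support \<open>F \<union> G\<close>.\<close>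
  define e where "e h = a * (if h \<in> F then c h else 0) + b * (if h \<in> G then d h else 0)" for h
  have "AE x in M. a * f x + b * g x = (\<Sum>h\<in>F \<union> G. e h * h x)"
    using F(3) G(3)
  proof eventually_elim
    fix x assume fx: "f x = (\<Sum>h\<in>F. c h * h x)" and gx: "g x = (\<Sum>h\<in>G. d h * h x)"
    have "f x = (\<Sum>h\<in>F \<union> G. (if h \<in> F then c h else 0) * h x)"
      unfolding fx by (rule sum.mono_neutral_cong_left) (use F G in auto)
    moreover have "g x = (\<Sum>h\<in>F \<union> G. (if h \<in> G then d h else 0) * h x)"
      unfolding gx by (rule sum.mono_neutral_cong_left) (use F G in auto)
    ultimately show "a * f x + b * g x = (\<Sum>h\<in>F \<union> G. e h * h x)"
      by (simp only: e_def distrib_right sum.distrib sum_distrib_left mult.assoc)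
  qed
  then show "(\<lambda>x. a * f x + b * g x) \<in> L2_span M B"
    using F G fg L2_lincomb[of f M g a b] unfolding L2_span_def
    by (intro CollectI conjI exI[of _ "F \<union> G"] exI[of _ e]) auto
next
  fix f g assume *: "f \<in> L2_span M B" "g \<in> L2 M" "AE x in M. g x = f x"
  then obtain F c where F: "finite F" "F \<subseteq> B" "AE x in M. f x = (\<Sum>h\<in>F. c h * h x)"
    unfolding L2_span_def by blast
  have "AE x in M. g x = (\<Sum>h\<in>F. c h * h x)"
    using *(3) F(3) by eventually_elim simp
  then show "g \<in> L2_span M B" using * F unfolding L2_span_def by blast
qed

lemma L2_span_base:
  assumes "f \<in> B" "f \<in> L2 M"
  shows "f \<in> L2_span M B"
  unfolding L2_span_def using assms
  by (intro CollectI conjI exI[of _ "{f}"] exI[of _ "\<lambda>_. 1"]) auto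

lemma L2_span_minimal:
  assumes "L2_subspace M U" "B \<subseteq> U"
  shows "L2_span M B \<subseteq> U"
proof
  fix f assume "f \<in> L2_span M B"
  then obtain F c where F: "F \<subseteq> B" "AE x in M. f x = (\<Sum>h\<in>F. c h * h x)" "f \<in> L2 M"
    unfolding L2_span_def by blast
  have "(\<lambda>x. \<Sum>h\<in>F. c h * h x) \<in> U"
    using F(1) assms by (intro L2_subspace_sum L2_subspace_scale) auto
  then show "f \<in> U" using F assms L2_subspace_AE by blast
qed

lemma L2_span_subspace:
  assumes "L2_subspace M U"
  shows "L2_span M U = U"
proof
  show "L2_span M U \<subseteq> U" using assms by (rule L2_span_minimal) simp
  show "U \<subseteq> L2_span M U" using assms by (auto intro: L2_span_base L2_subspace_L2)
qed

text \<open>The vectors orthogonal to \<open>f\<close> form a subspace; containing \<open>B\<close>,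
  it contains the span.\<close>

lemma L2_perp_span:
  assumes "B \<subseteq> L2 M" "f \<in> L2 M" "\<And>g. g \<in> B \<Longrightarrow> L2_inner M f g = 0"
  shows "f \<in> L2_perp M (L2_span M B)"
proof -
  have "L2_span M B \<subseteq> L2_perp M {f}"
    using assms by (intro L2_span_minimal L2_subspace_perp) (auto simp: L2_perp_def intro: L2_inner_eq_0_sym)
  then show ?thesis
    using assms(2) by (auto simp: L2_perp_def intro: L2_inner_eq_0_sym)
qed

lemma L2_perp_antimono: "U \<subseteq> W \<Longrightarrow> L2_perp M W \<subseteq> L2_perp M U"
  by (auto simp: L2_perp_def)

lemma L2_Int_perp_AE_0:
  assumes "f \<in> U" "f \<in> L2_perp M U"
  shows "AE x in M. f x = 0"
proof -
  have "f \<in> L2 M" "L2_inner M f f = 0" using assms by (auto simp: L2_perp_def)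
  then show ?thesis by (simp add: L2_inner_self L2_norm_eq_0_iff)
qed

section \<open>Closures and density\<close>

lemma L2_closure_base:
  assumes "U \<subseteq> L2 M" shows "U \<subseteq> L2_closure M U"
proof
  fix f assume f: "f \<in> U"
  have "L2_norm M (\<lambda>x. f x - f x) = 0" by (simp add: L2_norm_def)
  then show "f \<in> L2_closure M U" using f assms unfolding L2_closure_def by force
qed

lemma L2_subspace_closure:
  assumes U: "L2_subspace M U"
  shows "L2_subspace M (L2_closure M U)"
  unfolding L2_subspace_def
proof (intro conjI ballI allI impI)
  show "L2_closure M U \<subseteq> L2 M" by (auto simp: L2_closure_def)
  show "(\<lambda>_. 0) \<in> L2_closure M U"
    using L2_closure_base[of U M] L2_subspace_zero[OF U] L2_subspace_L2[OF U] by blast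
next
  fix f g a b assume f: "f \<in> L2_closure M U" and g: "g \<in> L2_closure M U"
  then have L2: "f \<in> L2 M" "g \<in> L2 M" by (auto simp: L2_closure_def)
  have "\<exists>h\<in>U. L2_norm M (\<lambda>x. (a * f x + b * g x) - h x) < e" if "e > 0" for e
  proof -
    \<comment> \<open>The summand 1 keeps the denominator positive when \<open>a = b = 0\<close> and
      makes the final estimate strict.\<close>
    define d where "d = e / (cmod a + cmod b + 1)"
    have pos: "cmod a + cmod b + 1 > 0" by (simp add: add_nonneg_pos)
    then have "d > 0" using that by (simp add: d_def)
    then obtain u w where u: "u \<in> U" "L2_norm M (\<lambda>x. f x - u x) < d"
      and w: "w \<in> U" "L2_norm M (\<lambda>x. g x - w x) < d"
      using f g unfolding L2_closure_def by blast
    have "L2_norm M (\<lambda>x. (a * f x + b * g x) - (a * u x + b * w x))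
        = L2_norm M (\<lambda>x. a * (f x - u x) + b * (g x - w x))"
      by (simp add: algebra_simps)
    also have "\<dots> \<le> L2_norm M (\<lambda>x. a * (f x - u x)) + L2_norm M (\<lambda>x. b * (g x - w x))"
      using L2 u(1) w(1) U by (intro L2_norm_triangle L2_scale L2_diff) (auto intro: L2_subspace_L2)
    also have "\<dots> = cmod a * L2_norm M (\<lambda>x. f x - u x) + cmod b * L2_norm M (\<lambda>x. g x - w x)"
      by (simp only: L2_norm_scale)
    also have "\<dots> \<le> cmod a * d + cmod b * d"
      using u w by (intro add_mono mult_left_mono) auto
    also have "\<dots> < (cmod a + cmod b + 1) * d" using \<open>d > 0\<close> by (simp add: algebra_simps)
    also have "\<dots> = e" using pos by (simp add: d_def)
    finally show ?thesis by (rule bexI[OF _ L2_subspace_lincomb[OF U u(1) w(1)]])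
  qed
  then show "(\<lambda>x. a * f x + b * g x) \<in> L2_closure M U"
    using L2_lincomb[OF L2] by (simp add: L2_closure_def)
next
  fix f g assume *: "f \<in> L2_closure M U" "g \<in> L2 M" "AE x in M. g x = f x"
  have "L2_norm M (\<lambda>x. g x - h x) = L2_norm M (\<lambda>x. f x - h x)" if "h \<in> U" for h
    using * L2_subspace_L2[OF U that]
    by (intro L2_norm_cong_AE L2_diff) (auto simp: L2_closure_def)
  then show "g \<in> L2_closure M U"
    using * unfolding L2_closure_def by simp
qed

lemma L2_closure_mono: "U \<subseteq> W \<Longrightarrow> L2_closure M U \<subseteq> L2_closure M W"
  unfolding L2_closure_def by blast

text \<open>Idempotence of the closure in sequential form: an approximant of a nearby
  \<open>g n\<close> also approximates \<open>f\<close>, at the cost of e/2 twice.\<close>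

lemma L2_closure_limit:
  assumes U: "L2_subspace M U" and f: "f \<in> L2 M" and g: "\<And>n. g n \<in> L2_closure M U"
    and lim: "(\<lambda>n. L2_norm M (\<lambda>x. f x - g n x)) \<longlonglongrightarrow> 0"
  shows "f \<in> L2_closure M U"
  unfolding L2_closure_def
proof (intro CollectI conjI allI impI f)
  fix e :: real assume "e > 0"
  then have "\<forall>\<^sub>F n in sequentially. L2_norm M (\<lambda>x. f x - g n x) < e / 2"
    using lim by (intro order_tendstoD) auto
  then obtain n where n: "L2_norm M (\<lambda>x. f x - g n x) < e / 2"
    by (auto dest: eventually_happens)
  obtain h where h: "h \<in> U" "L2_norm M (\<lambda>x. g n x - h x) < e / 2"
    using g[of n] \<open>e > 0\<close> unfolding L2_closure_def by (auto dest: spec[of _ "e / 2"])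
  have "L2_norm M (\<lambda>x. f x - h x) \<le> L2_norm M (\<lambda>x. f x - g n x) + L2_norm M (\<lambda>x. g n x - h x)"
    using f g[of n] h U by (intro L2_norm_triangle_diff) (auto simp: L2_closure_def intro: L2_subspace_L2)
  then show "\<exists>h\<in>U. L2_norm M (\<lambda>x. f x - h x) < e" using n h by force
qed

lemma L2_indicator:
  assumes "finite_measure M" "A \<in> sets M"
  shows "indicator A \<in> L2 M"
proof -
  have "(cmod (indicator A x))\<^sup>2 = indicat_real A x" for x
    by (simp add: indicator_def)
  then show ?thesis
    using assms finite_measure.emeasure_finite[OF assms(1), of A]
    by (simp add: L2_def integrable_real_indicator top.not_eq_extremum)
qed

lemma L2_inner_indicator:
  assumes "finite_measure M" "A \<in> sets M" "B \<in> sets M"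
  shows "L2_inner M (indicator A) (indicator B) = of_real (measure M (A \<inter> B))"
proof -
  have "indicator A x * cnj (indicator B x) = complex_of_real (indicator (A \<inter> B) x)" for x
    by (simp add: indicator_def)
  then show ?thesis
    using assms by (simp add: L2_inner_def sets.Int_space_eq2 sets.Int)
qed

text \<open>The sets whose indicators lie in the closure form a Dynkin system, so a generating
  pi-system suffices. Simple functions follow by linearity, and all of \<open>L2 M\<close> by
  dominated convergence.\<close>

lemma L2_closure_generator:
  assumes fin: "finite_measure M" and U: "L2_subspace M U"
    and G: "Int_stable G" "G \<subseteq> Pow (space M)" "sets M = sigma_sets (space M) G"
    and ind: "\<And>A. A \<in> G \<Longrightarrow> indicator A \<in> U" and one: "(\<lambda>_. 1) \<in> U"
  shows "L2_closure M U = L2 M"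
proof
  let ?H = "L2_closure M U"
  interpret finite_measure M by (rule fin)
  show "?H \<subseteq> L2 M" by (auto simp: L2_closure_def)
  have UL2: "U \<subseteq> L2 M" using U by (auto intro: L2_subspace_L2)
  have UH: "U \<subseteq> ?H" using UL2 by (rule L2_closure_base)
  have H: "L2_subspace M ?H" using U by (rule L2_subspace_closure)
  have indH: "indicator A \<in> ?H" if A: "A \<in> sigma_sets (space M) G" for A
    using G(1,2) A
  proof (induction rule: sigma_sets_induct_disjoint)
    case (basic A) then show ?case using ind UH by blast
  next
    case empty
    have "indicator {} = (\<lambda>_. 0 :: complex)" by auto
    then show ?case using L2_subspace_zero[OF H] by simp
  next
    case (compl A)
    have "(\<lambda>x. 1 - indicator A x) \<in> ?H"
      using one UH compl by (intro L2_subspace_diff[OF H]) auto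
    moreover have "indicator (space M - A) \<in> L2 M"
      using compl(1) G(3) fin by (intro L2_indicator) (metis sets.compl_sets)+
    \<comment> \<open>Outside \<open>space M\<close> the two functions are 0 and 1, so they agree
      only almost everywhere.\<close>
    moreover have "AE x in M. indicator (space M - A) x = (1 - indicator A x :: complex)"
      by (rule AE_I2) (auto simp: indicator_def)
    ultimately show ?case by (rule L2_subspace_AE[OF H])
  next
    case (union A)
    have meas: "A i \<in> sets M" for i using union G(3) by auto
    have UnL2: "indicator (\<Union>i. A i) \<in> L2 M" using meas fin by (intro L2_indicator) auto
    show ?case
    proof (rule L2_closure_limit[OF U UnL2])
      show "(\<lambda>x. \<Sum>i<n. indicator (A i) x) \<in> ?H" for n
        using union H by (intro L2_subspace_sum) auto
      \<comment> \<open>Disjointness makes the error the indicator of the remaining tail. Its norm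
        is the square root of a tail measure, which tends to 0 by countable additivity.\<close>
      have "L2_norm M (\<lambda>x. indicator (\<Union>i. A i) x - (\<Sum>i<n. indicator (A i) x))
          = sqrt (measure M (\<Union>i. A i) - (\<Sum>i<n. measure M (A i)))" for n
      proof -
        have disj: "disjoint_family_on A {..<n}"
          using union(1) by (auto simp: disjoint_family_on_def)
        have "indicator (\<Union>i. A i) x - (\<Sum>i<n. indicator (A i) x)
            = (indicator ((\<Union>i. A i) - (\<Union>i<n. A i)) x :: complex)" for x
        proof -
          have "(\<Sum>i<n. indicator (A i) x) = (indicator (\<Union>i<n. A i) x :: complex)"
            using disj by (subst indicator_UN_disjoint) auto
          then show ?thesis by (auto simp: indicator_def)
        qed
        then have "L2_norm M (\<lambda>x. indicator (\<Union>i. A i) x - (\<Sum>i<n. indicator (A i) x))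
          = L2_norm M (indicator ((\<Union>i. A i) - (\<Union>i<n. A i)))" by simp
        also have "\<dots> = sqrt (measure M ((\<Union>i. A i) - (\<Union>i<n. A i)))"
        proof -
          have sq: "(cmod (indicator B x))\<^sup>2 = indicat_real B x" for B x
            by (simp add: indicator_def)
          have "(\<Union>i. A i) - (\<Union>i<n. A i) \<in> sets M" using meas by auto
          then show ?thesis unfolding L2_norm_def sq by (simp add: sets.Int_space_eq2)
        qed
        also have "measure M ((\<Union>i. A i) - (\<Union>i<n. A i)) = measure M (\<Union>i. A i) - measure M (\<Union>i<n. A i)"
          using meas by (intro finite_measure_Diff) auto
        also have "measure M (\<Union>i<n. A i) = (\<Sum>i<n. measure M (A i))"
          using meas disj by (intro finite_measure_finite_Union) auto
        finally show ?thesis .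
      qed
      moreover have "(\<lambda>n. sqrt (measure M (\<Union>i. A i) - (\<Sum>i<n. measure M (A i))))
          \<longlonglongrightarrow> sqrt (measure M (\<Union>i. A i) - measure M (\<Union>i. A i))"
        using finite_measure_UNION[of A] union(1) meas
        by (intro tendsto_intros) (auto simp: sums_def)
      ultimately show "(\<lambda>n. L2_norm M (\<lambda>x. indicator (\<Union>i. A i) x - (\<Sum>i<n. indicator (A i) x))) \<longlonglongrightarrow> 0"
        by simp
    qed
  qed
  show "L2 M \<subseteq> ?H"
  proof
    fix f assume f: "f \<in> L2 M"
    have "\<exists>s. (\<forall>i. simple_function M (s i)) \<and> (\<forall>x\<in>space M. (\<lambda>i. s i x) \<longlonglongrightarrow> f x)
        \<and> (\<forall>i. \<forall>x\<in>space M. cmod (s i x) \<le> 2 * cmod (f x))"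
      using borel_measurable_implies_sequence_metric[OF L2_measurable[OF f], of 0]
      by (simp add: dist_norm)
    then obtain s where
      s: "\<And>i. simple_function M (s i)" and lim: "\<And>x. x \<in> space M \<Longrightarrow> (\<lambda>i. s i x) \<longlonglongrightarrow> f x"
      and bd: "\<And>i x. x \<in> space M \<Longrightarrow> cmod (s i x) \<le> 2 * cmod (f x)"
      by blast
    have sL2: "s i \<in> L2 M" for i
    proof -
      have m: "s i \<in> borel_measurable M" using s by (rule borel_measurable_simple_function)
      moreover have "integrable M (\<lambda>x. (cmod (s i x))\<^sup>2)"
      proof (rule Bochner_Integration.integrable_bound)
        show "integrable M (\<lambda>x. 4 * (cmod (f x))\<^sup>2)"
          using f by (intro integrable_mult_right L2_integrable_square)
        have "(cmod (s i x))\<^sup>2 \<le> 4 * (cmod (f x))\<^sup>2" if "x \<in> space M" for x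
          using power_mono[OF bd[OF that, of i], of 2] by (simp add: power_mult_distrib)
        then show "AE x in M. norm ((cmod (s i x))\<^sup>2) \<le> norm (4 * (cmod (f x))\<^sup>2)"
          by (intro AE_I2) simp
      qed (use m in measurable)
      ultimately show ?thesis by (simp add: L2_def)
    qed
    show "f \<in> ?H"
    proof (rule L2_closure_limit[OF U f])
      fix i
      have "(\<lambda>x. \<Sum>y\<in>s i ` space M. y * indicator (s i -` {y} \<inter> space M) x) \<in> ?H"
        using G(3) simple_functionD(2)[OF s] by (intro L2_subspace_sum[OF H] L2_subspace_scale[OF H] indH) auto
      moreover have "s i x = (\<Sum>y\<in>s i ` space M. y * indicator (s i -` {y} \<inter> space M) x)"
        if "x \<in> space M" for x
      proof -
        have "(\<Sum>y\<in>s i ` space M. y * indicator (s i -` {y} \<inter> space M) x)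
           = (\<Sum>y\<in>s i ` space M. if y = s i x then s i x else 0)"
          using that by (intro sum.cong) (auto simp: indicator_def)
        also have "\<dots> = s i x" using that simple_functionD(1)[OF s[of i]] by simp
        finally show ?thesis by simp
      qed
      then have "AE x in M. s i x = (\<Sum>y\<in>s i ` space M. y * indicator (s i -` {y} \<inter> space M) x)"
        by (rule AE_I2)
      ultimately show "s i \<in> ?H" by (rule L2_subspace_AE[OF H _ sL2])
    next
      \<comment> \<open>The bound \<open>2 * cmod (f x)\<close> on the simple functions gives
        \<open>3 * cmod (f x)\<close> for the difference, whence the factor 9 in the dominating
        function.\<close>
      have "(\<lambda>i. \<integral>x. (cmod (f x - s i x))\<^sup>2 \<partial>M) \<longlonglongrightarrow> (\<integral>x. 0 \<partial>M)"
      proof (rule integral_dominated_convergence[where w = "\<lambda>x. 9 * (cmod (f x))\<^sup>2"])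
        show "(\<lambda>x. 0) \<in> borel_measurable M" by simp
        show "(\<lambda>x. (cmod (f x - s i x))\<^sup>2) \<in> borel_measurable M" for i
          using L2_measurable[OF L2_diff[OF f sL2[of i]]] by measurable
        show "integrable M (\<lambda>x. 9 * (cmod (f x))\<^sup>2)"
          using f by (intro integrable_mult_right L2_integrable_square)
        show "AE x in M. (\<lambda>i. (cmod (f x - s i x))\<^sup>2) \<longlonglongrightarrow> 0"
        proof (rule AE_I2)
          fix x assume "x \<in> space M"
          then have "(\<lambda>i. (cmod (f x - s i x))\<^sup>2) \<longlonglongrightarrow> (cmod (f x - f x))\<^sup>2"
            by (intro tendsto_intros lim)
          then show "(\<lambda>i. (cmod (f x - s i x))\<^sup>2) \<longlonglongrightarrow> 0" by simp
        qed
        show "AE x in M. norm ((cmod (f x - s i x))\<^sup>2) \<le> 9 * (cmod (f x))\<^sup>2" for i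
        proof (rule AE_I2)
          fix x assume x: "x \<in> space M"
          have "cmod (f x - s i x) \<le> 3 * cmod (f x)"
            using norm_triangle_ineq4[of "f x" "s i x"] bd[OF x, of i] by simp
          then have "(cmod (f x - s i x))\<^sup>2 \<le> (3 * cmod (f x))\<^sup>2" by (rule power_mono) simp
          then show "norm ((cmod (f x - s i x))\<^sup>2) \<le> 9 * (cmod (f x))\<^sup>2"
            by (simp add: power_mult_distrib)
        qed
      qed
      then show "(\<lambda>i. L2_norm M (\<lambda>x. f x - s i x)) \<longlonglongrightarrow> 0"
        unfolding L2_norm_def using tendsto_real_sqrt by fastforce
    qed
  qed
qed

text \<open>In \<open>L2_span\<close> coefficients are attached to functions. Here they are indexed
  by \<open>I\<close>, without asking \<open>b\<close> to be injective, so that sums over paths can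
  be manipulated directly.\<close>

lemma L2_span_image:
  assumes "finite I" and b: "\<And>i. i \<in> I \<Longrightarrow> b i \<in> L2 M" and "f \<in> L2_span M (b ` I)"
  shows "\<exists>c. AE x in M. f x = (\<Sum>i\<in>I. c i * b i x)"
proof -
  define U where "U = {f \<in> L2 M. \<exists>c. AE x in M. f x = (\<Sum>i\<in>I. c i * b i x)}"
  have "L2_subspace M U"
    unfolding L2_subspace_def
  proof (intro conjI ballI allI impI)
    show "U \<subseteq> L2 M" by (auto simp: U_def)
    show "(\<lambda>_. 0) \<in> U" by (auto simp: U_def L2_zero intro!: exI[of _ "\<lambda>_. 0"])
  next
    fix f g s t assume "f \<in> U" "g \<in> U"
    then obtain c d where L2: "f \<in> L2 M" "g \<in> L2 M"
      and c: "AE x in M. f x = (\<Sum>i\<in>I. c i * b i x)" and d: "AE x in M. g x = (\<Sum>i\<in>I. d i * b i x)"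
      unfolding U_def by blast
    have "AE x in M. s * f x + t * g x = (\<Sum>i\<in>I. (s * c i + t * d i) * b i x)"
      using c d by eventually_elim (simp add: sum_distrib_left sum.distrib distrib_right mult.assoc)
    then show "(\<lambda>x. s * f x + t * g x) \<in> U"
      unfolding U_def using L2_lincomb[OF L2] by (intro CollectI conjI exI) auto
  next
    fix f g assume "f \<in> U" "g \<in> L2 M" "AE x in M. g x = f x"
    then obtain c where c: "AE x in M. f x = (\<Sum>i\<in>I. c i * b i x)"
      unfolding U_def by blast
    have "AE x in M. g x = (\<Sum>i\<in>I. c i * b i x)"
      using c \<open>AE x in M. g x = f x\<close> by eventually_elim simp
    then show "g \<in> U" using \<open>g \<in> L2 M\<close> unfolding U_def by blast
  qed
  moreover have "b ` I \<subseteq> U"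
  proof
    fix g assume "g \<in> b ` I"
    then obtain j where j: "j \<in> I" "g = b j" by blast
    have "g x = (\<Sum>i\<in>I. (if i = j then 1 else 0) * b i x)" for x
      using assms(1) j by (simp add: if_distrib[of "\<lambda>c. c * _"] cong: if_cong)
    then have "\<exists>c. AE x in M. g x = (\<Sum>i\<in>I. c i * b i x)"
      by (intro exI[of _ "\<lambda>i. if i = j then 1 else 0"] AE_I2)
    then show "g \<in> U" using b[OF j(1)] j(2) by (simp add: U_def)
  qed
  ultimately have "L2_span M (b ` I) \<subseteq> U" by (rule L2_span_minimal)
  then show ?thesis using assms(3) by (auto simp: U_def)
qed

section \<open>Bounded operators up to equality almost everywhere\<close>

context
  fixes M :: "'b measure" and T
  assumes T: "L2_bounded_operator M T"
begin

lemma bounded_operator_L2: "f \<in> L2 M \<Longrightarrow> T f \<in> L2 M"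
  using T by (simp add: L2_bounded_operator_def)

lemma bounded_operator_lincomb:
  "f \<in> L2 M \<Longrightarrow> g \<in> L2 M \<Longrightarrow>
    AE x in M. T (\<lambda>y. a * f y + b * g y) x = a * T f x + b * T g x"
  using T by (simp add: L2_bounded_operator_def)

text \<open>Compatibility with classes is a consequence of boundedness: the image of a null function
  has norm at most \<open>K * 0\<close>.\<close>

lemma bounded_operator_cong_AE:
  assumes f: "f \<in> L2 M" and g: "g \<in> L2 M" and eq: "AE x in M. f x = g x"
  shows "AE x in M. T f x = T g x"
proof -
  let ?d = "\<lambda>x. 1 * f x + (- 1) * g x"
  obtain K where K: "\<And>f. f \<in> L2 M \<Longrightarrow> L2_norm M (T f) \<le> K * L2_norm M f"
    using T unfolding L2_bounded_operator_def by blast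
  have d: "?d \<in> L2 M" using f g by (rule L2_lincomb)
  have "AE x in M. ?d x = 0" using eq by eventually_elim simp
  then have "L2_norm M ?d = 0" using L2_norm_eq_0_iff[OF d] by simp
  then have "L2_norm M (T ?d) \<le> 0" using K[OF d] by simp
  then have "L2_norm M (T ?d) = 0" by (intro antisym) simp_all
  then have "AE x in M. T ?d x = 0" using L2_norm_eq_0_iff[OF bounded_operator_L2[OF d]] by simp
  with bounded_operator_lincomb[OF f g, of 1 "- 1"] show ?thesis by eventually_elim simp
qed

lemma bounded_operator_sum:
  assumes "finite I" and b: "\<And>i. i \<in> I \<Longrightarrow> b i \<in> L2 M"
  shows "AE x in M. T (\<lambda>y. \<Sum>i\<in>I. c i * b i y) x = (\<Sum>i\<in>I. c i * T (b i) x)"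
  using assms
proof (induction I rule: finite_induct)
  case empty
  show ?case using bounded_operator_lincomb[OF L2_zero L2_zero, of 0 0] by simp
next
  case (insert j I)
  have "(\<lambda>y. \<Sum>i\<in>I. c i * b i y) \<in> L2 M"
    using insert.prems by (intro L2_sum L2_scale) auto
  from bounded_operator_lincomb[OF insert.prems[OF insertI1] this, of "c j" 1]
  have "AE x in M. T (\<lambda>y. c j * b j y + (\<Sum>i\<in>I. c i * b i y)) x
      = c j * T (b j) x + T (\<lambda>y. \<Sum>i\<in>I. c i * b i y) x" by simp
  moreover have "AE x in M. T (\<lambda>y. \<Sum>i\<in>I. c i * b i y) x = (\<Sum>i\<in>I. c i * T (b i) x)"
    using insert by simp
  ultimately have "AE x in M. T (\<lambda>y. c j * b j y + (\<Sum>i\<in>I. c i * b i y)) x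
      = c j * T (b j) x + (\<Sum>i\<in>I. c i * T (b i) x)"
    by eventually_elim simp
  then show ?case by (simp add: insert.hyps)
qed

end

lemma L2_subspace_UN_chain:
  assumes S: "\<And>n. L2_subspace M (E n)" and step: "\<And>n. E n \<subseteq> E (Suc n)"
  shows "L2_subspace M (\<Union>n. E n)"
  unfolding L2_subspace_def
proof (intro conjI ballI allI impI)
  have mono: "m \<le> n \<Longrightarrow> E m \<subseteq> E n" for m n using step by (rule lift_Suc_mono_le)
  show "(\<Union>n. E n) \<subseteq> L2 M" using L2_subspace_L2[OF S] by blast
  show "(\<lambda>_. 0) \<in> (\<Union>n. E n)" using L2_subspace_zero[OF S] by blast
  show "g \<in> (\<Union>n. E n)" if "f \<in> (\<Union>n. E n)" "g \<in> L2 M" "AE x in M. g x = f x" for f g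
    using that L2_subspace_AE[OF S] by blast
  fix f g a b assume "f \<in> (\<Union>n. E n)" "g \<in> (\<Union>n. E n)"
  then obtain m n where "f \<in> E m" "g \<in> E n" by blast
  then have "f \<in> E (max m n)" "g \<in> E (max m n)"
    using mono[of m "max m n"] mono[of n "max m n"] by auto
  from L2_subspace_lincomb[OF S this, of a b]
  show "(\<lambda>x. a * f x + b * g x) \<in> (\<Union>n. E n)" by (rule UN_I[OF UNIV_I])
qed

section \<open>Filtrations and their eigenspaces\<close>

text \<open>Existence of the orthogonal decomposition along \<open>U\<close>, which is what gives
  the choice in \<open>L2_projection\<close> its meaning.\<close>

definition L2_complemented :: "'b measure \<Rightarrow> ('b \<Rightarrow> complex) set \<Rightarrow> bool" where
  "L2_complemented M U \<longleftrightarrow> L2_subspace M U \<and>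
     (\<forall>f\<in>L2 M. \<exists>g\<in>U. (\<lambda>x. f x - g x) \<in> L2_perp M U)"

lemma L2_complemented_subspace: "L2_complemented M U \<Longrightarrow> L2_subspace M U"
  by (simp add: L2_complemented_def)

lemma L2_complemented_L2: "L2_complemented M U \<Longrightarrow> U \<subseteq> L2 M"
  by (auto simp: L2_complemented_def L2_subspace_def)

lemma L2_complemented_perp_subspace: "L2_complemented M U \<Longrightarrow> L2_subspace M (L2_perp M U)"
  by (intro L2_subspace_perp L2_complemented_L2)

lemma L2_projection:
  assumes "L2_complemented M U" "f \<in> L2 M"
  shows L2_projection_in: "L2_projection M U f \<in> U"
    and L2_projection_perp: "(\<lambda>x. f x - L2_projection M U f x) \<in> L2_perp M U"
proof -
  have "\<exists>g. g \<in> U \<and> (\<lambda>x. f x - g x) \<in> L2_perp M U"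
    using assms unfolding L2_complemented_def by blast
  from someI_ex[OF this] show "L2_projection M U f \<in> U"
    and "(\<lambda>x. f x - L2_projection M U f x) \<in> L2_perp M U"
    by (simp_all add: L2_projection_def)
qed

text \<open>Two candidates differ by a vector that lies both in \<open>U\<close> and in its
  orthogonal complement. This is how chosen projections are identified in all that follows.\<close>

lemma L2_projection_unique:
  assumes U: "L2_complemented M U" and f: "f \<in> L2 M"
    and g: "g \<in> U" "(\<lambda>x. f x - g x) \<in> L2_perp M U"
  shows "AE x in M. L2_projection M U f x = g x"
proof -
  let ?p = "L2_projection M U f"
  have S: "L2_subspace M U" using U by (rule L2_complemented_subspace)
  have "L2_subspace M (L2_perp M U)" using U by (rule L2_complemented_perp_subspace)
  from L2_subspace_diff[OF this g(2) L2_projection_perp[OF U f]]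
  have "(\<lambda>x. ?p x - g x) \<in> L2_perp M U" by simp
  moreover have "(\<lambda>x. ?p x - g x) \<in> U"
    using L2_projection_in[OF U f] g(1) by (rule L2_subspace_diff[OF S])
  ultimately have "AE x in M. ?p x - g x = 0" by (rule L2_Int_perp_AE_0[rotated])
  then show ?thesis by simp
qed

lemma L2_projection_L2:
  assumes "L2_complemented M U" "f \<in> L2 M"
  shows "L2_projection M U f \<in> L2 M"
  using L2_projection_in[OF assms] L2_complemented_subspace[OF assms(1)] by (rule L2_subspace_L2[rotated])

lemma L2_projection_id:
  assumes "L2_complemented M U" "f \<in> U"
  shows "AE x in M. L2_projection M U f x = f x"
proof (rule L2_projection_unique[OF assms(1) _ assms(2)])
  show "f \<in> L2 M" using assms L2_complemented_L2 by blast
  show "(\<lambda>x. f x - f x) \<in> L2_perp M U" by (simp add: L2_perp_def L2_zero)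
qed

lemma L2_projection_of_perp:
  assumes "L2_complemented M U" "f \<in> L2_perp M U"
  shows "AE x in M. L2_projection M U f x = 0"
proof (rule L2_projection_unique[OF assms(1)])
  show "f \<in> L2 M" using assms(2) by (simp add: L2_perp_def)
  show "(\<lambda>x. 0) \<in> U" using assms(1) by (intro L2_subspace_zero L2_complemented_subspace)
  show "(\<lambda>x. f x - 0) \<in> L2_perp M U" using assms(2) by simp
qed

lemma L2_projection_lincomb:
  assumes U: "L2_complemented M U" and f: "f \<in> L2 M" and g: "g \<in> L2 M"
  shows "AE x in M. L2_projection M U (\<lambda>x. a * f x + b * g x) x
    = a * L2_projection M U f x + b * L2_projection M U g x"
proof (rule L2_projection_unique[OF U L2_lincomb[OF f g]])
  have S: "L2_subspace M U" using U by (rule L2_complemented_subspace)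
  have P: "L2_subspace M (L2_perp M U)" using U by (rule L2_complemented_perp_subspace)
  show "(\<lambda>x. a * L2_projection M U f x + b * L2_projection M U g x) \<in> U"
    using S U f g by (intro L2_subspace_lincomb L2_projection_in)
  have "(\<lambda>x. a * (f x - L2_projection M U f x) + b * (g x - L2_projection M U g x)) \<in> L2_perp M U"
    using U f g by (intro L2_subspace_lincomb[OF P] L2_projection_perp)
  then show "(\<lambda>x. a * f x + b * g x - (a * L2_projection M U f x + b * L2_projection M U g x)) \<in> L2_perp M U"
    by (simp add: algebra_simps)
qed

lemma L2_projection_cong_AE:
  assumes U: "L2_complemented M U" and f: "f \<in> L2 M" and g: "g \<in> L2 M"
    and "AE x in M. f x = g x"
  shows "AE x in M. L2_projection M U f x = L2_projection M U g x"
proof (rule L2_projection_unique[OF U f])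
  show "L2_projection M U g \<in> U" using U g by (rule L2_projection_in)
  have "AE x in M. f x - L2_projection M U g x = g x - L2_projection M U g x"
    using assms(4) by eventually_elim simp
  then show "(\<lambda>x. f x - L2_projection M U g x) \<in> L2_perp M U"
    by (rule L2_subspace_AE[OF L2_complemented_perp_subspace[OF U] L2_projection_perp[OF U g]
          L2_diff[OF f L2_projection_L2[OF U g]]])
qed

text \<open>Pythagoras: f - g splits into f - p, orthogonal to \<open>U\<close>, and p - g, which
  lies in \<open>U\<close>, where p is the projection.\<close>

lemma L2_projection_best_approximation:
  assumes U: "L2_complemented M U" and f: "f \<in> L2 M" and g: "g \<in> U"
  shows "L2_norm M (\<lambda>x. f x - L2_projection M U f x) \<le> L2_norm M (\<lambda>x. f x - g x)"
proof (rule power2_le_imp_le)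
  let ?p = "L2_projection M U f"
  have S: "L2_subspace M U" using U by (rule L2_complemented_subspace)
  have d: "(\<lambda>x. ?p x - g x) \<in> U"
    using S L2_projection_in[OF U f] g by (rule L2_subspace_diff)
  have e: "(\<lambda>x. f x - ?p x) \<in> L2_perp M U" using U f by (rule L2_projection_perp)
  have "(L2_norm M (\<lambda>x. f x - g x))\<^sup>2 = (L2_norm M (\<lambda>x. (f x - ?p x) + (?p x - g x)))\<^sup>2" by simp
  also have "\<dots> = (L2_norm M (\<lambda>x. f x - ?p x))\<^sup>2 + (L2_norm M (\<lambda>x. ?p x - g x))\<^sup>2"
    using d e L2_subspace_L2[OF S d] by (subst L2_norm_add_square) (auto simp: L2_perp_def)
  finally show "(L2_norm M (\<lambda>x. f x - ?p x))\<^sup>2 \<le> (L2_norm M (\<lambda>x. f x - g x))\<^sup>2" by simp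
qed simp

text \<open>The projection is the finite Fourier sum with coefficients <f,b>/<b,b>; the norms are
  nonzero to permit the division.\<close>

lemma L2_complemented_span_orthogonal:
  assumes B: "finite B" "B \<subseteq> L2 M" "\<And>g. g \<in> B \<Longrightarrow> L2_norm M g \<noteq> 0"
    and orth: "\<And>g h. g \<in> B \<Longrightarrow> h \<in> B \<Longrightarrow> g \<noteq> h \<Longrightarrow> L2_inner M g h = 0"
  shows "L2_complemented M (L2_span M B)"
  unfolding L2_complemented_def
proof (intro conjI ballI)
  show S: "L2_subspace M (L2_span M B)" using B by (intro L2_subspace_span)
  fix f assume f: "f \<in> L2 M"
  define c where "c b = L2_inner M f b / L2_inner M b b" for b
  define g where "g = (\<lambda>x. \<Sum>b\<in>B. c b * b x)"
  have g: "g \<in> L2_span M B" unfolding g_def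
    using B S by (intro L2_subspace_sum L2_subspace_scale L2_span_base) auto
  have gL2: "g \<in> L2 M" using S g by (rule L2_subspace_L2)
  have "(\<lambda>x. f x - g x) \<in> L2_perp M (L2_span M B)"
  proof (rule L2_perp_span[OF B(2) L2_diff[OF f gL2]])
    fix b assume b: "b \<in> B"
    have "L2_inner M g b = (\<Sum>b'\<in>B. c b' * L2_inner M b' b)"
      unfolding g_def using B b by (subst L2_inner_sum_left) (auto intro!: L2_scale simp: L2_inner_scale_left)
    also have "\<dots> = (\<Sum>b'\<in>B. if b' = b then c b * L2_inner M b b else 0)"
      using b by (intro sum.cong) (auto simp: orth)
    also have "\<dots> = c b * L2_inner M b b" using B b by simp
    also have "\<dots> = L2_inner M f b" using B b by (simp add: c_def L2_inner_self)
    finally show "L2_inner M (\<lambda>x. f x - g x) b = 0"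
      using f gL2 b B by (subst L2_inner_diff_left) auto
  qed
  then show "\<exists>g\<in>L2_span M B. (\<lambda>x. f x - g x) \<in> L2_perp M (L2_span M B)" using g by blast
qed

text \<open>A vector of \<open>X\<close> minus its projection onto \<open>U\<close> remains in
  \<open>X\<close>, because \<open>U\<close> does.\<close>

lemma L2_direct_sum_complement:
  assumes U: "L2_complemented M U" and X: "L2_subspace M X" and sub: "U \<subseteq> X"
  shows "L2_direct_sum M X (X \<inter> L2_perp M U) U"
  unfolding L2_direct_sum_def
proof
  show "L2_orthogonal M (X \<inter> L2_perp M U) U" by (auto simp: L2_orthogonal_def L2_perp_def)
  show "X = {f \<in> L2 M. \<exists>u\<in>X \<inter> L2_perp M U. \<exists>w\<in>U. AE x in M. f x = u x + w x}"
  proof (intro equalityI subsetI CollectI conjI)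
    fix f assume f: "f \<in> X"
    then show L2: "f \<in> L2 M" using X by (rule L2_subspace_L2[rotated])
    have "(\<lambda>x. f x - L2_projection M U f x) \<in> X \<inter> L2_perp M U"
      using L2_projection[OF U L2] sub f by (auto intro: L2_subspace_diff[OF X])
    then show "\<exists>u\<in>X \<inter> L2_perp M U. \<exists>w\<in>U. AE x in M. f x = u x + w x"
      using L2_projection_in[OF U L2] by (intro bexI[of _ "\<lambda>x. f x - L2_projection M U f x"] bexI) auto
  next
    fix f assume "f \<in> {f \<in> L2 M. \<exists>u\<in>X \<inter> L2_perp M U. \<exists>w\<in>U. AE x in M. f x = u x + w x}"
    then obtain u w where "f \<in> L2 M" "u \<in> X" "w \<in> X" "AE x in M. f x = u x + w x"
      using sub by blast
    then show "f \<in> X" using L2_subspace_AE[OF X L2_subspace_add[OF X]] by blast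
  qed
qed

text \<open>Used twice: with E_n = V_n for the wavelet decomposition and with E_n = R_(n-1) for the
  eigenspaces of D.\<close>

locale L2_filtration =
  fixes M :: "'b measure" and E :: "nat \<Rightarrow> ('b \<Rightarrow> complex) set"
  assumes complemented: "L2_complemented M (E n)"
    and step: "E n \<subseteq> E (Suc n)"
    and dense: "L2_closure M (\<Union>n. E n) = L2 M"
begin

text \<open>The detail gained from stage n to stage n + 1. The bottom space \<open>E 0\<close> is
  not a layer and is always listed separately.\<close>

definition layer :: "nat \<Rightarrow> ('b \<Rightarrow> complex) set" where
  "layer n = E (Suc n) \<inter> L2_perp M (E n)"

text \<open>The projection onto \<open>layer n\<close> up to null sets, kept as a difference of
  chosen projections so that it becomes literally \<open>Xi_hat\<close> for the chain
  R_(n-1).\<close>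

definition increment :: "nat \<Rightarrow> ('b \<Rightarrow> complex) \<Rightarrow> 'b \<Rightarrow> complex" where
  "increment n f = (\<lambda>x. L2_projection M (E (Suc n)) f x - L2_projection M (E n) f x)"

abbreviation P :: "nat \<Rightarrow> ('b \<Rightarrow> complex) \<Rightarrow> 'b \<Rightarrow> complex" where
  "P n \<equiv> L2_projection M (E n)"

lemma mono: "m \<le> n \<Longrightarrow> E m \<subseteq> E n"
  using step by (rule lift_Suc_mono_le)

lemma subspace: "L2_subspace M (E n)"
  using complemented by (rule L2_complemented_subspace)

lemma E_L2: "E n \<subseteq> L2 M"
  using complemented by (rule L2_complemented_L2)

lemma subspace_perp: "L2_subspace M (L2_perp M (E n))"
  using E_L2 by (rule L2_subspace_perp)

lemma layer_subspace: "L2_subspace M (layer n)"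
  unfolding layer_def by (intro L2_subspace_Int subspace subspace_perp)

lemma layer_sub_E: "n < m \<Longrightarrow> layer n \<subseteq> E m"
  using mono[of "Suc n" m] by (auto simp: layer_def)

lemma layer_sub_perp: "m \<le> n \<Longrightarrow> layer n \<subseteq> L2_perp M (E m)"
  using L2_perp_antimono[OF mono[of m n], of M] by (auto simp: layer_def)

lemma layer_orthogonal_E: "m \<le> n \<Longrightarrow> f \<in> layer n \<Longrightarrow> g \<in> E m \<Longrightarrow> L2_inner M f g = 0"
  using layer_sub_perp[of m n] by (auto simp: L2_perp_def)

lemma layer_orthogonal:
  assumes "m \<noteq> n" "f \<in> layer m" "g \<in> layer n"
  shows "L2_inner M f g = 0"
proof (cases "m < n")
  case True
  then show ?thesis using assms layer_sub_E[of m n] layer_orthogonal_E[of n n g f]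
    by (auto intro: L2_inner_eq_0_sym)
next
  case False
  then show ?thesis using assms layer_sub_E[of n m] layer_orthogonal_E[of m m f g] by auto
qed

lemma increment_layer:
  assumes f: "f \<in> L2 M"
  shows "increment n f \<in> layer n"
proof -
  have "increment n f \<in> E (Suc n)"
    unfolding increment_def using f step L2_projection_in[OF complemented f]
    by (intro L2_subspace_diff[OF subspace]) auto
  \<comment> \<open>The increment is (f - P_n f) - (f - P_(n+1) f), and both terms are orthogonal to
    \<open>E n\<close>.\<close>
  moreover have "(\<lambda>x. f x - P (Suc n) f x) \<in> L2_perp M (E n)"
    using L2_projection_perp[OF complemented f] L2_perp_antimono[OF step] by blast
  from L2_subspace_diff[OF subspace_perp L2_projection_perp[OF complemented f] this]
  have "increment n f \<in> L2_perp M (E n)" unfolding increment_def by simp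
  ultimately show ?thesis by (simp add: layer_def)
qed

lemma layer_L2: "layer n \<subseteq> L2 M"
  using E_L2 by (auto simp: layer_def)

lemma increment_L2: "f \<in> L2 M \<Longrightarrow> increment n f \<in> L2 M"
  using increment_layer layer_L2 by blast

lemma sum_increment: "(\<Sum>q<N. increment q f x) = P N f x - P 0 f x"
  unfolding increment_def by (rule sum_lessThan_telescope)

text \<open>Density provides an approximant in some \<open>E m\<close>; it lies in every later
  space, where the projection approximates at least as well.\<close>

lemma projection_tendsto:
  assumes f: "f \<in> L2 M"
  shows "(\<lambda>n. L2_norm M (\<lambda>x. f x - P n f x)) \<longlonglongrightarrow> 0"
proof (rule LIMSEQ_I)
  fix e :: real assume "e > 0"
  then obtain m g where g: "g \<in> E m" "L2_norm M (\<lambda>x. f x - g x) < e"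
    using f dense unfolding L2_closure_def by blast
  have "L2_norm M (\<lambda>x. f x - P n f x) < e" if "n \<ge> m" for n
    using L2_projection_best_approximation[OF complemented f, of g n] mono[OF that] g by auto
  then show "\<exists>no. \<forall>n\<ge>no. norm (L2_norm M (\<lambda>x. f x - P n f x) - 0) < e" by auto
qed

text \<open>Writing f = (f - P_n f) + P_n f shows inductively that each \<open>E n\<close> lies in
  the algebraic span of \<open>E 0\<close> and the layers; density does the rest. In
  \<open>case_nat\<close> the layer n sits at index n + 1.\<close>

lemma hilbert_sum: "L2_hilbert_sum M (L2 M) (case_nat (E 0) layer)"
  unfolding L2_hilbert_sum_def
proof (intro conjI allI impI)
  fix m n :: nat assume "m \<noteq> n"
  then show "L2_orthogonal M (case_nat (E 0) layer m) (case_nat (E 0) layer n)"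
    by (cases m; cases n)
      (auto simp: L2_orthogonal_def layer_orthogonal layer_orthogonal_E[of 0]
        intro: L2_inner_eq_0_sym[OF layer_orthogonal_E[of 0]])
next
  let ?U = "\<Union>n. case_nat (E 0) layer n"
  have U_L2: "?U \<subseteq> L2 M"
    by (rule UN_least) (simp add: E_L2 layer_L2 split: nat.split)
  then have S: "L2_subspace M (L2_span M ?U)" by (rule L2_subspace_span)
  have base: "case_nat (E 0) layer n \<subseteq> L2_span M ?U" for n
    using U_L2 by (blast intro: L2_span_base)
  have "E n \<subseteq> L2_span M ?U" for n
  proof (induction n)
    case 0
    then show ?case using base[of 0] by simp
  next
    case (Suc n)
    show ?case
    proof
      fix f assume f: "f \<in> E (Suc n)"
      then have L2: "f \<in> L2 M" using E_L2 by auto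
      have "P n f \<in> E (Suc n)" using L2_projection_in[OF complemented L2] step by blast
      from L2_subspace_diff[OF subspace f this]
      have "(\<lambda>x. f x - P n f x) \<in> layer n"
        using L2_projection_perp[OF complemented L2] by (simp add: layer_def)
      then have "(\<lambda>x. (f x - P n f x) + P n f x) \<in> L2_span M ?U"
        using base[of "Suc n"] Suc L2_projection_in[OF complemented L2, of n]
        by (intro L2_subspace_add[OF S]) auto
      then show "f \<in> L2_span M ?U" by simp
    qed
  qed
  then have "L2 M \<subseteq> L2_closure M (L2_span M ?U)"
    unfolding dense[symmetric] by (intro L2_closure_mono) blast
  moreover have "L2_closure M (L2_span M ?U) \<subseteq> L2 M" by (auto simp: L2_closure_def)
  ultimately show "L2 M = L2_closure M (L2_span M ?U)" by blast
qed

text \<open>The relation \<open>dirac\<close> with right-hand side c f, transferred to an arbitrary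
  filtration.\<close>

definition eigenvector :: "(nat \<Rightarrow> real) \<Rightarrow> complex \<Rightarrow> ('b \<Rightarrow> complex) \<Rightarrow> bool" where
  "eigenvector \<alpha> c f \<longleftrightarrow> f \<in> L2 M \<and>
     (\<lambda>N. L2_norm M (\<lambda>x. (\<Sum>q<N. complex_of_real (\<alpha> q) * increment q f x) - c * f x)) \<longlonglongrightarrow> 0"

text \<open>Necessity: pairing with a fixed component yields scalars that are eventually constant,
  so the constant equals the limit 0. Sufficiency: the partial sums telescope to c P_N f almost
  everywhere, and P_N f tends to f.\<close>

lemma eigenvector_iff:
  "eigenvector \<alpha> c f \<longleftrightarrow> f \<in> L2 M \<and>
     (\<forall>q. complex_of_real (\<alpha> q) \<noteq> c \<longrightarrow> (AE x in M. increment q f x = 0)) \<and>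
     (c \<noteq> 0 \<longrightarrow> (AE x in M. P 0 f x = 0))"
proof (cases "f \<in> L2 M")
  case f: True
  define S where "S N = (\<lambda>x. (\<Sum>q<N. complex_of_real (\<alpha> q) * increment q f x))" for N
  have SL2: "S N \<in> L2 M" for N
    unfolding S_def using f by (intro L2_sum L2_scale increment_L2)
  have dL2: "(\<lambda>x. S N x - c * f x) \<in> L2 M" for N
    using SL2 f by (intro L2_diff L2_scale)
  have PL2: "P n f \<in> L2 M" for n using complemented f by (rule L2_projection_L2)
  have inner_f_P: "L2_inner M f (P 0 f) = L2_inner M (P 0 f) (P 0 f)"
  proof -
    have "L2_inner M (\<lambda>x. f x - P 0 f x) (P 0 f) = 0"
      using L2_projection[OF complemented f, of 0] by (auto simp: L2_perp_def)
    then show ?thesis using L2_inner_diff_left[OF f PL2 PL2, of 0 0] by simp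
  qed
  \<comment> \<open>f is the sum of f - P_(p+1) f, the p-th increment and P_p f; the outer two are
    orthogonal to the middle one.\<close>
  have inner_f_incr: "L2_inner M f (increment p f) = L2_inner M (increment p f) (increment p f)" for p
  proof -
    have "L2_inner M (\<lambda>x. f x - P (Suc p) f x) (increment p f) = 0"
      using L2_projection_perp[OF complemented f, of "Suc p"] increment_layer[OF f, of p]
      by (auto simp: L2_perp_def layer_def)
    moreover have "L2_inner M (P p f) (increment p f) = 0"
      using layer_orthogonal_E[OF order_refl increment_layer[OF f, of p] L2_projection_in[OF complemented f]]
      by (rule L2_inner_eq_0_sym)
    ultimately show ?thesis
      using L2_inner_diff_left[OF f PL2 increment_L2[OF f], of "Suc p" p]
        L2_inner_diff_left[OF PL2 PL2 increment_L2[OF f], of "Suc p" p p]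
      by (simp add: increment_def)
  qed
  \<comment> \<open>Norm convergence implies weak convergence, by Cauchy-Schwarz.\<close>
  have weak: "(\<lambda>N. L2_inner M (S N) h - c * L2_inner M f h) \<longlonglongrightarrow> 0"
    if lim: "(\<lambda>N. L2_norm M (\<lambda>x. S N x - c * f x)) \<longlonglongrightarrow> 0" and h: "h \<in> L2 M" for h
  proof (rule Lim_null_comparison)
    show "\<forall>\<^sub>F N in sequentially. norm (L2_inner M (S N) h - c * L2_inner M f h)
        \<le> L2_norm M (\<lambda>x. S N x - c * f x) * L2_norm M h"
      using L2_Cauchy_Schwarz[OF dL2 h] L2_inner_diff_left[OF SL2 L2_scale[OF f] h, of _ c]
      by (simp add: L2_inner_scale_left)
    show "(\<lambda>N. L2_norm M (\<lambda>x. S N x - c * f x) * L2_norm M h) \<longlonglongrightarrow> 0"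
      using tendsto_mult_right[OF lim, of "L2_norm M h"] by simp
  qed
  have inner_S: "L2_inner M (S N) h = (\<Sum>q<N. complex_of_real (\<alpha> q) * L2_inner M (increment q f) h)"
    if "h \<in> L2 M" for N h
    unfolding S_def using that f
    by (subst L2_inner_sum_left) (auto intro!: L2_scale increment_L2 simp: L2_inner_scale_left)
  show ?thesis
  proof
    assume "eigenvector \<alpha> c f"
    then have lim: "(\<lambda>N. L2_norm M (\<lambda>x. S N x - c * f x)) \<longlonglongrightarrow> 0"
      by (simp add: eigenvector_def S_def)
    have "AE x in M. increment p f x = 0" if ne: "complex_of_real (\<alpha> p) \<noteq> c" for p
    proof -
      let ?h = "increment p f"
      \<comment> \<open>By orthogonality of the layers only the p-th term survives, and it is
        present as soon as N exceeds p.\<close>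
      have "L2_inner M (S N) ?h = complex_of_real (\<alpha> p) * L2_inner M ?h ?h" if "N > p" for N
      proof -
        have "L2_inner M (S N) ?h = (\<Sum>q<N. if q = p then complex_of_real (\<alpha> p) * L2_inner M ?h ?h else 0)"
          unfolding inner_S[OF increment_L2[OF f]] using increment_layer[OF f]
          by (intro sum.cong) (auto simp: layer_orthogonal)
        then show ?thesis using that by simp
      qed
      then have "\<forall>\<^sub>F N in sequentially. L2_inner M (S N) ?h - c * L2_inner M f ?h
          = (complex_of_real (\<alpha> p) - c) * L2_inner M ?h ?h"
        by (intro eventually_sequentiallyI[of "Suc p"]) (simp add: inner_f_incr algebra_simps)
      from iffD1[OF tendsto_cong[OF this] weak[OF lim increment_L2[OF f]]]
      have "(complex_of_real (\<alpha> p) - c) * L2_inner M ?h ?h = 0"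
        by (simp add: LIMSEQ_const_iff)
      then show ?thesis
        using ne f by (simp add: L2_inner_self L2_norm_eq_0_iff increment_L2)
    qed
    moreover have "AE x in M. P 0 f x = 0" if ne: "c \<noteq> 0"
    proof -
      \<comment> \<open>Every increment is orthogonal to \<open>E 0\<close>, so the pairing retains
        only the contribution of -c f.\<close>
      have "L2_inner M (S N) (P 0 f) = 0" for N
        unfolding inner_S[OF PL2]
        using layer_orthogonal_E[OF _ increment_layer[OF f] L2_projection_in[OF complemented f]]
        by simp
      with weak[OF lim PL2, of 0] have "c * L2_inner M (P 0 f) (P 0 f) = 0"
        by (simp add: inner_f_P LIMSEQ_const_iff)
      then show ?thesis using ne PL2 by (simp add: L2_inner_self L2_norm_eq_0_iff)
    qed
    ultimately show "f \<in> L2 M \<and>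
       (\<forall>q. complex_of_real (\<alpha> q) \<noteq> c \<longrightarrow> (AE x in M. increment q f x = 0)) \<and>
       (c \<noteq> 0 \<longrightarrow> (AE x in M. P 0 f x = 0))" using f by blast
  next
    assume R: "f \<in> L2 M \<and>
       (\<forall>q. complex_of_real (\<alpha> q) \<noteq> c \<longrightarrow> (AE x in M. increment q f x = 0)) \<and>
       (c \<noteq> 0 \<longrightarrow> (AE x in M. P 0 f x = 0))"
    have "AE x in M. complex_of_real (\<alpha> q) * increment q f x = c * increment q f x" for q
      using R by (cases "complex_of_real (\<alpha> q) = c") auto
    then have A: "AE x in M. \<forall>q. complex_of_real (\<alpha> q) * increment q f x = c * increment q f x"
      by (simp add: AE_all_countable)
    \<comment> \<open>Either factor may be the one that vanishes: the first if c = 0, the second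
      otherwise.\<close>
    have Z: "AE x in M. c * P 0 f x = 0" using R by (cases "c = 0") auto
    have "AE x in M. S N x - c * f x = - c * (f x - P N f x)" for N
      using A Z
    proof eventually_elim
      fix x assume a: "\<forall>q. complex_of_real (\<alpha> q) * increment q f x = c * increment q f x"
        and z: "c * P 0 f x = 0"
      have "S N x = c * (\<Sum>q<N. increment q f x)" 
        unfolding S_def sum_distrib_left using a by (intro sum.cong) simp_all
      also have "\<dots> = c * P N f x" using z by (simp add: sum_increment right_diff_distrib)
      finally show "S N x - c * f x = - c * (f x - P N f x)" by (simp add: algebra_simps)
    qed
    then have "L2_norm M (\<lambda>x. S N x - c * f x) = L2_norm M (\<lambda>x. - c * (f x - P N f x))" for N
      by (rule L2_norm_cong_AE[OF dL2 L2_scale[OF L2_diff[OF f PL2]]])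
    also have "L2_norm M (\<lambda>x. - c * (f x - P N f x)) = cmod c * L2_norm M (\<lambda>x. f x - P N f x)" for N
      unfolding L2_norm_scale by simp
    finally have "(\<lambda>N. L2_norm M (\<lambda>x. S N x - c * f x)) \<longlonglongrightarrow> 0"
      using tendsto_mult_left[OF projection_tendsto[OF f], of "cmod c"] by simp
    then show "eigenvector \<alpha> c f" using f by (simp add: eigenvector_def S_def)
  qed
qed (simp add: eigenvector_def)

lemma increment_lincomb:
  assumes f: "f \<in> L2 M" and g: "g \<in> L2 M"
  shows "AE x in M. increment q (\<lambda>x. a * f x + b * g x) x = a * increment q f x + b * increment q g x"
  using L2_projection_lincomb[OF complemented f g, of "Suc q" a b]
    L2_projection_lincomb[OF complemented f g, of q a b]
  unfolding increment_def by eventually_elim (simp add: algebra_simps)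

lemma increment_cong_AE:
  assumes f: "f \<in> L2 M" and g: "g \<in> L2 M" and "AE x in M. f x = g x"
  shows "AE x in M. increment q f x = increment q g x"
  using L2_projection_cong_AE[OF complemented assms, of "Suc q"]
    L2_projection_cong_AE[OF complemented assms, of q]
  unfolding increment_def by eventually_elim simp

text \<open>Chosen projections are linear only almost everywhere, so linearity is read off the
  characterization by components. The lemma lets a span of layers be placed in an eigenspace
  generator by generator.\<close>

lemma eigenspace_subspace: "L2_subspace M {f. eigenvector \<alpha> c f}"
  unfolding L2_subspace_def
proof (intro conjI ballI allI impI)
  show "{f. eigenvector \<alpha> c f} \<subseteq> L2 M" by (auto simp: eigenvector_def)
  have z: "AE x in M. P n (\<lambda>_. 0) x = 0" for n
    using L2_projection_id[OF complemented L2_subspace_zero[OF subspace]] .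
  have "AE x in M. increment q (\<lambda>_. 0) x = 0" for q
    using z[of "Suc q"] z[of q] unfolding increment_def by eventually_elim simp
  then show "(\<lambda>_. 0) \<in> {f. eigenvector \<alpha> c f}"
    using z[of 0] by (auto simp: eigenvector_iff L2_zero)
next
  fix f g a b assume "f \<in> {f. eigenvector \<alpha> c f}" "g \<in> {f. eigenvector \<alpha> c f}"
  then have f: "eigenvector \<alpha> c f" and g: "eigenvector \<alpha> c g" by auto
  then have L2: "f \<in> L2 M" "g \<in> L2 M" by (auto simp: eigenvector_def)
  have "AE x in M. increment q (\<lambda>x. a * f x + b * g x) x = 0" if "complex_of_real (\<alpha> q) \<noteq> c" for q
  proof -
    have "AE x in M. increment q f x = 0" "AE x in M. increment q g x = 0"
      using f g that by (auto simp: eigenvector_iff)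
    with increment_lincomb[OF L2, of q a b] show ?thesis by eventually_elim simp
  qed
  moreover have "AE x in M. P 0 (\<lambda>x. a * f x + b * g x) x = 0" if "c \<noteq> 0"
  proof -
    have "AE x in M. P 0 f x = 0" "AE x in M. P 0 g x = 0"
      using f g that by (auto simp: eigenvector_iff)
    with L2_projection_lincomb[OF complemented L2, of 0 a b] show ?thesis by eventually_elim simp
  qed
  ultimately show "(\<lambda>x. a * f x + b * g x) \<in> {f. eigenvector \<alpha> c f}"
    using L2_lincomb[OF L2] by (simp add: eigenvector_iff)
next
  fix f g assume "f \<in> {f. eigenvector \<alpha> c f}" and g: "g \<in> L2 M" and eq: "AE x in M. g x = f x"
  then have f: "eigenvector \<alpha> c f" by auto
  then have L2: "f \<in> L2 M" by (auto simp: eigenvector_def)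
  have "AE x in M. increment q g x = 0" if "complex_of_real (\<alpha> q) \<noteq> c" for q
  proof -
    have "AE x in M. increment q f x = 0" using f that by (auto simp: eigenvector_iff)
    with increment_cong_AE[OF g L2 eq, of q] show ?thesis by eventually_elim simp
  qed
  moreover have "AE x in M. P 0 g x = 0" if "c \<noteq> 0"
  proof -
    have "AE x in M. P 0 f x = 0" using f that by (auto simp: eigenvector_iff)
    with L2_projection_cong_AE[OF complemented g L2 eq, of 0] show ?thesis by eventually_elim simp
  qed
  ultimately show "g \<in> {f. eigenvector \<alpha> c f}" using g by (simp add: eigenvector_iff)
qed

text \<open>The projections P_n kill f for n at most q and fix it for n above q, so the q-th
  increment is the only one that can be nonzero.\<close>

lemma eigenvector_layer:
  assumes "f \<in> layer q"
  shows "eigenvector \<alpha> (complex_of_real (\<alpha> q)) f"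
  unfolding eigenvector_iff
proof (intro conjI allI impI)
  show "f \<in> L2 M" using assms layer_L2 by auto
  have up: "AE x in M. P n f x = f x" if "n > q" for n
    using L2_projection_id[OF complemented] layer_sub_E[OF that] assms by blast
  have low: "AE x in M. P n f x = 0" if "n \<le> q" for n
    using L2_projection_of_perp[OF complemented] layer_sub_perp[OF that] assms by blast
  show "AE x in M. P 0 f x = 0" by (rule low) simp
  fix p assume "complex_of_real (\<alpha> p) \<noteq> complex_of_real (\<alpha> q)"
  then have "p \<noteq> q" by auto
  then consider "p > q" | "Suc p \<le> q" by linarith
  then show "AE x in M. increment p f x = 0"
  proof cases
    case 1
    then have "AE x in M. P (Suc p) f x = f x" "AE x in M. P p f x = f x" by (auto intro: up)
    then show ?thesis unfolding increment_def by eventually_elim simp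
  next
    case 2
    then have "AE x in M. P (Suc p) f x = 0" "AE x in M. P p f x = 0" by (auto intro: low)
    then show ?thesis unfolding increment_def by eventually_elim simp
  qed
qed

text \<open>From stage \<open>m\<close> on the projections of f no longer change, so the distance
  from f to them is constant while tending to 0.\<close>

lemma stationary_projection:
  assumes f: "f \<in> L2 M" and z: "\<And>q. q \<ge> m \<Longrightarrow> AE x in M. increment q f x = 0"
  shows "AE x in M. f x = P m f x"
proof -
  have PL2: "P n f \<in> L2 M" for n using complemented f by (rule L2_projection_L2)
  have "AE x in M. P n f x = P m f x" if "n \<ge> m" for n
    using that
  proof (induction n rule: dec_induct)
    case (step n)
    from step.IH z[OF step.hyps(1)] show ?case
      unfolding increment_def by eventually_elim simp
  qed simp
  then have "L2_norm M (\<lambda>x. f x - P n f x) = L2_norm M (\<lambda>x. f x - P m f x)" if "n \<ge> m" for n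
    using that f PL2 by (intro L2_norm_cong_AE L2_diff) auto
  then have "\<forall>\<^sub>F n in sequentially. L2_norm M (\<lambda>x. f x - P n f x) = L2_norm M (\<lambda>x. f x - P m f x)"
    by (rule eventually_sequentiallyI)
  from iffD1[OF tendsto_cong[OF this] projection_tendsto[OF f]]
  have "L2_norm M (\<lambda>x. f x - P m f x) = 0" by (simp add: LIMSEQ_const_iff)
  then show ?thesis using f PL2 by (simp add: L2_norm_eq_0_iff L2_diff)
qed

lemma eigenspace_0:
  assumes "\<And>q. \<alpha> q \<noteq> 0"
  shows "{f. eigenvector \<alpha> 0 f} = E 0"
proof (intro equalityI subsetI CollectI)
  fix f assume "f \<in> {f. eigenvector \<alpha> 0 f}"
  then have f: "f \<in> L2 M" and "AE x in M. increment q f x = 0" for q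
    using assms by (auto simp: eigenvector_iff)
  then have "AE x in M. f x = P 0 f x" by (intro stationary_projection)
  then show "f \<in> E 0"
    using L2_subspace_AE[OF subspace L2_projection_in[OF complemented f] f] by blast
next
  fix f assume f: "f \<in> E 0"
  have id: "AE x in M. P n f x = f x" for n
    using L2_projection_id[OF complemented] mono[of 0 n] f by blast
  have "AE x in M. increment q f x = 0" for q
    using id[of "Suc q"] id[of q] unfolding increment_def by eventually_elim simp
  then show "eigenvector \<alpha> 0 f" using f E_L2 by (auto simp: eigenvector_iff)
qed

text \<open>Since \<open>\<alpha>\<close> exceeds \<open>cmod c\<close> from some stage on, f has
  finitely many nonzero components; this is why the algebraic span appears without a
  closure.\<close>

lemma eigenspace_nonzero:
  assumes lim: "filterlim \<alpha> at_top sequentially" and c: "c \<noteq> 0"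
  shows "{f. eigenvector \<alpha> c f} = L2_span M (\<Union>q\<in>{q. complex_of_real (\<alpha> q) = c}. layer q)"
    (is "_ = L2_span M ?U")
proof (intro equalityI subsetI)
  have UL2: "?U \<subseteq> L2 M" using layer_L2 by blast
  have S: "L2_subspace M (L2_span M ?U)" using UL2 by (rule L2_subspace_span)
  fix f assume "f \<in> {f. eigenvector \<alpha> c f}"
  then have f: "f \<in> L2 M" and z: "\<And>q. complex_of_real (\<alpha> q) \<noteq> c \<Longrightarrow> AE x in M. increment q f x = 0"
    and z0: "AE x in M. P 0 f x = 0" using c by (auto simp: eigenvector_iff)
  have "\<forall>\<^sub>F q in sequentially. \<alpha> q > cmod c"
    using lim by (simp add: filterlim_at_top_dense)
  then obtain m where m: "\<And>q. q \<ge> m \<Longrightarrow> \<alpha> q > cmod c"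
    by (auto simp: eventually_sequentially)
  have "complex_of_real (\<alpha> q) \<noteq> c" if "q \<ge> m" for q
    using m[OF that] by auto
  then have fP: "AE x in M. f x = P m f x" by (intro stationary_projection f z)
  have "AE x in M. \<forall>q. complex_of_real (\<alpha> q) \<noteq> c \<longrightarrow> increment q f x = 0"
    unfolding AE_all_countable using z by auto
  with fP z0 have "AE x in M. f x = (\<Sum>q\<in>{q. q < m \<and> complex_of_real (\<alpha> q) = c}. increment q f x)"
  proof eventually_elim
    fix x assume "f x = P m f x" "P 0 f x = 0"
      and z: "\<forall>q. complex_of_real (\<alpha> q) \<noteq> c \<longrightarrow> increment q f x = 0"
    then have "f x = (\<Sum>q<m. increment q f x)" by (simp add: sum_increment)
    also have "\<dots> = (\<Sum>q\<in>{q. q < m \<and> complex_of_real (\<alpha> q) = c}. increment q f x)"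
      using z by (intro sum.mono_neutral_right) auto
    finally show "f x = (\<Sum>q\<in>{q. q < m \<and> complex_of_real (\<alpha> q) = c}. increment q f x)" .
  qed
  moreover have "(\<lambda>x. \<Sum>q\<in>{q. q < m \<and> complex_of_real (\<alpha> q) = c}. increment q f x) \<in> L2_span M ?U"
    using increment_layer[OF f] increment_L2[OF f]
    by (intro L2_subspace_sum[OF S] L2_span_base) auto
  ultimately show "f \<in> L2_span M ?U" using L2_subspace_AE[OF S _ f] by blast
next
  have "L2_span M ?U \<subseteq> {f. eigenvector \<alpha> c f}"
    using eigenspace_subspace by (rule L2_span_minimal) (auto intro: eigenvector_layer)
  then show "\<And>f. f \<in> L2_span M ?U \<Longrightarrow> f \<in> {f. eigenvector \<alpha> c f}" by blast
qed

end

section \<open>Cylinders and the shift\<close>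

locale finite_k_graph =
  fixes \<Lambda> :: "('a, 'k::finite) kgraph"
  assumes kg: "k_graph \<Lambda>" and fin: "finite_kgraph \<Lambda>"
begin

lemma finite_of_degree: "finite (of_degree \<Lambda> n)"
  using fin by (simp add: finite_kgraph_def)

lemma src_vertex_simps:
  assumes "\<mu> \<in> Mor \<Lambda>"
  shows src_Mor: "src \<Lambda> \<mu> \<in> Mor \<Lambda>" and dgr_src: "dgr \<Lambda> (src \<Lambda> \<mu>) = 0"
  using kg assms by (simp_all add: k_graph_def small_category_def)

lemma cmp_simps:
  assumes "\<mu> \<in> Mor \<Lambda>" "\<nu> \<in> Mor \<Lambda>" "src \<Lambda> \<mu> = rng \<Lambda> \<nu>"
  shows cmp_Mor: "cmp \<Lambda> \<mu> \<nu> \<in> Mor \<Lambda>"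
    and src_cmp: "src \<Lambda> (cmp \<Lambda> \<mu> \<nu>) = src \<Lambda> \<nu>"
    and dgr_cmp: "dgr \<Lambda> (cmp \<Lambda> \<mu> \<nu>) = dgr \<Lambda> \<mu> + dgr \<Lambda> \<nu>"
  using kg assms by (simp_all add: k_graph_def small_category_def)

lemma factorization:
  assumes "\<kappa> \<in> Mor \<Lambda>" "dgr \<Lambda> \<kappa> = m + n"
  shows "\<exists>!(\<mu>, \<nu>). \<mu> \<in> Mor \<Lambda> \<and> \<nu> \<in> Mor \<Lambda> \<and> dgr \<Lambda> \<mu> = m \<and> dgr \<Lambda> \<nu> = n
           \<and> src \<Lambda> \<mu> = rng \<Lambda> \<nu> \<and> \<kappa> = cmp \<Lambda> \<mu> \<nu>"
proof -
  have "\<forall>\<kappa>\<in>Mor \<Lambda>. \<forall>m n. dgr \<Lambda> \<kappa> = m + n \<longrightarrow>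
      (\<exists>!(\<mu>, \<nu>). \<mu> \<in> Mor \<Lambda> \<and> \<nu> \<in> Mor \<Lambda> \<and> dgr \<Lambda> \<mu> = m \<and> dgr \<Lambda> \<nu> = n
         \<and> src \<Lambda> \<mu> = rng \<Lambda> \<nu> \<and> \<kappa> = cmp \<Lambda> \<mu> \<nu>)"
    using kg unfolding k_graph_def by (elim conjE)
  from this[rule_format, OF assms] show ?thesis .
qed

text \<open>Cancellation of degrees shows that the second factors have equal degrees too, so both
  pairs are factorizations of one morphism for the same splitting of its degree.\<close>

lemma cmp_cancel:
  assumes "\<mu> \<in> Mor \<Lambda>" "\<nu> \<in> Mor \<Lambda>" "src \<Lambda> \<mu> = rng \<Lambda> \<nu>"
    and "\<mu>' \<in> Mor \<Lambda>" "\<nu>' \<in> Mor \<Lambda>" "src \<Lambda> \<mu>' = rng \<Lambda> \<nu>'"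
    and "dgr \<Lambda> \<mu> = dgr \<Lambda> \<mu>'" "cmp \<Lambda> \<mu> \<nu> = cmp \<Lambda> \<mu>' \<nu>'"
  shows "\<mu> = \<mu>'" "\<nu> = \<nu>'"
proof -
  have deg: "dgr \<Lambda> \<nu> = dgr \<Lambda> \<nu>'"
    using dgr_cmp[OF assms(1-3)] dgr_cmp[OF assms(4-6)] assms(7,8) by simp
  define Q where "Q = (\<lambda>(\<alpha>, \<beta>). \<alpha> \<in> Mor \<Lambda> \<and> \<beta> \<in> Mor \<Lambda> \<and> dgr \<Lambda> \<alpha> = dgr \<Lambda> \<mu> \<and> dgr \<Lambda> \<beta> = dgr \<Lambda> \<nu>
    \<and> src \<Lambda> \<alpha> = rng \<Lambda> \<beta> \<and> cmp \<Lambda> \<mu> \<nu> = cmp \<Lambda> \<alpha> \<beta>)"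
  have "\<exists>!z. Q z" unfolding Q_def
    by (rule factorization[OF cmp_Mor[OF assms(1-3)] dgr_cmp[OF assms(1-3)]])
  moreover have "Q (\<mu>, \<nu>)" "Q (\<mu>', \<nu>')" using assms deg by (simp_all add: Q_def)
  ultimately have "(\<mu>, \<nu>) = (\<mu>', \<nu>')" by (metis (no_types))
  then show "\<mu> = \<mu>'" "\<nu> = \<nu>'" by simp_all
qed

lemma factor:
  assumes "\<kappa> \<in> of_degree \<Lambda> (m + n)"
  obtains \<mu> \<nu> where "\<mu> \<in> of_degree \<Lambda> m" "\<nu> \<in> of_degree \<Lambda> n" "src \<Lambda> \<mu> = rng \<Lambda> \<nu>" "\<kappa> = cmp \<Lambda> \<mu> \<nu>"
proof -
  have "\<kappa> \<in> Mor \<Lambda>" "dgr \<Lambda> \<kappa> = m + n" using assms by (simp_all add: of_degree_def)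
  from factorization[OF this] show thesis
    by (elim ex1E) (use that in \<open>auto simp: of_degree_def\<close>)
qed

text \<open>The set usually written s(mu) Lambda^n; it depends on \<open>\<mu>\<close> only through
  its source.\<close>

definition extensions :: "'a \<Rightarrow> nat ^ 'k \<Rightarrow> 'a set" where
  "extensions \<mu> n = {\<eta> \<in> of_degree \<Lambda> n. rng \<Lambda> \<eta> = src \<Lambda> \<mu>}"

lemma finite_extensions: "finite (extensions \<mu> n)"
  using finite_of_degree[of n] by (simp add: extensions_def)

lemma extensionsD:
  assumes "\<eta> \<in> extensions \<mu> n"
  shows "\<eta> \<in> Mor \<Lambda>" "dgr \<Lambda> \<eta> = n" "src \<Lambda> \<mu> = rng \<Lambda> \<eta>"
  using assms by (auto simp: extensions_def of_degree_def)

text \<open>The factorization property in bijective form, used to regroup sums over paths by their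
  initial segments.\<close>

lemma bij_betw_cmp:
  "bij_betw (\<lambda>(\<mu>, \<eta>). cmp \<Lambda> \<mu> \<eta>) (SIGMA \<mu>:of_degree \<Lambda> m. extensions \<mu> n) (of_degree \<Lambda> (m + n))"
  unfolding bij_betw_def
proof
  show "inj_on (\<lambda>(\<mu>, \<eta>). cmp \<Lambda> \<mu> \<eta>) (SIGMA \<mu>:of_degree \<Lambda> m. extensions \<mu> n)"
  proof (rule inj_onI, clarify)
    fix \<mu> \<eta> \<mu>' \<eta>'
    assume *: "\<mu> \<in> of_degree \<Lambda> m" "\<mu>' \<in> of_degree \<Lambda> m" "\<eta> \<in> extensions \<mu> n" "\<eta>' \<in> extensions \<mu>' n"
      "cmp \<Lambda> \<mu> \<eta> = cmp \<Lambda> \<mu>' \<eta>'"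
    then have "\<mu> \<in> Mor \<Lambda>" "\<mu>' \<in> Mor \<Lambda>" "dgr \<Lambda> \<mu> = dgr \<Lambda> \<mu>'" by (simp_all add: of_degree_def)
    from cmp_cancel[OF this(1) extensionsD(1,3)[OF *(3)] this(2) extensionsD(1,3)[OF *(4)] this(3) *(5)]
    show "\<mu> = \<mu>' \<and> \<eta> = \<eta>'" by blast
  qed
  show "(\<lambda>(\<mu>, \<eta>). cmp \<Lambda> \<mu> \<eta>) ` (SIGMA \<mu>:of_degree \<Lambda> m. extensions \<mu> n) = of_degree \<Lambda> (m + n)"
  proof
    show "(\<lambda>(\<mu>, \<eta>). cmp \<Lambda> \<mu> \<eta>) ` (SIGMA \<mu>:of_degree \<Lambda> m. extensions \<mu> n) \<subseteq> of_degree \<Lambda> (m + n)"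
      by (auto simp: of_degree_def extensions_def cmp_Mor dgr_cmp)
    show "of_degree \<Lambda> (m + n) \<subseteq> (\<lambda>(\<mu>, \<eta>). cmp \<Lambda> \<mu> \<eta>) ` (SIGMA \<mu>:of_degree \<Lambda> m. extensions \<mu> n)"
    proof
      fix \<kappa> assume "\<kappa> \<in> of_degree \<Lambda> (m + n)"
      then obtain \<mu> \<nu> where "\<mu> \<in> of_degree \<Lambda> m" "\<nu> \<in> of_degree \<Lambda> n" "src \<Lambda> \<mu> = rng \<Lambda> \<nu>" "\<kappa> = cmp \<Lambda> \<mu> \<nu>"
        by (rule factor)
      then show "\<kappa> \<in> (\<lambda>(\<mu>, \<eta>). cmp \<Lambda> \<mu> \<eta>) ` (SIGMA \<mu>:of_degree \<Lambda> m. extensions \<mu> n)"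
        by (intro image_eqI[of _ _ "(\<mu>, \<nu>)"]) (auto simp: extensions_def)
    qed
  qed
qed

lemma sum_of_degree_add:
  "(\<Sum>\<kappa>\<in>of_degree \<Lambda> (m + n). F \<kappa>) = (\<Sum>\<mu>\<in>of_degree \<Lambda> m. \<Sum>\<eta>\<in>extensions \<mu> n. F (cmp \<Lambda> \<mu> \<eta>))"
proof -
  have "(\<Sum>\<mu>\<in>of_degree \<Lambda> m. \<Sum>\<eta>\<in>extensions \<mu> n. F (cmp \<Lambda> \<mu> \<eta>))
      = (\<Sum>z\<in>(SIGMA \<mu>:of_degree \<Lambda> m. extensions \<mu> n). F (case z of (\<mu>, \<eta>) \<Rightarrow> cmp \<Lambda> \<mu> \<eta>))"
    by (simp add: sum.Sigma finite_of_degree finite_extensions split_beta)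
  also have "\<dots> = (\<Sum>\<kappa>\<in>of_degree \<Lambda> (m + n). F \<kappa>)"
    by (rule sum.reindex_bij_betw[OF bij_betw_cmp])
  finally show ?thesis by (rule sym)
qed

section \<open>Infinite paths and their cylinders\<close>

lemma path_simps:
  assumes "p \<in> infinite_paths \<Lambda>" "m \<le> n"
  shows path_Mor: "p (m, n) \<in> Mor \<Lambda>" and dgr_path: "dgr \<Lambda> (p (m, n)) = n - m"
    and rng_path: "rng \<Lambda> (p (m, n)) = p (m, m)" and src_path: "src \<Lambda> (p (m, n)) = p (n, n)"
proof -
  have F: "cat_functor Omega \<Lambda> p" and d: "\<forall>\<mu>\<in>Mor Omega. dgr \<Lambda> (p \<mu>) = dgr Omega \<mu>"
    using assms(1) by (simp_all add: infinite_paths_def)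
  have mn: "(m, n) \<in> Mor Omega" using assms(2) by (simp add: Omega_def)
  have F': "\<forall>\<mu>\<in>Mor Omega. p \<mu> \<in> Mor \<Lambda> \<and> p (rng Omega \<mu>) = rng \<Lambda> (p \<mu>) \<and> p (src Omega \<mu>) = src \<Lambda> (p \<mu>)"
    using F unfolding cat_functor_def by blast
  have om: "rng Omega (m, n) = (m, m)" "src Omega (m, n) = (n, n)" "dgr Omega (m, n) = n - m"
    by (simp_all add: Omega_def)
  show "p (m, n) \<in> Mor \<Lambda>" "dgr \<Lambda> (p (m, n)) = n - m"
    "rng \<Lambda> (p (m, n)) = p (m, m)" "src \<Lambda> (p (m, n)) = p (n, n)"
    using bspec[OF F' mn] bspec[OF d mn] unfolding om by simp_all
qed

lemma path_cmp:
  assumes "p \<in> infinite_paths \<Lambda>" "l \<le> m" "m \<le> n"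
  shows "p (l, n) = cmp \<Lambda> (p (l, m)) (p (m, n))"
proof -
  have F: "cat_functor Omega \<Lambda> p" using assms(1) by (simp add: infinite_paths_def)
  have "\<forall>\<mu>\<in>Mor Omega. \<forall>\<nu>\<in>Mor Omega. src Omega \<mu> = rng Omega \<nu> \<longrightarrow>
      p (cmp Omega \<mu> \<nu>) = cmp \<Lambda> (p \<mu>) (p \<nu>)"
    using F unfolding cat_functor_def by blast
  from this[rule_format, of "(l, m)" "(m, n)"] show ?thesis using assms by (simp add: Omega_def)
qed

lemma nat_vec_le_add: "m \<le> m + (n :: nat ^ 'k)"
  by (simp add: Finite_Cartesian_Product.less_eq_vec_def)

lemma nat_vec_zero_le: "0 \<le> (n :: nat ^ 'k)"
  by (simp add: Finite_Cartesian_Product.less_eq_vec_def)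

lemma path_add:
  assumes "p \<in> infinite_paths \<Lambda>"
  shows "p (0, m + n) = cmp \<Lambda> (p (0, m)) (p (m, m + n))"
  by (rule path_cmp[OF assms nat_vec_zero_le nat_vec_le_add])

text \<open>The segment of p of degree d(mu) + d(eta) factors at d(mu); uniqueness allows comparison
  with \<open>cmp \<Lambda> \<mu> \<eta>\<close> factor by factor.\<close>

lemma cylinder_cmp:
  assumes p: "p \<in> infinite_paths \<Lambda>" and \<mu>: "\<mu> \<in> Mor \<Lambda>" "\<eta> \<in> Mor \<Lambda>" "src \<Lambda> \<mu> = rng \<Lambda> \<eta>"
  shows "p \<in> cylinder \<Lambda> (cmp \<Lambda> \<mu> \<eta>) \<longleftrightarrow>
    p \<in> cylinder \<Lambda> \<mu> \<and> p (dgr \<Lambda> \<mu>, dgr \<Lambda> \<mu> + dgr \<Lambda> \<eta>) = \<eta>"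
proof
  let ?a = "p (0, dgr \<Lambda> \<mu>)" and ?b = "p (dgr \<Lambda> \<mu>, dgr \<Lambda> \<mu> + dgr \<Lambda> \<eta>)"
  assume "p \<in> cylinder \<Lambda> (cmp \<Lambda> \<mu> \<eta>)"
  then have eq: "cmp \<Lambda> ?a ?b = cmp \<Lambda> \<mu> \<eta>"
    using path_add[OF p] by (simp add: cylinder_def dgr_cmp[OF \<mu>])
  have "?a \<in> Mor \<Lambda>" "?b \<in> Mor \<Lambda>" "src \<Lambda> ?a = rng \<Lambda> ?b" "dgr \<Lambda> ?a = dgr \<Lambda> \<mu>"
    using p by (simp_all add: path_simps[OF p] nat_vec_zero_le nat_vec_le_add Finite_Cartesian_Product.vec_eq_iff)
  from cmp_cancel[OF this(1-3) \<mu> this(4) eq] p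
  show "p \<in> cylinder \<Lambda> \<mu> \<and> ?b = \<eta>" by (simp add: cylinder_def)
next
  assume "p \<in> cylinder \<Lambda> \<mu> \<and> p (dgr \<Lambda> \<mu>, dgr \<Lambda> \<mu> + dgr \<Lambda> \<eta>) = \<eta>"
  then show "p \<in> cylinder \<Lambda> (cmp \<Lambda> \<mu> \<eta>)"
    using path_add[OF p] by (simp add: cylinder_def dgr_cmp[OF \<mu>])
qed

lemma cylinder_paths: "cylinder \<Lambda> \<mu> \<subseteq> infinite_paths \<Lambda>"
  by (auto simp: cylinder_def)

lemma cylinder_cmp_subset:
  assumes "\<mu> \<in> Mor \<Lambda>" "\<eta> \<in> Mor \<Lambda>" "src \<Lambda> \<mu> = rng \<Lambda> \<eta>"
  shows "cylinder \<Lambda> (cmp \<Lambda> \<mu> \<eta>) \<subseteq> cylinder \<Lambda> \<mu>"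
proof
  fix p assume p: "p \<in> cylinder \<Lambda> (cmp \<Lambda> \<mu> \<eta>)"
  then have "p \<in> infinite_paths \<Lambda>" by (simp add: cylinder_def)
  from cylinder_cmp[OF this assms] p show "p \<in> cylinder \<Lambda> \<mu>" by simp
qed

lemma cylinder_disjoint:
  assumes "dgr \<Lambda> \<mu> = dgr \<Lambda> \<nu>" "\<mu> \<noteq> \<nu>"
  shows "cylinder \<Lambda> \<mu> \<inter> cylinder \<Lambda> \<nu> = {}"
proof -
  have "\<mu> = \<nu>" if "p \<in> cylinder \<Lambda> \<mu>" "p \<in> cylinder \<Lambda> \<nu>" for p
  proof -
    have "\<mu> = p (0, dgr \<Lambda> \<mu>)" "\<nu> = p (0, dgr \<Lambda> \<nu>)" using that by (simp_all add: cylinder_def)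
    then show ?thesis using assms(1) by metis
  qed
  then show ?thesis using assms(2) by blast
qed

lemma path_in_cylinder:
  assumes "p \<in> infinite_paths \<Lambda>"
  shows "p (0, n) \<in> of_degree \<Lambda> n" "p \<in> cylinder \<Lambda> (p (0, n))"
proof -
  have deg: "dgr \<Lambda> (p (0, n)) = n"
    using dgr_path[OF assms nat_vec_zero_le, of n] by simp
  then show "p (0, n) \<in> of_degree \<Lambda> n"
    using path_Mor[OF assms nat_vec_zero_le, of n] by (simp add: of_degree_def)
  show "p \<in> cylinder \<Lambda> (p (0, n))" using assms by (simp add: cylinder_def deg)
qed

text \<open>The longer segment p(0,n) is \<open>\<mu>\<close> composed with p(d(mu),n), so its
  cylinder is smaller.\<close>

lemma cylinder_mono:
  assumes p: "p \<in> cylinder \<Lambda> \<mu>" and "dgr \<Lambda> \<mu> \<le> n"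
  shows "cylinder \<Lambda> (p (0, n)) \<subseteq> cylinder \<Lambda> \<mu>"
proof -
  have path: "p \<in> infinite_paths \<Lambda>" and \<mu>: "p (0, dgr \<Lambda> \<mu>) = \<mu>" using p by (auto simp: cylinder_def)
  have "p (0, n) = cmp \<Lambda> \<mu> (p (dgr \<Lambda> \<mu>, n))"
    using path_cmp[OF path nat_vec_zero_le assms(2)] \<mu> by simp
  moreover have "\<mu> \<in> Mor \<Lambda>" "src \<Lambda> \<mu> = rng \<Lambda> (p (dgr \<Lambda> \<mu>, n))"
    using path_Mor[OF path nat_vec_zero_le, of "dgr \<Lambda> \<mu>"] src_path[OF path nat_vec_zero_le, of "dgr \<Lambda> \<mu>"]
      rng_path[OF path assms(2)] \<mu> by simp_all
  ultimately show ?thesis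
    using cylinder_cmp_subset path_Mor[OF path assms(2)] by simp
qed

text \<open>The cylinder of \<open>\<mu>\<close> is partitioned by its extensions: for a path in it,
  the segment following \<open>\<mu>\<close> is the one extension that contributes 1.\<close>

lemma chi_eq_sum:
  assumes \<mu>: "\<mu> \<in> Mor \<Lambda>"
  shows "chi \<Lambda> \<mu> p = (\<Sum>\<eta>\<in>extensions \<mu> n. chi \<Lambda> (cmp \<Lambda> \<mu> \<eta>) p)"
proof (cases "p \<in> cylinder \<Lambda> \<mu>")
  case True
  then have p: "p \<in> infinite_paths \<Lambda>" and \<mu>p: "p (0, dgr \<Lambda> \<mu>) = \<mu>" by (auto simp: cylinder_def)
  let ?e = "p (dgr \<Lambda> \<mu>, dgr \<Lambda> \<mu> + n)"
  have "src \<Lambda> \<mu> = p (dgr \<Lambda> \<mu>, dgr \<Lambda> \<mu>)"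
    using src_path[OF p nat_vec_zero_le, of "dgr \<Lambda> \<mu>"] \<mu>p by simp
  then have "?e \<in> extensions \<mu> n"
    using p by (simp add: extensions_def of_degree_def path_simps[OF p] nat_vec_le_add Finite_Cartesian_Product.vec_eq_iff)
  moreover have "chi \<Lambda> (cmp \<Lambda> \<mu> \<eta>) p = (if \<eta> = ?e then 1 else 0 :: complex)" if "\<eta> \<in> extensions \<mu> n" for \<eta>
    using cylinder_cmp[OF p \<mu> extensionsD(1,3)[OF that]] extensionsD(2)[OF that] True
    by (auto simp: indicator_def)
  ultimately show ?thesis using True finite_extensions by simp
next
  case False
  then show ?thesis
    using cylinder_cmp_subset[OF \<mu> extensionsD(1,3)[of _ \<mu> n]]
    by (subst sum.neutral) (auto simp: indicator_def)
qed

text \<open>The restriction keeps the shifted path extensional, as membership in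
  \<open>infinite_paths\<close> demands.\<close>

definition shift :: "nat ^ 'k \<Rightarrow> ('a, 'k) path \<Rightarrow> ('a, 'k) path" where
  "shift d p = restrict (\<lambda>(m, n). p (m + d, n + d)) (Mor Omega)"

lemma shift_apply: "m \<le> n \<Longrightarrow> shift d p (m, n) = p (m + d, n + d)"
  by (simp add: shift_def Omega_def)

lemma shift_path:
  assumes p: "p \<in> infinite_paths \<Lambda>"
  shows "shift d p \<in> infinite_paths \<Lambda>"
proof -
  have le: "m + d \<le> n + d" if "m \<le> n" for m n :: "nat ^ 'k"
    using that by (simp add: Finite_Cartesian_Product.less_eq_vec_def)
  have "cat_functor Omega \<Lambda> (shift d p)"
    unfolding cat_functor_def
  proof (intro conjI ballI impI)
    fix \<mu> :: "(nat ^ 'k) \<times> (nat ^ 'k)" assume "\<mu> \<in> Mor Omega"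
    then obtain m n where [simp]: "\<mu> = (m, n)" and mn: "m \<le> n" by (auto simp: Omega_def)
    show "shift d p \<mu> \<in> Mor \<Lambda>" "shift d p (rng Omega \<mu>) = rng \<Lambda> (shift d p \<mu>)"
      "shift d p (src Omega \<mu>) = src \<Lambda> (shift d p \<mu>)"
      using path_simps[OF p le[OF mn]] mn by (simp_all add: shift_apply Omega_def)
    fix \<nu> :: "(nat ^ 'k) \<times> (nat ^ 'k)" assume "\<nu> \<in> Mor Omega" "src Omega \<mu> = rng Omega \<nu>"
    then obtain l where [simp]: "\<nu> = (n, l)" and nl: "n \<le> l" by (auto simp: Omega_def)
    show "shift d p (cmp Omega \<mu> \<nu>) = cmp \<Lambda> (shift d p \<mu>) (shift d p \<nu>)"
      using path_cmp[OF p le[OF mn] le[OF nl]] mn nl order_trans[OF mn nl]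
      by (simp add: shift_apply Omega_def)
  qed
  moreover have "dgr \<Lambda> (shift d p \<mu>) = dgr Omega \<mu>" if "\<mu> \<in> Mor Omega" for \<mu>
    using that dgr_path[OF p le] by (auto simp: Omega_def shift_apply Finite_Cartesian_Product.vec_eq_iff)
  ultimately show ?thesis by (simp add: infinite_paths_def shift_def)
qed

text \<open>Composability is automatic on the left: the vertex p(d(mu),d(mu)) is at once the source
  of \<open>\<mu>\<close> and the range of \<open>\<eta>\<close>.\<close>

lemma shift_cylinder:
  assumes p: "p \<in> infinite_paths \<Lambda>" and \<mu>: "\<mu> \<in> Mor \<Lambda>" "\<eta> \<in> Mor \<Lambda>"
  shows "p \<in> cylinder \<Lambda> \<mu> \<and> shift (dgr \<Lambda> \<mu>) p \<in> cylinder \<Lambda> \<eta> \<longleftrightarrow>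
    src \<Lambda> \<mu> = rng \<Lambda> \<eta> \<and> p \<in> cylinder \<Lambda> (cmp \<Lambda> \<mu> \<eta>)"
proof (cases "src \<Lambda> \<mu> = rng \<Lambda> \<eta>")
  case True
  then show ?thesis
    using cylinder_cmp[OF p \<mu> True] shift_path[OF p, of "dgr \<Lambda> \<mu>"]
    by (simp add: cylinder_def shift_apply nat_vec_zero_le add.commute)
next
  case False
  have "src \<Lambda> \<mu> = rng \<Lambda> \<eta>" if "p \<in> cylinder \<Lambda> \<mu>" "shift (dgr \<Lambda> \<mu>) p \<in> cylinder \<Lambda> \<eta>"
  proof -
    have "p (0, dgr \<Lambda> \<mu>) = \<mu>" "p (dgr \<Lambda> \<mu>, dgr \<Lambda> \<mu> + dgr \<Lambda> \<eta>) = \<eta>"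
      using that by (auto simp: cylinder_def shift_apply nat_vec_zero_le add.commute)
    then show ?thesis
      using src_path[OF p nat_vec_zero_le, of "dgr \<Lambda> \<mu>"]
        rng_path[OF p nat_vec_le_add, of "dgr \<Lambda> \<mu>" "dgr \<Lambda> \<eta>"] by simp
  qed
  with False show ?thesis by blast
qed

section \<open>Diagonal cylinders as a pi-system generating the Borel sets\<close>

abbreviation diag :: "nat \<Rightarrow> nat ^ 'k" where
  "diag n \<equiv> (\<chi> i. n)"

text \<open>The empty set is included so that disjoint cylinders also have their intersection in the
  family.\<close>

definition diagonal_cylinders :: "('a, 'k) path set set" where
  "diagonal_cylinders = insert {} (\<Union>n. cylinder \<Lambda> ` of_degree \<Lambda> (diag n))"

lemma diagonal_cylinders_paths: "diagonal_cylinders \<subseteq> Pow (infinite_paths \<Lambda>)"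
  using cylinder_paths by (auto simp: diagonal_cylinders_def)

lemma countable_diagonal_cylinders: "countable diagonal_cylinders"
  unfolding diagonal_cylinders_def
  by (intro countable_insert countable_UN[OF countableI_type] countable_finite finite_imageI finite_of_degree)

lemma diag_mono: "m \<le> n \<Longrightarrow> diag m \<le> diag n"
  by (simp add: Finite_Cartesian_Product.less_eq_vec_def)

lemma dgr_le_diag: "(n :: nat ^ 'k) \<le> diag (Max (range (\<lambda>i. n $ i)))"
  by (simp add: Finite_Cartesian_Product.less_eq_vec_def)

text \<open>Diagonal degrees are totally ordered, so two such cylinders with a common path are
  nested, the one of larger degree inside the other.\<close>

lemma Int_stable_diagonal_cylinders: "Int_stable diagonal_cylinders"
proof (rule Int_stableI)
  have *: "cylinder \<Lambda> \<mu> \<inter> cylinder \<Lambda> \<nu> \<in> diagonal_cylinders"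
    if "m \<le> n" "\<mu> \<in> of_degree \<Lambda> (diag m)" "\<nu> \<in> of_degree \<Lambda> (diag n)" for m n :: nat and \<mu> \<nu>
  proof (cases "cylinder \<Lambda> \<mu> \<inter> cylinder \<Lambda> \<nu> = {}")
    case True
    then show ?thesis by (simp add: diagonal_cylinders_def)
  next
    case False
    then obtain p where p: "p \<in> cylinder \<Lambda> \<mu>" "p \<in> cylinder \<Lambda> \<nu>" by blast
    then have "cylinder \<Lambda> \<nu> \<subseteq> cylinder \<Lambda> \<mu>"
      using cylinder_mono[OF p(1), of "diag n"] that diag_mono[of m n]
      by (auto simp: of_degree_def cylinder_def)
    then have "cylinder \<Lambda> \<mu> \<inter> cylinder \<Lambda> \<nu> = cylinder \<Lambda> \<nu>" by blast
    then show ?thesis using that by (auto simp: diagonal_cylinders_def)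
  qed
  fix a b assume "a \<in> diagonal_cylinders" "b \<in> diagonal_cylinders"
  then consider "a \<inter> b = {}" | m n \<mu> \<nu> where "\<mu> \<in> of_degree \<Lambda> (diag m)" "\<nu> \<in> of_degree \<Lambda> (diag n)"
      "a = cylinder \<Lambda> \<mu>" "b = cylinder \<Lambda> \<nu>"
    by (auto simp: diagonal_cylinders_def)
  then show "a \<inter> b \<in> diagonal_cylinders"
  proof cases
    case 1
    then show ?thesis by (simp add: diagonal_cylinders_def)
  next
    case (2 m n \<mu> \<nu>)
    then show ?thesis using *[of m n \<mu> \<nu>] *[of n m \<nu> \<mu>] by (cases "m \<le> n") (auto simp: Int_commute)
  qed
qed

text \<open>Diagonal cylinders form a countable base: every point of an open set has one of its own
  inside the set, and the set is the countable union of those it contains.\<close>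

lemma open_sigma_sets:
  assumes "generate_topology_on (cylinder \<Lambda> ` Mor \<Lambda>) U"
  shows "U \<in> sigma_sets (infinite_paths \<Lambda>) diagonal_cylinders"
proof -
  have nbhd: "\<forall>p\<in>U. p \<in> infinite_paths \<Lambda> \<and> (\<exists>n. cylinder \<Lambda> (p (0, diag n)) \<subseteq> U)"
    using assms
  proof induction
    case Empty
    then show ?case by simp
  next
    case (Int a b)
    show ?case
    proof
      fix p assume p: "p \<in> a \<inter> b"
      then obtain m n where mn: "cylinder \<Lambda> (p (0, diag m)) \<subseteq> a" "cylinder \<Lambda> (p (0, diag n)) \<subseteq> b"
        and path: "p \<in> infinite_paths \<Lambda>" using Int.IH by blast
      \<comment> \<open>The larger of the two diagonal degrees refines both neighbourhoods.\<close>
      have "cylinder \<Lambda> (p (0, diag (max m n))) \<subseteq> cylinder \<Lambda> (p (0, diag k))" if "k \<le> max m n" for k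
        using path_in_cylinder[OF path, of "diag k"] diag_mono[OF that]
        by (intro cylinder_mono) (auto simp: of_degree_def)
      from this[of m] this[of n] mn have "cylinder \<Lambda> (p (0, diag (max m n))) \<subseteq> a \<inter> b" by auto
      then show "p \<in> infinite_paths \<Lambda> \<and> (\<exists>n. cylinder \<Lambda> (p (0, diag n)) \<subseteq> a \<inter> b)"
        using path by blast
    qed
  next
    case (UN K)
    then show ?case by blast
  next
    case (Basis s)
    then obtain \<mu> where \<mu>: "s = cylinder \<Lambda> \<mu>" by blast
    show ?case
      unfolding \<mu> using cylinder_mono[OF _ dgr_le_diag] cylinder_paths by blast
  qed
  have "\<exists>Z\<in>diagonal_cylinders. p \<in> Z \<and> Z \<subseteq> U" if "p \<in> U" for p
  proof -
    obtain n where n: "cylinder \<Lambda> (p (0, diag n)) \<subseteq> U" and p: "p \<in> infinite_paths \<Lambda>"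
      using nbhd \<open>p \<in> U\<close> by blast
    have "cylinder \<Lambda> (p (0, diag n)) \<in> diagonal_cylinders"
      using path_in_cylinder(1)[OF p] unfolding diagonal_cylinders_def by blast
    with n path_in_cylinder(2)[OF p] show ?thesis by blast
  qed
  then have "U = \<Union>{Z \<in> diagonal_cylinders. Z \<subseteq> U}" by blast
  moreover have "countable {Z \<in> diagonal_cylinders. Z \<subseteq> U}"
    by (rule countable_subset[OF _ countable_diagonal_cylinders]) auto
  ultimately show ?thesis
    using sigma_sets_UNION[of "{Z \<in> diagonal_cylinders. Z \<subseteq> U}" "infinite_paths \<Lambda>" diagonal_cylinders]
    by (metis (no_types, lifting) mem_Collect_eq sigma_sets.Basic)
qed

end

section \<open>The path measure and the operators S\<close>

locale path_space = finite_k_graph \<Lambda> for \<Lambda> :: "('a, 'k::finite) kgraph" +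
  fixes x :: "'a \<Rightarrow> real" and M :: "('a, 'k) path measure"
  assumes no_src: "no_sources \<Lambda>" and pf: "perron_frobenius_vector \<Lambda> x" and pm: "path_measure \<Lambda> x M"
begin

section \<open>Borel structure, positivity and scaling of the path measure\<close>

lemma prob_space_M: "prob_space M"
  using pm by (simp add: path_measure_def)

lemma finite_measure_M: "finite_measure M"
  using prob_space_M by (rule prob_space.finite_measure)

lemma open_paths: "generate_topology_on (cylinder \<Lambda> ` Mor \<Lambda>) U \<Longrightarrow> U \<subseteq> infinite_paths \<Lambda>"
  using open_sigma_sets[of U] sigma_sets_into_sp[OF diagonal_cylinders_paths] by blast

lemma sets_M_open: "sets M = sigma_sets (infinite_paths \<Lambda>) {U. generate_topology_on (cylinder \<Lambda> ` Mor \<Lambda>) U}"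
proof -
  have "{U. generate_topology_on (cylinder \<Lambda> ` Mor \<Lambda>) U} \<subseteq> Pow (infinite_paths \<Lambda>)"
    using open_paths by blast
  then show ?thesis
    using pm by (simp add: path_measure_def path_topology_def openin_topology_generated_by_iff)
qed

lemma sets_M: "sets M = sigma_sets (infinite_paths \<Lambda>) diagonal_cylinders"
  unfolding sets_M_open
proof (rule antisym)
  show "sigma_sets (infinite_paths \<Lambda>) {U. generate_topology_on (cylinder \<Lambda> ` Mor \<Lambda>) U}
      \<subseteq> sigma_sets (infinite_paths \<Lambda>) diagonal_cylinders"
    using open_sigma_sets by (intro sigma_sets_mono) blast
  have "generate_topology_on (cylinder \<Lambda> ` Mor \<Lambda>) Z" if "Z \<in> diagonal_cylinders" for Z
    using that unfolding diagonal_cylinders_def of_degree_def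
    by (auto intro: generate_topology_on.Empty generate_topology_on.Basis)
  then show "sigma_sets (infinite_paths \<Lambda>) diagonal_cylinders
      \<subseteq> sigma_sets (infinite_paths \<Lambda>) {U. generate_topology_on (cylinder \<Lambda> ` Mor \<Lambda>) U}"
    by (intro sigma_sets_mono') blast
qed

text \<open>\<open>path_measure\<close> prescribes the measurable sets; the underlying space is
  recovered as the largest of them.\<close>

lemma space_M: "space M = infinite_paths \<Lambda>"
proof -
  have "sets M = sets (sigma (infinite_paths \<Lambda>) diagonal_cylinders)"
    using diagonal_cylinders_paths by (simp add: sets_M)
  from sets_eq_imp_space_eq[OF this] diagonal_cylinders_paths
  show ?thesis by (simp add: space_measure_of)
qed

lemma cylinder_sets: "\<mu> \<in> Mor \<Lambda> \<Longrightarrow> cylinder \<Lambda> \<mu> \<in> sets M"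
  unfolding sets_M_open by (intro sigma_sets.Basic CollectI generate_topology_on.Basis) simp

lemma vertex_ext: "\<exists>v. v \<in> vertices \<Lambda>"
proof (rule ccontr)
  assume "\<not> ?thesis"
  then have "vertices \<Lambda> = {}" by blast
  then show False using pf by (simp add: perron_frobenius_vector_def)
qed

lemma x_pos: "v \<in> vertices \<Lambda> \<Longrightarrow> x v > 0"
  using pf by (simp add: perron_frobenius_vector_def)

text \<open>Absence of sources gives an edge of degree e_i at a vertex v, hence a positive entry in
  row v of A_i. The eigenvector equation at v then forces a positive eigenvalue.\<close>

lemma rho_pos: "rho \<Lambda> i > 0"
proof -
  obtain v where v: "v \<in> vertices \<Lambda>" using vertex_ext by blast
  obtain \<mu> where \<mu>: "\<mu> \<in> of_degree \<Lambda> (axis i 1)" "rng \<Lambda> \<mu> = v"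
    using no_src v unfolding no_sources_def by blast
  then have m: "\<mu> \<in> Mor \<Lambda>" by (simp add: of_degree_def)
  let ?w = "src \<Lambda> \<mu>"
  have w: "?w \<in> vertices \<Lambda>" using src_Mor[OF m] dgr_src[OF m] by (simp add: of_degree_def)
  have "finite {\<kappa> \<in> of_degree \<Lambda> (axis i 1). rng \<Lambda> \<kappa> = v \<and> src \<Lambda> \<kappa> = ?w}"
    using finite_of_degree by simp
  then have "vertex_matrix \<Lambda> i v ?w > 0"
    unfolding vertex_matrix_def using \<mu> by (auto simp: card_gt_0_iff)
  then have "0 < real (vertex_matrix \<Lambda> i v ?w) * x ?w" using x_pos[OF w] by simp
  also have "\<dots> \<le> (\<Sum>w\<in>vertices \<Lambda>. real (vertex_matrix \<Lambda> i v w) * x w)"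
    using w x_pos finite_of_degree
    by (intro member_le_sum[of ?w "vertices \<Lambda>" "\<lambda>w. real (vertex_matrix \<Lambda> i v w) * x w"])
      (auto intro!: mult_nonneg_nonneg simp: less_imp_le)
  also have "\<dots> = rho \<Lambda> i * x v" using pf v by (simp add: perron_frobenius_vector_def)
  finally show ?thesis using x_pos[OF v] by (simp add: zero_less_mult_iff)
qed

lemma rho_pow_pos: "rho_pow \<Lambda> n > 0"
  unfolding rho_pow_def by (intro prod_pos) (simp add: rho_pos)

lemma rho_pow_add: "rho_pow \<Lambda> (m + n) = rho_pow \<Lambda> m * rho_pow \<Lambda> n"
  by (simp add: rho_pow_def power_add prod.distrib)

lemma measure_cylinder:
  "\<mu> \<in> Mor \<Lambda> \<Longrightarrow> measure M (cylinder \<Lambda> \<mu>) = inverse (rho_pow \<Lambda> (dgr \<Lambda> \<mu>)) * x (src \<Lambda> \<mu>)"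
  using pm by (simp add: path_measure_def)

lemma measure_cylinder_pos:
  assumes "\<mu> \<in> Mor \<Lambda>" shows "measure M (cylinder \<Lambda> \<mu>) > 0"
proof -
  have "src \<Lambda> \<mu> \<in> vertices \<Lambda>" using src_Mor[OF assms] dgr_src[OF assms] by (simp add: of_degree_def)
  then show ?thesis using x_pos rho_pow_pos by (simp add: measure_cylinder[OF assms])
qed

text \<open>Prolonging at the front leaves the source alone, so only the power of rho changes. This
  is self-similarity on cylinders.\<close>

lemma measure_cylinder_cmp:
  assumes "\<mu> \<in> Mor \<Lambda>" "\<eta> \<in> Mor \<Lambda>" "src \<Lambda> \<mu> = rng \<Lambda> \<eta>"
  shows "measure M (cylinder \<Lambda> (cmp \<Lambda> \<mu> \<eta>))
    = inverse (rho_pow \<Lambda> (dgr \<Lambda> \<mu>)) * measure M (cylinder \<Lambda> \<eta>)"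
  using assms by (simp add: measure_cylinder cmp_Mor dgr_cmp src_cmp rho_pow_add)

lemma chi_L2: "\<mu> \<in> Mor \<Lambda> \<Longrightarrow> chi \<Lambda> \<mu> \<in> L2 M"
  using finite_measure_M cylinder_sets by (rule L2_indicator)

lemma chi_inner:
  "\<mu> \<in> Mor \<Lambda> \<Longrightarrow> \<nu> \<in> Mor \<Lambda> \<Longrightarrow>
    L2_inner M (chi \<Lambda> \<mu>) (chi \<Lambda> \<nu>) = of_real (measure M (cylinder \<Lambda> \<mu> \<inter> cylinder \<Lambda> \<nu>))"
  by (intro L2_inner_indicator finite_measure_M cylinder_sets)

text \<open>The preimage of the cylinder of \<open>\<eta>\<close> is the union of the cylinders of
  \<open>cmp \<Lambda> \<mu> \<eta>\<close> over the finitely many \<open>\<mu>\<close> of degree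
  \<open>d\<close> that compose with it.\<close>

lemma measurable_shift: "shift d \<in> measurable M M"
proof (rule measurable_sigma_sets[OF sets_M diagonal_cylinders_paths])
  show "shift d \<in> space M \<rightarrow> infinite_paths \<Lambda>" using shift_path by (auto simp: space_M)
  fix Z assume "Z \<in> diagonal_cylinders"
  then consider "Z = {}" | \<eta> where "\<eta> \<in> Mor \<Lambda>" "Z = cylinder \<Lambda> \<eta>"
    by (auto simp: diagonal_cylinders_def of_degree_def)
  then show "shift d -` Z \<inter> space M \<in> sets M"
  proof cases
    case (2 \<eta>)
    have "shift d -` Z \<inter> space M
        = (\<Union>\<mu>\<in>{\<mu> \<in> of_degree \<Lambda> d. src \<Lambda> \<mu> = rng \<Lambda> \<eta>}. cylinder \<Lambda> (cmp \<Lambda> \<mu> \<eta>))" (is "?L = ?R")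
    proof (intro equalityI subsetI)
      fix p assume "p \<in> ?L"
      then have p: "p \<in> infinite_paths \<Lambda>" and s: "shift d p \<in> cylinder \<Lambda> \<eta>"
        using 2 by (auto simp: space_M)
      have "p (0, d) \<in> Mor \<Lambda>" and d: "dgr \<Lambda> (p (0, d)) = d"
        using path_in_cylinder(1)[OF p, of d] by (simp_all add: of_degree_def)
      then show "p \<in> ?R"
        using shift_cylinder[OF p _ 2(1), of "p (0, d)"] path_in_cylinder[OF p, of d] s by auto
    next
      fix p assume "p \<in> ?R"
      then obtain \<mu> where \<mu>: "\<mu> \<in> Mor \<Lambda>" "dgr \<Lambda> \<mu> = d" "src \<Lambda> \<mu> = rng \<Lambda> \<eta>" "p \<in> cylinder \<Lambda> (cmp \<Lambda> \<mu> \<eta>)"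
        by (auto simp: of_degree_def)
      then have p: "p \<in> infinite_paths \<Lambda>" using cylinder_paths by blast
      show "p \<in> ?L" using shift_cylinder[OF p \<mu>(1) 2(1)] \<mu> p 2 by (simp add: space_M)
    qed
    also have "\<dots> \<in> sets M"
    proof (rule sets.finite_UN)
      show "finite {\<mu> \<in> of_degree \<Lambda> d. src \<Lambda> \<mu> = rng \<Lambda> \<eta>}" using finite_of_degree by simp
      show "cylinder \<Lambda> (cmp \<Lambda> \<mu> \<eta>) \<in> sets M" if "\<mu> \<in> {\<mu> \<in> of_degree \<Lambda> d. src \<Lambda> \<mu> = rng \<Lambda> \<eta>}" for \<mu>
        using that 2 by (intro cylinder_sets cmp_Mor) (auto simp: of_degree_def)
    qed
    finally show ?thesis .
  qed simp
qed

text \<open>Every path in the cylinder of \<open>\<eta>\<close> starts at the range of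
  \<open>\<eta>\<close>.\<close>

lemma vertex_cylinder:
  assumes "v \<in> vertices \<Lambda>" "\<eta> \<in> Mor \<Lambda>"
  shows "cylinder \<Lambda> v \<inter> cylinder \<Lambda> \<eta> = (if rng \<Lambda> \<eta> = v then cylinder \<Lambda> \<eta> else {})"
proof -
  have "p \<in> cylinder \<Lambda> v \<longleftrightarrow> rng \<Lambda> \<eta> = v" if p: "p \<in> cylinder \<Lambda> \<eta>" for p
  proof -
    have path: "p \<in> infinite_paths \<Lambda>" and e: "p (0, dgr \<Lambda> \<eta>) = \<eta>" using p by (simp_all add: cylinder_def)
    have "rng \<Lambda> \<eta> = p (0, 0)" using rng_path[OF path nat_vec_zero_le, of "dgr \<Lambda> \<eta>"] e by simp
    then show ?thesis using path assms(1) by (auto simp: cylinder_def of_degree_def)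
  qed
  then show ?thesis by auto
qed

text \<open>The self-similarity of \<open>M\<close> that makes \<open>S\<^sub>\<mu>\<close> well defined and bounded.\<close>

lemma distr_shift:
  assumes \<mu>: "\<mu> \<in> Mor \<Lambda>"
  shows "distr (density M (indicator (cylinder \<Lambda> \<mu>))) M (shift (dgr \<Lambda> \<mu>))
    = density M (\<lambda>p. ennreal (inverse (rho_pow \<Lambda> (dgr \<Lambda> \<mu>))) * indicator (cylinder \<Lambda> (src \<Lambda> \<mu>)) p)"
    (is "?L = ?R")
proof -
  interpret finite_measure M by (rule finite_measure_M)
  let ?d = "dgr \<Lambda> \<mu>" and ?v = "src \<Lambda> \<mu>"
  have v: "?v \<in> vertices \<Lambda>" using src_Mor[OF \<mu>] dgr_src[OF \<mu>] by (simp add: of_degree_def)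
  note [measurable] = measurable_shift cylinder_sets[OF \<mu>] cylinder_sets[OF src_Mor[OF \<mu>]]
  have shift_density: "shift ?d \<in> measurable (density M (indicator (cylinder \<Lambda> \<mu>))) M"
    using measurable_shift by (simp add: measurable_cong_sets[OF sets_density refl])
  have L: "emeasure ?L Z = emeasure M (cylinder \<Lambda> \<mu> \<inter> (shift ?d -` Z \<inter> space M))" if "Z \<in> sets M" for Z
  proof -
    have Z: "shift ?d -` Z \<inter> space M \<in> sets M" using measurable_shift that by (rule measurable_sets)
    have "emeasure ?L Z = emeasure (density M (indicator (cylinder \<Lambda> \<mu>))) (shift ?d -` Z \<inter> space M)"
      using that by (subst emeasure_distr[OF shift_density]) simp_all
    also have "\<dots> = (\<integral>\<^sup>+p. indicator (cylinder \<Lambda> \<mu>) p * indicator (shift ?d -` Z \<inter> space M) p \<partial>M)"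
      by (intro emeasure_density borel_measurable_indicator cylinder_sets \<mu> Z)
    also have "\<dots> = (\<integral>\<^sup>+p. indicator (cylinder \<Lambda> \<mu> \<inter> (shift ?d -` Z \<inter> space M)) p \<partial>M)"
      by (intro nn_integral_cong) (simp add: indicator_inter_arith)
    also have "\<dots> = emeasure M (cylinder \<Lambda> \<mu> \<inter> (shift ?d -` Z \<inter> space M))"
      using Z cylinder_sets[OF \<mu>] by (intro nn_integral_indicator) simp
    finally show ?thesis .
  qed
  have R: "emeasure ?R Z = ennreal (inverse (rho_pow \<Lambda> ?d)) * emeasure M (cylinder \<Lambda> ?v \<inter> Z)"
    if "Z \<in> sets M" for Z
  proof -
    have "emeasure ?R Z = (\<integral>\<^sup>+p. ennreal (inverse (rho_pow \<Lambda> ?d)) * indicator (cylinder \<Lambda> ?v) p * indicator Z p \<partial>M)"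
      using that by (intro emeasure_density) measurable
    also have "\<dots> = (\<integral>\<^sup>+p. ennreal (inverse (rho_pow \<Lambda> ?d)) * indicator (cylinder \<Lambda> ?v \<inter> Z) p \<partial>M)"
      by (intro nn_integral_cong) (simp add: indicator_inter_arith mult.assoc)
    also have "\<dots> = ennreal (inverse (rho_pow \<Lambda> ?d)) * emeasure M (cylinder \<Lambda> ?v \<inter> Z)"
      using that cylinder_sets[OF src_Mor[OF \<mu>]] by (intro nn_integral_cmult_indicator) simp
    finally show ?thesis .
  qed
  \<comment> \<open>On the left the set is the cylinder of
    \<open>cmp \<Lambda> \<mu> \<eta>\<close>, on the right it is the intersection with a vertex
    cylinder; both are null unless \<open>\<mu>\<close> and \<open>\<eta>\<close> compose.\<close>
  have cyl: "emeasure ?L (cylinder \<Lambda> \<eta>) = emeasure ?R (cylinder \<Lambda> \<eta>)"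
    "emeasure ?L (cylinder \<Lambda> \<eta>) \<noteq> \<infinity>" if \<eta>: "\<eta> \<in> Mor \<Lambda>" for \<eta>
  proof -
    have "cylinder \<Lambda> \<mu> \<inter> (shift ?d -` cylinder \<Lambda> \<eta> \<inter> space M)
        = (if ?v = rng \<Lambda> \<eta> then cylinder \<Lambda> (cmp \<Lambda> \<mu> \<eta>) else {})"
      using shift_cylinder[OF _ \<mu> \<eta>] cylinder_paths by (auto simp: space_M)
    then have 1: "emeasure ?L (cylinder \<Lambda> \<eta>)
        = (if ?v = rng \<Lambda> \<eta> then ennreal (inverse (rho_pow \<Lambda> ?d) * measure M (cylinder \<Lambda> \<eta>)) else 0)"
      unfolding L[OF cylinder_sets[OF \<eta>]]
      by (simp add: emeasure_eq_measure measure_cylinder_cmp[OF \<mu> \<eta>])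
    have "emeasure ?R (cylinder \<Lambda> \<eta>)
        = (if ?v = rng \<Lambda> \<eta> then ennreal (inverse (rho_pow \<Lambda> ?d) * measure M (cylinder \<Lambda> \<eta>)) else 0)"
      unfolding R[OF cylinder_sets[OF \<eta>]] vertex_cylinder[OF v \<eta>]
      using rho_pow_pos[of ?d] by (simp add: emeasure_eq_measure ennreal_mult)
    with 1 show "emeasure ?L (cylinder \<Lambda> \<eta>) = emeasure ?R (cylinder \<Lambda> \<eta>)" by simp
    from 1 show "emeasure ?L (cylinder \<Lambda> \<eta>) \<noteq> \<infinity>" by simp
  qed
  show ?thesis
  proof (rule measure_eqI_generator_eq_countable[OF Int_stable_diagonal_cylinders diagonal_cylinders_paths])
    show "emeasure ?L Z = emeasure ?R Z" if "Z \<in> diagonal_cylinders" for Z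
      using that cyl(1) by (auto simp: diagonal_cylinders_def of_degree_def)
    show "sets ?L = sigma_sets (infinite_paths \<Lambda>) diagonal_cylinders"
      "sets ?R = sigma_sets (infinite_paths \<Lambda>) diagonal_cylinders"
      by (simp_all add: sets_M)
    \<comment> \<open>The vertex cylinders are the countable cover by generators of finite measure
      that the uniqueness theorem asks for.\<close>
    show "cylinder \<Lambda> ` of_degree \<Lambda> (diag 0) \<subseteq> diagonal_cylinders"
      by (auto simp: diagonal_cylinders_def)
    show "\<Union> (cylinder \<Lambda> ` of_degree \<Lambda> (diag 0)) = infinite_paths \<Lambda>"
      using path_in_cylinder[of _ "diag 0"] cylinder_paths by blast
    show "countable (cylinder \<Lambda> ` of_degree \<Lambda> (diag 0))"
      by (intro countable_finite finite_imageI finite_of_degree)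
    show "emeasure ?L Z \<noteq> \<infinity>" if "Z \<in> cylinder \<Lambda> ` of_degree \<Lambda> (diag 0)" for Z
      using that cyl(2) by (auto simp: of_degree_def)
  qed
qed

text \<open>Change of variables along the shift; the power of rho in front cancels the inverse one
  in the density of \<open>distr_shift\<close>.\<close>

lemma nn_integral_shift:
  assumes \<mu>: "\<mu> \<in> Mor \<Lambda>" and g: "g \<in> borel_measurable M"
  shows "ennreal (rho_pow \<Lambda> (dgr \<Lambda> \<mu>)) * (\<integral>\<^sup>+p. indicator (cylinder \<Lambda> \<mu>) p * g (shift (dgr \<Lambda> \<mu>) p) \<partial>M)
    = (\<integral>\<^sup>+p. indicator (cylinder \<Lambda> (src \<Lambda> \<mu>)) p * g p \<partial>M)"
proof -
  let ?d = "dgr \<Lambda> \<mu>" and ?r = "rho_pow \<Lambda> (dgr \<Lambda> \<mu>)"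
  note [measurable] = measurable_shift cylinder_sets[OF \<mu>] cylinder_sets[OF src_Mor[OF \<mu>]] g
  have shift_density: "shift ?d \<in> measurable (density M (indicator (cylinder \<Lambda> \<mu>))) M"
    using measurable_shift by (simp add: measurable_cong_sets[OF sets_density refl])
  have "(\<integral>\<^sup>+p. indicator (cylinder \<Lambda> \<mu>) p * g (shift ?d p) \<partial>M)
      = (\<integral>\<^sup>+p. g (shift ?d p) \<partial>density M (indicator (cylinder \<Lambda> \<mu>)))"
    by (intro nn_integral_density[symmetric]) measurable
  also have "\<dots> = (\<integral>\<^sup>+p. g p \<partial>distr (density M (indicator (cylinder \<Lambda> \<mu>))) M (shift ?d))"
    by (intro nn_integral_distr[symmetric] shift_density) (simp add: g)
  also have "\<dots> = (\<integral>\<^sup>+p. ennreal (inverse ?r) * indicator (cylinder \<Lambda> (src \<Lambda> \<mu>)) p * g p \<partial>M)"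
    unfolding distr_shift[OF \<mu>] by (intro nn_integral_density) measurable
  also have "\<dots> = ennreal (inverse ?r) * (\<integral>\<^sup>+p. indicator (cylinder \<Lambda> (src \<Lambda> \<mu>)) p * g p \<partial>M)"
    unfolding mult.assoc by (intro nn_integral_cmult) measurable
  finally have "ennreal ?r * (\<integral>\<^sup>+p. indicator (cylinder \<Lambda> \<mu>) p * g (shift ?d p) \<partial>M)
      = (ennreal ?r * ennreal (inverse ?r)) * (\<integral>\<^sup>+p. indicator (cylinder \<Lambda> (src \<Lambda> \<mu>)) p * g p \<partial>M)"
    by (simp only: mult.assoc)
  also have "ennreal ?r * ennreal (inverse ?r) = 1"
    using rho_pow_pos[of ?d] by (simp flip: ennreal_mult)
  finally show ?thesis by simp
qed

text \<open>The concrete form of S_mu, and the witness for the choice in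
  \<open>S_op\<close>.\<close>

definition shift_op :: "'a \<Rightarrow> (('a, 'k) path \<Rightarrow> complex) \<Rightarrow> ('a, 'k) path \<Rightarrow> complex" where
  "shift_op \<mu> f p = of_real (sqrt (rho_pow \<Lambda> (dgr \<Lambda> \<mu>))) * (chi \<Lambda> \<mu> p * f (shift (dgr \<Lambda> \<mu>) p))"

text \<open>By the change of variables the squared norm of the image is the integral of |f|^2 over
  the cylinder of s(mu). The square root in \<open>shift_op\<close> is the normalization that
  produces this.\<close>

lemma shift_op:
  assumes \<mu>: "\<mu> \<in> Mor \<Lambda>" and f: "f \<in> L2 M"
  shows shift_op_L2: "shift_op \<mu> f \<in> L2 M"
    and shift_op_norm: "L2_norm M (shift_op \<mu> f) \<le> L2_norm M f"
proof -
  let ?d = "dgr \<Lambda> \<mu>" and ?r = "rho_pow \<Lambda> (dgr \<Lambda> \<mu>)"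
  note [measurable] = measurable_shift cylinder_sets[OF \<mu>] L2_measurable[OF f]
  have meas [measurable]: "shift_op \<mu> f \<in> borel_measurable M"
    unfolding shift_op_def by measurable
  have sq: "ennreal ((cmod (shift_op \<mu> f p))\<^sup>2)
      = ennreal ?r * (indicator (cylinder \<Lambda> \<mu>) p * ennreal ((cmod (f (shift ?d p)))\<^sup>2))" for p
    using rho_pow_pos[of ?d]
    by (auto simp: shift_op_def indicator_def norm_mult power_mult_distrib ennreal_mult)
  have "(\<integral>\<^sup>+p. ennreal ((cmod (shift_op \<mu> f p))\<^sup>2) \<partial>M)
      = ennreal ?r * (\<integral>\<^sup>+p. indicator (cylinder \<Lambda> \<mu>) p * ennreal ((cmod (f (shift ?d p)))\<^sup>2) \<partial>M)"
    unfolding sq by (intro nn_integral_cmult) measurable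
  also have "\<dots> = (\<integral>\<^sup>+p. indicator (cylinder \<Lambda> (src \<Lambda> \<mu>)) p * ennreal ((cmod (f p))\<^sup>2) \<partial>M)"
    by (intro nn_integral_shift[OF \<mu>]) measurable
  also have "\<dots> \<le> (\<integral>\<^sup>+p. ennreal ((cmod (f p))\<^sup>2) \<partial>M)"
    by (intro nn_integral_mono) (auto simp: indicator_def)
  also have "\<dots> = ennreal (\<integral>p. (cmod (f p))\<^sup>2 \<partial>M)"
    by (intro nn_integral_eq_integral L2_integrable_square f) simp
  finally have bound: "(\<integral>\<^sup>+p. ennreal ((cmod (shift_op \<mu> f p))\<^sup>2) \<partial>M) \<le> ennreal (\<integral>p. (cmod (f p))\<^sup>2 \<partial>M)" .
  have int: "integrable M (\<lambda>p. (cmod (shift_op \<mu> f p))\<^sup>2)"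
  proof (rule integrableI_bounded)
    show "(\<integral>\<^sup>+p. ennreal (norm ((cmod (shift_op \<mu> f p))\<^sup>2)) \<partial>M) < \<infinity>"
      using bound by (simp add: le_less_trans)
  qed measurable
  then show "shift_op \<mu> f \<in> L2 M" using meas by (simp add: L2_def)
  have "ennreal (\<integral>p. (cmod (shift_op \<mu> f p))\<^sup>2 \<partial>M) \<le> ennreal (\<integral>p. (cmod (f p))\<^sup>2 \<partial>M)"
    using bound nn_integral_eq_integral[OF int] by simp
  then show "L2_norm M (shift_op \<mu> f) \<le> L2_norm M f"
    unfolding L2_norm_def by (intro real_sqrt_le_mono) (simp add: integral_nonneg)
qed

text \<open>\<open>shift_op\<close> satisfies the defining condition, so the chosen operator does as
  well; everything later relies on this condition alone.\<close>

lemma S_op: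
  assumes \<mu>: "\<mu> \<in> Mor \<Lambda>"
  shows S_op_bounded: "L2_bounded_operator M (S_op \<Lambda> M \<mu>)"
    and S_op_chi: "\<eta> \<in> Mor \<Lambda> \<Longrightarrow> AE p in M. S_op \<Lambda> M \<mu> (chi \<Lambda> \<eta>) p =
           (if src \<Lambda> \<mu> = rng \<Lambda> \<eta>
            then complex_of_real (sqrt (rho_pow \<Lambda> (dgr \<Lambda> \<mu>))) * chi \<Lambda> (cmp \<Lambda> \<mu> \<eta>) p else 0)"
proof -
  have bounded: "L2_bounded_operator M (shift_op \<mu>)"
    unfolding L2_bounded_operator_def
  proof (intro conjI ballI allI)
    show "shift_op \<mu> f \<in> L2 M" if "f \<in> L2 M" for f using \<mu> that by (rule shift_op_L2)
    show "AE p in M. shift_op \<mu> (\<lambda>y. a * f y + b * g y) p = a * shift_op \<mu> f p + b * shift_op \<mu> g p" for f g a b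
      by (rule AE_I2) (simp add: shift_op_def algebra_simps)
    show "\<exists>K. \<forall>f\<in>L2 M. L2_norm M (shift_op \<mu> f) \<le> K * L2_norm M f"
      using shift_op_norm[OF \<mu>] by (intro exI[of _ 1]) simp
  qed
  have chi: "AE p in M. shift_op \<mu> (chi \<Lambda> \<eta>) p =
           (if src \<Lambda> \<mu> = rng \<Lambda> \<eta>
            then complex_of_real (sqrt (rho_pow \<Lambda> (dgr \<Lambda> \<mu>))) * chi \<Lambda> (cmp \<Lambda> \<mu> \<eta>) p else 0)"
    if \<eta>: "\<eta> \<in> Mor \<Lambda>" for \<eta>
  proof (rule AE_I2)
    fix p assume "p \<in> space M"
    then have p: "p \<in> infinite_paths \<Lambda>" by (simp add: space_M)
    show "shift_op \<mu> (chi \<Lambda> \<eta>) p = (if src \<Lambda> \<mu> = rng \<Lambda> \<eta>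
            then complex_of_real (sqrt (rho_pow \<Lambda> (dgr \<Lambda> \<mu>))) * chi \<Lambda> (cmp \<Lambda> \<mu> \<eta>) p else 0)"
      using shift_cylinder[OF p \<mu> \<eta>] by (auto simp: shift_op_def indicator_def)
  qed
  have "L2_bounded_operator M (S_op \<Lambda> M \<mu>) \<and> (\<forall>\<eta>\<in>Mor \<Lambda>. AE p in M. S_op \<Lambda> M \<mu> (chi \<Lambda> \<eta>) p =
           (if src \<Lambda> \<mu> = rng \<Lambda> \<eta>
            then complex_of_real (sqrt (rho_pow \<Lambda> (dgr \<Lambda> \<mu>))) * chi \<Lambda> (cmp \<Lambda> \<mu> \<eta>) p else 0))"
    unfolding S_op_def
    by (rule someI[of _ "shift_op \<mu>"]) (use bounded chi in blast)
  then show "L2_bounded_operator M (S_op \<Lambda> M \<mu>)"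
    and "\<eta> \<in> Mor \<Lambda> \<Longrightarrow> AE p in M. S_op \<Lambda> M \<mu> (chi \<Lambda> \<eta>) p =
           (if src \<Lambda> \<mu> = rng \<Lambda> \<eta>
            then complex_of_real (sqrt (rho_pow \<Lambda> (dgr \<Lambda> \<mu>))) * chi \<Lambda> (cmp \<Lambda> \<mu> \<eta>) p else 0)"
    by blast+
qed

end

section \<open>Wavelet spaces\<close>

context path_space
begin

section \<open>The chains of the spaces V_n and R_n\<close>

abbreviation "V \<equiv> V_space \<Lambda> M"

lemma diag_0: "diag 0 = 0"
  by (simp add: Finite_Cartesian_Product.vec_eq_iff)

lemma diag_Suc: "diag (Suc n) = diag n + diag 1"
  by (simp add: Finite_Cartesian_Product.vec_eq_iff)

lemma of_degree_Mor: "\<mu> \<in> of_degree \<Lambda> n \<Longrightarrow> \<mu> \<in> Mor \<Lambda>"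
  by (simp add: of_degree_def)

lemma chi_image_L2: "chi \<Lambda> ` of_degree \<Lambda> n \<subseteq> L2 M"
  using chi_L2 of_degree_Mor by blast

lemma V_subspace: "L2_subspace M (V n)"
  unfolding V_space_def using chi_image_L2 by (rule L2_subspace_span)

text \<open>Cylinder functions of one degree are orthogonal by disjointness and have nonzero norm by
  positivity of the measure.\<close>

lemma V_complemented: "L2_complemented M (V n)"
  unfolding V_space_def
proof (rule L2_complemented_span_orthogonal)
  show "finite (chi \<Lambda> ` of_degree \<Lambda> (diag n))" using finite_of_degree by simp
  show "chi \<Lambda> ` of_degree \<Lambda> (diag n) \<subseteq> L2 M" by (rule chi_image_L2)
next
  fix g :: "('a, 'k) path \<Rightarrow> complex" assume "g \<in> chi \<Lambda> ` of_degree \<Lambda> (diag n)"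
  then obtain \<mu> where \<mu>: "\<mu> \<in> Mor \<Lambda>" "g = chi \<Lambda> \<mu>" using of_degree_Mor by blast
  have "L2_inner M g g \<noteq> 0"
    using measure_cylinder_pos[OF \<mu>(1)] by (simp add: \<mu> chi_inner)
  then show "L2_norm M g \<noteq> 0" by (simp add: L2_inner_self)
next
  fix g h :: "('a, 'k) path \<Rightarrow> complex"
  assume "g \<in> chi \<Lambda> ` of_degree \<Lambda> (diag n)" "h \<in> chi \<Lambda> ` of_degree \<Lambda> (diag n)" "g \<noteq> h"
  then obtain \<mu> \<nu> where *: "\<mu> \<in> of_degree \<Lambda> (diag n)" "\<nu> \<in> of_degree \<Lambda> (diag n)" "\<mu> \<noteq> \<nu>"
    "g = chi \<Lambda> \<mu>" "h = chi \<Lambda> \<nu>" by blast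
  have "cylinder \<Lambda> \<mu> \<inter> cylinder \<Lambda> \<nu> = {}"
    using * by (intro cylinder_disjoint) (auto simp: of_degree_def)
  then show "L2_inner M g h = 0"
    using * by (simp add: chi_inner of_degree_Mor)
qed

lemma chi_in_V:
  assumes \<mu>: "\<mu> \<in> Mor \<Lambda>" and le: "dgr \<Lambda> \<mu> \<le> diag n"
  shows "chi \<Lambda> \<mu> \<in> V n"
proof -
  \<comment> \<open>Subtraction is truncated in each coordinate; by \<open>le\<close> it is the true
    complement, so every extension by this degree has degree (n,...,n).\<close>
  let ?e = "diag n - dgr \<Lambda> \<mu>"
  have add: "dgr \<Lambda> \<mu> + ?e = diag n"
    using le by (simp add: Finite_Cartesian_Product.vec_eq_iff Finite_Cartesian_Product.less_eq_vec_def)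
  have "chi \<Lambda> (cmp \<Lambda> \<mu> \<eta>) \<in> V n" if \<eta>: "\<eta> \<in> extensions \<mu> ?e" for \<eta>
  proof -
    note e = extensionsD[OF \<eta>]
    have "cmp \<Lambda> \<mu> \<eta> \<in> of_degree \<Lambda> (diag n)"
      using cmp_Mor[OF \<mu> e(1,3)] dgr_cmp[OF \<mu> e(1,3)] e(2) add by (simp add: of_degree_def)
    then show ?thesis
      unfolding V_space_def using chi_L2 of_degree_Mor by (blast intro: L2_span_base)
  qed
  then have "(\<lambda>p. \<Sum>\<eta>\<in>extensions \<mu> ?e. chi \<Lambda> (cmp \<Lambda> \<mu> \<eta>) p) \<in> V n"
    by (rule L2_subspace_sum[OF V_subspace])
  moreover have "chi \<Lambda> \<mu> = (\<lambda>p. \<Sum>\<eta>\<in>extensions \<mu> ?e. chi \<Lambda> (cmp \<Lambda> \<mu> \<eta>) p)"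
    by (rule ext) (rule chi_eq_sum[OF \<mu>])
  ultimately show ?thesis by simp
qed

lemma V_step: "V n \<subseteq> V (Suc n)"
proof -
  have "chi \<Lambda> ` of_degree \<Lambda> (diag n) \<subseteq> V (Suc n)"
    using diag_mono[of n "Suc n"] by (auto intro!: chi_in_V simp: of_degree_def)
  with V_subspace show ?thesis unfolding V_space_def[of \<Lambda> M n] by (rule L2_span_minimal)
qed

text \<open>A bound q on the largest entry of the degree is the componentwise bound by (q,...,q),
  which is the condition of \<open>chi_in_V\<close>.\<close>

lemma R_eq_V: "R_space \<Lambda> M (int q) = V q"
proof -
  have R: "R_space \<Lambda> M (int q) = L2_span M {chi \<Lambda> \<eta> |\<eta>. \<eta> \<in> Mor \<Lambda> \<and> dgr \<Lambda> \<eta> \<le> diag q}"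
    by (simp add: R_space_def Finite_Cartesian_Product.less_eq_vec_def)
  show ?thesis
    unfolding R
  proof
    show "L2_span M {chi \<Lambda> \<eta> |\<eta>. \<eta> \<in> Mor \<Lambda> \<and> dgr \<Lambda> \<eta> \<le> diag q} \<subseteq> V q"
      using V_subspace by (rule L2_span_minimal) (auto intro: chi_in_V)
    have "L2_subspace M (L2_span M {chi \<Lambda> \<eta> |\<eta>. \<eta> \<in> Mor \<Lambda> \<and> dgr \<Lambda> \<eta> \<le> diag q})"
      using chi_L2 by (intro L2_subspace_span) blast
    moreover have "chi \<Lambda> ` of_degree \<Lambda> (diag q) \<subseteq> L2_span M {chi \<Lambda> \<eta> |\<eta>. \<eta> \<in> Mor \<Lambda> \<and> dgr \<Lambda> \<eta> \<le> diag q}"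
      using chi_L2 by (auto intro!: L2_span_base simp: of_degree_def)
    ultimately show "V q \<subseteq> L2_span M {chi \<Lambda> \<eta> |\<eta>. \<eta> \<in> Mor \<Lambda> \<and> dgr \<Lambda> \<eta> \<le> diag q}"
      unfolding V_space_def by (rule L2_span_minimal)
  qed
qed

lemma one_L2: "(\<lambda>_. 1) \<in> L2 M"
proof -
  interpret finite_measure M by (rule finite_measure_M)
  show ?thesis by (simp add: L2_def)
qed

lemma one_in_V: "(\<lambda>_. 1) \<in> V 0"
proof -
  have "(\<lambda>p. \<Sum>v\<in>of_degree \<Lambda> (diag 0). chi \<Lambda> v p) \<in> V 0"
    by (rule L2_subspace_sum[OF V_subspace]) (auto intro: chi_in_V simp: of_degree_def)
  \<comment> \<open>The vertex cylinders partition the path space. Off this space the sum is 0 and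
    the constant is 1, so the equality is only almost everywhere.\<close>
  moreover have "AE p in M. 1 = (\<Sum>v\<in>of_degree \<Lambda> (diag 0). chi \<Lambda> v p)"
  proof (rule AE_I2)
    fix p assume "p \<in> space M"
    then have p: "p \<in> infinite_paths \<Lambda>" by (simp add: space_M)
    have "(\<Sum>v\<in>of_degree \<Lambda> (diag 0). chi \<Lambda> v p)
        = (\<Sum>v\<in>of_degree \<Lambda> (diag 0). if v = p (0, diag 0) then 1 else 0)"
      by (rule sum.cong) (use p in \<open>auto simp: indicator_def cylinder_def of_degree_def\<close>)
    also have "\<dots> = 1" using path_in_cylinder(1)[OF p] finite_of_degree by simp
    finally show "1 = (\<Sum>v\<in>of_degree \<Lambda> (diag 0). chi \<Lambda> v p)" by simp
  qed
  ultimately show ?thesis by (rule L2_subspace_AE[OF V_subspace _ one_L2])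
qed

lemma R_minus_1: "R_space \<Lambda> M (- 1) = L2_span M {\<lambda>_. 1}"
  by (simp add: R_space_def)

lemma R_minus_1_complemented: "L2_complemented M (R_space \<Lambda> M (- 1))"
  unfolding R_minus_1
proof (rule L2_complemented_span_orthogonal)
  show "{\<lambda>_. 1} \<subseteq> L2 M" using one_L2 by simp
  show "L2_norm M g \<noteq> 0" if "g \<in> {\<lambda>_. 1}" for g
    using that prob_space.prob_space[OF prob_space_M] by (simp add: L2_norm_def)
qed auto

lemma R_minus_1_sub_V: "R_space \<Lambda> M (- 1) \<subseteq> V 0"
  unfolding R_minus_1 using V_subspace by (rule L2_span_minimal) (simp add: one_in_V)

lemma V_dense: "L2_closure M (\<Union>n. V n) = L2 M"
proof (rule L2_closure_generator[OF finite_measure_M])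
  show S: "L2_subspace M (\<Union>n. V n)" using V_subspace V_step by (rule L2_subspace_UN_chain)
  show "Int_stable diagonal_cylinders" by (rule Int_stable_diagonal_cylinders)
  show "diagonal_cylinders \<subseteq> Pow (space M)" "sets M = sigma_sets (space M) diagonal_cylinders"
    using diagonal_cylinders_paths sets_M by (simp_all add: space_M)
  show "(\<lambda>_. 1) \<in> (\<Union>n. V n)" using one_in_V by blast
  fix A assume "A \<in> diagonal_cylinders"
  then consider "A = {}" | n \<mu> where "\<mu> \<in> of_degree \<Lambda> (diag n)" "A = cylinder \<Lambda> \<mu>"
    by (auto simp: diagonal_cylinders_def)
  then show "indicator A \<in> (\<Union>n. V n)"
  proof cases
    case 1
    then have "indicator A = (\<lambda>_. 0 :: complex)" by auto
    then show ?thesis using L2_subspace_zero[OF S] by (simp only:)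
  next
    case (2 n \<mu>)
    then show ?thesis using chi_in_V[of \<mu> n] by (auto simp: of_degree_def)
  qed
qed

lemma V_filtration: "L2_filtration M V"
  by (intro L2_filtration.intro V_complemented V_step V_dense)

text \<open>Shifted by one so that natural indices can start at R_(-1); the q-th increment is then
  the difference of the projections for q and q - 1.\<close>

abbreviation R_chain :: "nat \<Rightarrow> (('a, 'k) path \<Rightarrow> complex) set" where
  "R_chain n \<equiv> R_space \<Lambda> M (int n - 1)"

lemma R_chain_Suc: "R_chain (Suc n) = V n"
  using R_eq_V[of n] by simp

lemma R_filtration: "L2_filtration M R_chain"
proof
  show "L2_complemented M (R_chain n)" for n
    using R_minus_1_complemented V_complemented by (cases n) (simp_all add: R_eq_V)
  show "R_chain n \<subseteq> R_chain (Suc n)" for n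
  proof (cases n)
    case 0
    then show ?thesis using R_minus_1_sub_V R_chain_Suc[of 0] by simp
  next
    case (Suc m)
    then show ?thesis by (simp only: R_chain_Suc V_step)
  qed
  have "V n \<subseteq> (\<Union>n. R_chain n)" for n unfolding R_chain_Suc[symmetric] by blast
  then have "L2_closure M (\<Union>n. V n) \<subseteq> L2_closure M (\<Union>n. R_chain n)"
    by (intro L2_closure_mono UN_least)
  moreover have "L2_closure M (\<Union>n. R_chain n) \<subseteq> L2 M" by (auto simp: L2_closure_def)
  ultimately show "L2_closure M (\<Union>n. R_chain n) = L2 M" using V_dense by blast
qed

section \<open>Finite expansions in cylinder functions and the action of S\<close>

lemma V_expansion:
  assumes "f \<in> V n"
  shows "\<exists>c. AE p in M. f p = (\<Sum>\<eta>\<in>of_degree \<Lambda> (diag n). c \<eta> * chi \<Lambda> \<eta> p)"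
proof (rule L2_span_image)
  show "finite (of_degree \<Lambda> (diag n))" by (rule finite_of_degree)
  show "chi \<Lambda> \<eta> \<in> L2 M" if "\<eta> \<in> of_degree \<Lambda> (diag n)" for \<eta>
    using that by (intro chi_L2 of_degree_Mor)
  show "f \<in> L2_span M (chi \<Lambda> ` of_degree \<Lambda> (diag n))" using assms by (simp add: V_space_def)
qed

lemma sum_chi_L2: "I \<subseteq> Mor \<Lambda> \<Longrightarrow> (\<lambda>p. \<Sum>\<eta>\<in>I. c \<eta> * chi \<Lambda> \<eta> p) \<in> L2 M"
  by (intro L2_sum L2_scale chi_L2) blast

lemma sum_chi_inner:
  assumes I: "I \<subseteq> Mor \<Lambda>" and \<mu>: "\<mu> \<in> Mor \<Lambda>"
  shows "L2_inner M (\<lambda>p. \<Sum>\<eta>\<in>I. c \<eta> * chi \<Lambda> \<eta> p) (chi \<Lambda> \<mu>)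
    = (\<Sum>\<eta>\<in>I. c \<eta> * of_real (measure M (cylinder \<Lambda> \<eta> \<inter> cylinder \<Lambda> \<mu>)))"
proof -
  have "L2_inner M (\<lambda>p. \<Sum>\<eta>\<in>I. c \<eta> * chi \<Lambda> \<eta> p) (chi \<Lambda> \<mu>)
      = (\<Sum>\<eta>\<in>I. L2_inner M (\<lambda>p. c \<eta> * chi \<Lambda> \<eta> p) (chi \<Lambda> \<mu>))"
    using I by (intro L2_inner_sum_left L2_scale chi_L2 \<mu>) blast
  also have "\<dots> = (\<Sum>\<eta>\<in>I. c \<eta> * of_real (measure M (cylinder \<Lambda> \<eta> \<inter> cylinder \<Lambda> \<mu>)))"
    using I \<mu> by (intro sum.cong refl) (auto simp: L2_inner_scale_left chi_inner)
  finally show ?thesis .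
qed

lemma measure_cmp_Int:
  assumes "\<mu> \<in> of_degree \<Lambda> m" "\<nu> \<in> of_degree \<Lambda> m" "\<eta> \<in> extensions \<nu> n"
  shows "measure M (cylinder \<Lambda> (cmp \<Lambda> \<nu> \<eta>) \<inter> cylinder \<Lambda> \<mu>)
    = (if \<nu> = \<mu> then measure M (cylinder \<Lambda> (cmp \<Lambda> \<mu> \<eta>)) else 0)"
proof -
  have sub: "cylinder \<Lambda> (cmp \<Lambda> \<nu> \<eta>) \<subseteq> cylinder \<Lambda> \<nu>"
    by (rule cylinder_cmp_subset[OF of_degree_Mor[OF assms(2)] extensionsD(1,3)[OF assms(3)]])
  show ?thesis
  proof (cases "\<nu> = \<mu>")
    case True
    then show ?thesis using sub by (simp add: Int_absorb2)
  next
    case False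
    have "cylinder \<Lambda> \<nu> \<inter> cylinder \<Lambda> \<mu> = {}"
      by (rule cylinder_disjoint) (use assms False in \<open>auto simp: of_degree_def\<close>)
    then have "cylinder \<Lambda> (cmp \<Lambda> \<nu> \<eta>) \<inter> cylinder \<Lambda> \<mu> = {}" using sub by blast
    then show ?thesis using False by simp
  qed
qed

text \<open>After grouping by initial segments of degree \<open>m\<close>, only the group of
  \<open>\<mu>\<close> meets the cylinder of \<open>\<mu>\<close>.\<close>

lemma expansion_inner:
  assumes \<mu>: "\<mu> \<in> of_degree \<Lambda> m"
  shows "L2_inner M (\<lambda>p. \<Sum>\<kappa>\<in>of_degree \<Lambda> (m + n). c \<kappa> * chi \<Lambda> \<kappa> p) (chi \<Lambda> \<mu>)
    = (\<Sum>\<eta>\<in>extensions \<mu> n. c (cmp \<Lambda> \<mu> \<eta>) * of_real (measure M (cylinder \<Lambda> (cmp \<Lambda> \<mu> \<eta>))))"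
proof -
  let ?g = "\<lambda>\<nu> \<eta>. c (cmp \<Lambda> \<nu> \<eta>) * of_real (measure M (cylinder \<Lambda> (cmp \<Lambda> \<nu> \<eta>)))"
  have "L2_inner M (\<lambda>p. \<Sum>\<kappa>\<in>of_degree \<Lambda> (m + n). c \<kappa> * chi \<Lambda> \<kappa> p) (chi \<Lambda> \<mu>)
      = (\<Sum>\<kappa>\<in>of_degree \<Lambda> (m + n). c \<kappa> * of_real (measure M (cylinder \<Lambda> \<kappa> \<inter> cylinder \<Lambda> \<mu>)))"
    using of_degree_Mor \<mu> by (intro sum_chi_inner) blast+
  also have "\<dots> = (\<Sum>\<nu>\<in>of_degree \<Lambda> m. \<Sum>\<eta>\<in>extensions \<nu> n.
      c (cmp \<Lambda> \<nu> \<eta>) * of_real (measure M (cylinder \<Lambda> (cmp \<Lambda> \<nu> \<eta>) \<inter> cylinder \<Lambda> \<mu>)))"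
    by (rule sum_of_degree_add)
  also have "\<dots> = (\<Sum>\<nu>\<in>of_degree \<Lambda> m. if \<nu> = \<mu> then \<Sum>\<eta>\<in>extensions \<mu> n. ?g \<mu> \<eta> else 0)"
  proof (rule sum.cong[OF refl])
    fix \<nu> assume \<nu>: "\<nu> \<in> of_degree \<Lambda> m"
    have "(\<Sum>\<eta>\<in>extensions \<nu> n. c (cmp \<Lambda> \<nu> \<eta>) * of_real (measure M (cylinder \<Lambda> (cmp \<Lambda> \<nu> \<eta>) \<inter> cylinder \<Lambda> \<mu>)))
        = (\<Sum>\<eta>\<in>extensions \<nu> n. if \<nu> = \<mu> then ?g \<mu> \<eta> else 0)"
      by (rule sum.cong[OF refl]) (simp add: measure_cmp_Int[OF \<mu> \<nu>])
    then show "(\<Sum>\<eta>\<in>extensions \<nu> n. c (cmp \<Lambda> \<nu> \<eta>) * of_real (measure M (cylinder \<Lambda> (cmp \<Lambda> \<nu> \<eta>) \<inter> cylinder \<Lambda> \<mu>)))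
        = (if \<nu> = \<mu> then \<Sum>\<eta>\<in>extensions \<mu> n. ?g \<mu> \<eta> else 0)" by simp
  qed
  also have "\<dots> = (\<Sum>\<eta>\<in>extensions \<mu> n. ?g \<mu> \<eta>)" using \<mu> finite_of_degree by simp
  finally show ?thesis .
qed

text \<open>The degree 0 counterpart of \<open>expansion_inner\<close>, phrased by ranges so that no
  composition with a vertex appears.\<close>

lemma expansion_inner_vertex:
  assumes v: "v \<in> vertices \<Lambda>"
  shows "L2_inner M (\<lambda>p. \<Sum>\<eta>\<in>of_degree \<Lambda> n. c \<eta> * chi \<Lambda> \<eta> p) (chi \<Lambda> v)
    = (\<Sum>\<eta>\<in>{\<eta> \<in> of_degree \<Lambda> n. rng \<Lambda> \<eta> = v}. c \<eta> * of_real (measure M (cylinder \<Lambda> \<eta>)))"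
proof -
  have "L2_inner M (\<lambda>p. \<Sum>\<eta>\<in>of_degree \<Lambda> n. c \<eta> * chi \<Lambda> \<eta> p) (chi \<Lambda> v)
      = (\<Sum>\<eta>\<in>of_degree \<Lambda> n. c \<eta> * of_real (measure M (cylinder \<Lambda> \<eta> \<inter> cylinder \<Lambda> v)))"
    using of_degree_Mor v by (intro sum_chi_inner) blast+
  also have "\<dots> = (\<Sum>\<eta>\<in>of_degree \<Lambda> n. if rng \<Lambda> \<eta> = v then c \<eta> * of_real (measure M (cylinder \<Lambda> \<eta>)) else 0)"
    by (rule sum.cong[OF refl])
      (simp add: vertex_cylinder[OF v of_degree_Mor] Int_commute[of _ "cylinder \<Lambda> v"])
  also have "\<dots> = (\<Sum>\<eta>\<in>{\<eta> \<in> of_degree \<Lambda> n. rng \<Lambda> \<eta> = v}. c \<eta> * of_real (measure M (cylinder \<Lambda> \<eta>)))"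
    by (rule sum.inter_filter[symmetric]) (rule finite_of_degree)
  finally show ?thesis .
qed

text \<open>\<open>S_op\<close> is known on cylinder functions only. So f is replaced by its finite
  expansion, linearity is applied, and the terms that do not compose with \<open>\<mu>\<close>
  vanish.\<close>

lemma S_op_expansion:
  assumes \<mu>: "\<mu> \<in> Mor \<Lambda>" and f: "f \<in> L2 M"
    and exp: "AE p in M. f p = (\<Sum>\<eta>\<in>of_degree \<Lambda> n. c \<eta> * chi \<Lambda> \<eta> p)"
  shows "AE p in M. S_op \<Lambda> M \<mu> f p = of_real (sqrt (rho_pow \<Lambda> (dgr \<Lambda> \<mu>)))
    * (\<Sum>\<eta>\<in>extensions \<mu> n. c \<eta> * chi \<Lambda> (cmp \<Lambda> \<mu> \<eta>) p)"
proof -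
  let ?T = "S_op \<Lambda> M \<mu>" and ?s = "complex_of_real (sqrt (rho_pow \<Lambda> (dgr \<Lambda> \<mu>)))"
  let ?h = "\<lambda>p. \<Sum>\<eta>\<in>of_degree \<Lambda> n. c \<eta> * chi \<Lambda> \<eta> p"
  have h: "?h \<in> L2 M" using of_degree_Mor by (intro sum_chi_L2) blast
  have "AE p in M. ?T f p = ?T ?h p"
    by (rule bounded_operator_cong_AE[OF S_op_bounded[OF \<mu>] f h exp])
  moreover have "AE p in M. ?T ?h p = (\<Sum>\<eta>\<in>of_degree \<Lambda> n. c \<eta> * ?T (chi \<Lambda> \<eta>) p)"
    by (rule bounded_operator_sum[OF S_op_bounded[OF \<mu>] finite_of_degree chi_L2[OF of_degree_Mor]])
  moreover have "AE p in M. \<forall>\<eta>\<in>of_degree \<Lambda> n. ?T (chi \<Lambda> \<eta>) p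
      = (if src \<Lambda> \<mu> = rng \<Lambda> \<eta> then ?s * chi \<Lambda> (cmp \<Lambda> \<mu> \<eta>) p else 0)"
    by (rule AE_finite_allI[OF finite_of_degree S_op_chi[OF \<mu> of_degree_Mor]])
  ultimately show ?thesis
  proof eventually_elim
    fix p assume 1: "?T f p = ?T ?h p" and 2: "?T ?h p = (\<Sum>\<eta>\<in>of_degree \<Lambda> n. c \<eta> * ?T (chi \<Lambda> \<eta>) p)"
      and 3: "\<forall>\<eta>\<in>of_degree \<Lambda> n. ?T (chi \<Lambda> \<eta>) p
      = (if src \<Lambda> \<mu> = rng \<Lambda> \<eta> then ?s * chi \<Lambda> (cmp \<Lambda> \<mu> \<eta>) p else 0)"
    have "?T f p = (\<Sum>\<eta>\<in>of_degree \<Lambda> n. if rng \<Lambda> \<eta> = src \<Lambda> \<mu> then ?s * (c \<eta> * chi \<Lambda> (cmp \<Lambda> \<mu> \<eta>) p) else 0)"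
      unfolding 1 2 by (rule sum.cong[OF refl]) (use 3 in auto)
    also have "\<dots> = (\<Sum>\<eta>\<in>extensions \<mu> n. ?s * (c \<eta> * chi \<Lambda> (cmp \<Lambda> \<mu> \<eta>) p))"
      unfolding extensions_def by (rule sum.inter_filter[symmetric]) (rule finite_of_degree)
    finally show "?T f p = ?s * (\<Sum>\<eta>\<in>extensions \<mu> n. c \<eta> * chi \<Lambda> (cmp \<Lambda> \<mu> \<eta>) p)"
      by (simp only: sum_distrib_left)
  qed
qed

lemma src_vertex: "\<mu> \<in> Mor \<Lambda> \<Longrightarrow> src \<Lambda> \<mu> \<in> vertices \<Lambda>"
  using src_Mor dgr_src by (simp add: of_degree_def)

lemma perp_V_iff: "f \<in> L2_perp M (V n) \<longleftrightarrow>
    f \<in> L2 M \<and> (\<forall>\<mu>\<in>of_degree \<Lambda> (diag n). L2_inner M f (chi \<Lambda> \<mu>) = 0)"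
proof
  assume "f \<in> L2_perp M (V n)"
  moreover have "chi \<Lambda> \<mu> \<in> V n" if "\<mu> \<in> of_degree \<Lambda> (diag n)" for \<mu>
    using that by (intro chi_in_V) (simp_all add: of_degree_def)
  ultimately show "f \<in> L2 M \<and> (\<forall>\<mu>\<in>of_degree \<Lambda> (diag n). L2_inner M f (chi \<Lambda> \<mu>) = 0)"
    by (auto simp: L2_perp_def)
next
  assume "f \<in> L2 M \<and> (\<forall>\<mu>\<in>of_degree \<Lambda> (diag n). L2_inner M f (chi \<Lambda> \<mu>) = 0)"
  then show "f \<in> L2_perp M (V n)"
    unfolding V_space_def using chi_image_L2 by (intro L2_perp_span) auto
qed

text \<open>Against the cylinder function of another path of the same degree the pairing vanishes by
  disjointness. Against that of \<open>\<mu>\<close> itself it is a multiple of the pairing of f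
  with the cylinder function of s(mu), which is 0.\<close>

lemma S_op_layer:
  assumes \<mu>: "\<mu> \<in> of_degree \<Lambda> (diag n)" and f: "f \<in> V 1 \<inter> L2_perp M (V 0)"
  shows "S_op \<Lambda> M \<mu> f \<in> V (Suc n) \<inter> L2_perp M (V n)"
proof
  let ?s = "complex_of_real (sqrt (rho_pow \<Lambda> (dgr \<Lambda> \<mu>)))"
  have m: "\<mu> \<in> Mor \<Lambda>" using \<mu> by (rule of_degree_Mor)
  have fL2: "f \<in> L2 M" using f by (simp add: L2_perp_def)
  obtain c where c: "AE p in M. f p = (\<Sum>\<eta>\<in>of_degree \<Lambda> (diag 1). c \<eta> * chi \<Lambda> \<eta> p)"
    using V_expansion f by blast
  define g where "g p = (\<Sum>\<eta>\<in>extensions \<mu> (diag 1). c \<eta> * chi \<Lambda> (cmp \<Lambda> \<mu> \<eta>) p)" for p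
  have Sf: "S_op \<Lambda> M \<mu> f \<in> L2 M" by (rule bounded_operator_L2[OF S_op_bounded[OF m] fL2])
  have Sg: "AE p in M. S_op \<Lambda> M \<mu> f p = ?s * g p"
    unfolding g_def by (rule S_op_expansion[OF m fL2 c])
  have ext: "cmp \<Lambda> \<mu> \<eta> \<in> of_degree \<Lambda> (diag (Suc n))" if "\<eta> \<in> extensions \<mu> (diag 1)" for \<eta>
    using cmp_Mor[OF m extensionsD(1,3)[OF that]] dgr_cmp[OF m extensionsD(1,3)[OF that]]
      extensionsD(2)[OF that] \<mu> unfolding diag_Suc by (simp add: of_degree_def)
  have gV: "g \<in> V (Suc n)"
    unfolding g_def using ext
    by (intro L2_subspace_sum[OF V_subspace] L2_subspace_scale[OF V_subspace] chi_in_V) (auto simp: of_degree_def)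
  then have gL2: "g \<in> L2 M" by (rule L2_subspace_L2[OF V_subspace])
  show "S_op \<Lambda> M \<mu> f \<in> V (Suc n)"
    by (rule L2_subspace_AE[OF V_subspace L2_subspace_scale[OF V_subspace gV] Sf Sg])
  show "S_op \<Lambda> M \<mu> f \<in> L2_perp M (V n)"
    unfolding perp_V_iff
  proof (intro conjI ballI Sf)
    fix \<nu> assume \<nu>: "\<nu> \<in> of_degree \<Lambda> (diag n)"
    have "L2_inner M (S_op \<Lambda> M \<mu> f) (chi \<Lambda> \<nu>) = ?s * L2_inner M g (chi \<Lambda> \<nu>)"
      unfolding L2_inner_scale_left[symmetric]
      by (rule L2_inner_cong_AE[OF Sf L2_scale[OF gL2] chi_L2 chi_L2 Sg]) (use \<nu> of_degree_Mor in auto)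
    also have "L2_inner M g (chi \<Lambda> \<nu>)
        = (\<Sum>\<eta>\<in>extensions \<mu> (diag 1). c \<eta> * of_real (measure M (cylinder \<Lambda> (cmp \<Lambda> \<mu> \<eta>) \<inter> cylinder \<Lambda> \<nu>)))"
    proof -
      have "L2_inner M g (chi \<Lambda> \<nu>)
          = (\<Sum>\<eta>\<in>extensions \<mu> (diag 1). L2_inner M (\<lambda>p. c \<eta> * chi \<Lambda> (cmp \<Lambda> \<mu> \<eta>) p) (chi \<Lambda> \<nu>))"
        unfolding g_def
        by (rule L2_inner_sum_left) (use ext \<nu> in \<open>auto intro!: L2_scale chi_L2 of_degree_Mor\<close>)
      also have "\<dots> = (\<Sum>\<eta>\<in>extensions \<mu> (diag 1).
          c \<eta> * of_real (measure M (cylinder \<Lambda> (cmp \<Lambda> \<mu> \<eta>) \<inter> cylinder \<Lambda> \<nu>)))"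
        by (rule sum.cong[OF refl])
          (simp only: L2_inner_scale_left chi_inner[OF of_degree_Mor[OF ext] of_degree_Mor[OF \<nu>]])
      finally show ?thesis .
    qed
    also have "\<dots> = 0"
    proof (cases "\<nu> = \<mu>")
      case True
      \<comment> \<open>Testing at the single vertex s(mu) sums the coefficients over exactly the
        extensions of \<open>\<mu>\<close>.\<close>
      have "0 = L2_inner M f (chi \<Lambda> (src \<Lambda> \<mu>))"
        using f src_vertex[OF m] by (simp add: perp_V_iff diag_0)
      also have "\<dots> = L2_inner M (\<lambda>p. \<Sum>\<eta>\<in>of_degree \<Lambda> (diag 1). c \<eta> * chi \<Lambda> \<eta> p) (chi \<Lambda> (src \<Lambda> \<mu>))"
        by (rule L2_inner_cong_AE[OF fL2 sum_chi_L2 _ _ c])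
          (use m in \<open>auto intro: chi_L2 src_Mor of_degree_Mor\<close>)
      also have "\<dots> = (\<Sum>\<eta>\<in>extensions \<mu> (diag 1). c \<eta> * of_real (measure M (cylinder \<Lambda> \<eta>)))"
        unfolding extensions_def by (rule expansion_inner_vertex[OF src_vertex[OF m]])
      finally have z: "(\<Sum>\<eta>\<in>extensions \<mu> (diag 1). c \<eta> * of_real (measure M (cylinder \<Lambda> \<eta>))) = 0" by simp
      have "(\<Sum>\<eta>\<in>extensions \<mu> (diag 1). c \<eta> * of_real (measure M (cylinder \<Lambda> (cmp \<Lambda> \<mu> \<eta>) \<inter> cylinder \<Lambda> \<nu>)))
          = (\<Sum>\<eta>\<in>extensions \<mu> (diag 1). of_real (inverse (rho_pow \<Lambda> (dgr \<Lambda> \<mu>)))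
              * (c \<eta> * of_real (measure M (cylinder \<Lambda> \<eta>))))"
      proof (rule sum.cong[OF refl])
        fix \<eta> assume \<eta>: "\<eta> \<in> extensions \<mu> (diag 1)"
        have "measure M (cylinder \<Lambda> (cmp \<Lambda> \<mu> \<eta>) \<inter> cylinder \<Lambda> \<nu>)
            = inverse (rho_pow \<Lambda> (dgr \<Lambda> \<mu>)) * measure M (cylinder \<Lambda> \<eta>)"
          using True measure_cmp_Int[OF \<nu> \<mu> \<eta>] measure_cylinder_cmp[OF m extensionsD(1,3)[OF \<eta>]]
          by simp
        then show "c \<eta> * of_real (measure M (cylinder \<Lambda> (cmp \<Lambda> \<mu> \<eta>) \<inter> cylinder \<Lambda> \<nu>))
            = of_real (inverse (rho_pow \<Lambda> (dgr \<Lambda> \<mu>))) * (c \<eta> * of_real (measure M (cylinder \<Lambda> \<eta>)))"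
          by simp
      qed
      also have "\<dots> = 0" unfolding sum_distrib_left[symmetric] z by simp
      finally show ?thesis .
    next
      case False
      then show ?thesis by (intro sum.neutral ballI) (simp add: measure_cmp_Int[OF \<nu> \<mu>])
    qed
    finally show "L2_inner M (S_op \<Lambda> M \<mu> f) (chi \<Lambda> \<nu>) = 0" by simp
  qed
qed

text \<open>Grouping the expansion of \<open>g\<close> by initial segments \<open>\<mu>\<close> of degree \<open>(n,\<dots>,n)\<close>, each group is \<open>S\<^sub>\<mu>\<close>
  of an element of \<open>\<W>\<^sub>0\<close>, because \<open>g\<close> is orthogonal to the cylinder function of \<open>\<mu>\<close>.\<close>

lemma layer_sub_span_S_op:
  assumes g: "g \<in> V (Suc n) \<inter> L2_perp M (V n)"
  shows "g \<in> L2_span M {S_op \<Lambda> M \<mu> f |\<mu> f. \<mu> \<in> of_degree \<Lambda> (diag n) \<and> f \<in> V 1 \<inter> L2_perp M (V 0)}"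
    (is "g \<in> L2_span M ?B")
proof -
  have gL2: "g \<in> L2 M" using g by (simp add: L2_perp_def)
  obtain c where c: "AE p in M. g p = (\<Sum>\<kappa>\<in>of_degree \<Lambda> (diag n + diag 1). c \<kappa> * chi \<Lambda> \<kappa> p)"
    using V_expansion[of g "Suc n"] g unfolding diag_Suc by blast
  define s where "s = (\<lambda>\<mu>. complex_of_real (sqrt (rho_pow \<Lambda> (dgr \<Lambda> \<mu>))))"
  have s: "s \<mu> \<noteq> 0" for \<mu> using rho_pow_pos[of "dgr \<Lambda> \<mu>"] by (simp add: s_def)
  \<comment> \<open>Division by \<open>s \<mu>\<close> undoes the normalization of S_mu, so that
    S_mu (f mu) restores the group of \<open>\<mu>\<close>. The value 0 elsewhere makes
    \<open>f \<mu>\<close> live on the cylinder of s(mu).\<close>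
  define d where "d = (\<lambda>\<mu> \<eta>. if rng \<Lambda> \<eta> = src \<Lambda> \<mu> then c (cmp \<Lambda> \<mu> \<eta>) / s \<mu> else 0)"
  define f where "f = (\<lambda>\<mu> p. \<Sum>\<eta>\<in>of_degree \<Lambda> (diag 1). d \<mu> \<eta> * chi \<Lambda> \<eta> p)"
  have fV: "f \<mu> \<in> V 1" for \<mu>
    unfolding f_def
    by (intro L2_subspace_sum[OF V_subspace] L2_subspace_scale[OF V_subspace] chi_in_V) (auto simp: of_degree_def)
  have fL2: "f \<mu> \<in> L2 M" for \<mu> using L2_subspace_L2[OF V_subspace fV] .
  have fperp: "f \<mu> \<in> L2_perp M (V 0)" if \<mu>: "\<mu> \<in> of_degree \<Lambda> (diag n)" for \<mu>
    unfolding perp_V_iff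
  proof (intro conjI ballI fL2)
    fix v assume "v \<in> of_degree \<Lambda> (diag 0)"
    then have v: "v \<in> vertices \<Lambda>" by (simp add: diag_0)
    have m: "\<mu> \<in> Mor \<Lambda>" using \<mu> by (rule of_degree_Mor)
    have "L2_inner M (f \<mu>) (chi \<Lambda> v)
        = (\<Sum>\<eta>\<in>{\<eta> \<in> of_degree \<Lambda> (diag 1). rng \<Lambda> \<eta> = v}. d \<mu> \<eta> * of_real (measure M (cylinder \<Lambda> \<eta>)))"
      unfolding f_def by (rule expansion_inner_vertex[OF v])
    also have "\<dots> = 0"
    proof (cases "v = src \<Lambda> \<mu>")
      case True
      let ?r = "rho_pow \<Lambda> (dgr \<Lambda> \<mu>)"
      have "0 = L2_inner M g (chi \<Lambda> \<mu>)" using g \<mu> by (simp add: perp_V_iff)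
      also have "\<dots> = L2_inner M (\<lambda>p. \<Sum>\<kappa>\<in>of_degree \<Lambda> (diag n + diag 1). c \<kappa> * chi \<Lambda> \<kappa> p) (chi \<Lambda> \<mu>)"
        by (rule L2_inner_cong_AE[OF gL2 sum_chi_L2 _ _ c])
          (use m in \<open>auto intro: chi_L2 of_degree_Mor\<close>)
      also have "\<dots> = (\<Sum>\<eta>\<in>extensions \<mu> (diag 1). c (cmp \<Lambda> \<mu> \<eta>) * of_real (measure M (cylinder \<Lambda> (cmp \<Lambda> \<mu> \<eta>))))"
        by (rule expansion_inner[OF \<mu>])
      finally have z: "(\<Sum>\<eta>\<in>extensions \<mu> (diag 1). c (cmp \<Lambda> \<mu> \<eta>) * of_real (measure M (cylinder \<Lambda> (cmp \<Lambda> \<mu> \<eta>)))) = 0"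
        by simp
      \<comment> \<open>The constant collects \<open>1 / s \<mu>\<close> from \<open>d\<close> and
        \<open>?r\<close> from the ratio of the measures of the cylinders of \<open>\<eta>\<close>
        and \<open>cmp \<Lambda> \<mu> \<eta>\<close>.\<close>
      have "(\<Sum>\<eta>\<in>extensions \<mu> (diag 1). d \<mu> \<eta> * of_real (measure M (cylinder \<Lambda> \<eta>)))
          = (\<Sum>\<eta>\<in>extensions \<mu> (diag 1). (of_real ?r / s \<mu>)
              * (c (cmp \<Lambda> \<mu> \<eta>) * of_real (measure M (cylinder \<Lambda> (cmp \<Lambda> \<mu> \<eta>)))))"
      proof (rule sum.cong[OF refl])
        fix \<eta> assume \<eta>: "\<eta> \<in> extensions \<mu> (diag 1)"
        have "measure M (cylinder \<Lambda> \<eta>) = ?r * measure M (cylinder \<Lambda> (cmp \<Lambda> \<mu> \<eta>))"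
          using measure_cylinder_cmp[OF m extensionsD(1,3)[OF \<eta>]] rho_pow_pos[of "dgr \<Lambda> \<mu>"] by simp
        then show "d \<mu> \<eta> * of_real (measure M (cylinder \<Lambda> \<eta>)) = (of_real ?r / s \<mu>)
              * (c (cmp \<Lambda> \<mu> \<eta>) * of_real (measure M (cylinder \<Lambda> (cmp \<Lambda> \<mu> \<eta>))))"
          using extensionsD(3)[OF \<eta>] by (simp add: d_def)
      qed
      also have "\<dots> = 0" unfolding sum_distrib_left[symmetric] z by simp
      finally show ?thesis using True by (simp add: extensions_def)
    next
      case False
      then show ?thesis by (intro sum.neutral ballI) (simp add: d_def)
    qed
    finally show "L2_inner M (f \<mu>) (chi \<Lambda> v) = 0" .
  qed
  have B: "S_op \<Lambda> M \<mu> (f \<mu>) \<in> ?B" if "\<mu> \<in> of_degree \<Lambda> (diag n)" for \<mu>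
    using that fV fperp by blast
  have SL2: "S_op \<Lambda> M \<mu> h \<in> L2 M" if "\<mu> \<in> of_degree \<Lambda> (diag n)" "h \<in> L2 M" for \<mu> h
    using that by (intro bounded_operator_L2[OF S_op_bounded] of_degree_Mor)
  have "?B \<subseteq> L2 M" using SL2 by (auto simp: L2_perp_def)
  then have S: "L2_subspace M (L2_span M ?B)" by (rule L2_subspace_span)
  have "AE p in M. \<forall>\<mu>\<in>of_degree \<Lambda> (diag n). S_op \<Lambda> M \<mu> (f \<mu>) p
      = s \<mu> * (\<Sum>\<eta>\<in>extensions \<mu> (diag 1). d \<mu> \<eta> * chi \<Lambda> (cmp \<Lambda> \<mu> \<eta>) p)"
    unfolding s_def
    by (rule AE_finite_allI[OF finite_of_degree S_op_expansion[OF of_degree_Mor fL2]])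
      (simp_all add: f_def)
  with c have "AE p in M. g p = (\<Sum>\<mu>\<in>of_degree \<Lambda> (diag n). S_op \<Lambda> M \<mu> (f \<mu>) p)"
  proof eventually_elim
    fix p assume gp: "g p = (\<Sum>\<kappa>\<in>of_degree \<Lambda> (diag n + diag 1). c \<kappa> * chi \<Lambda> \<kappa> p)"
      and Sp: "\<forall>\<mu>\<in>of_degree \<Lambda> (diag n). S_op \<Lambda> M \<mu> (f \<mu>) p
        = s \<mu> * (\<Sum>\<eta>\<in>extensions \<mu> (diag 1). d \<mu> \<eta> * chi \<Lambda> (cmp \<Lambda> \<mu> \<eta>) p)"
    have "g p = (\<Sum>\<mu>\<in>of_degree \<Lambda> (diag n). \<Sum>\<eta>\<in>extensions \<mu> (diag 1). c (cmp \<Lambda> \<mu> \<eta>) * chi \<Lambda> (cmp \<Lambda> \<mu> \<eta>) p)"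
      unfolding gp by (rule sum_of_degree_add)
    also have "\<dots> = (\<Sum>\<mu>\<in>of_degree \<Lambda> (diag n). S_op \<Lambda> M \<mu> (f \<mu>) p)"
    proof (rule sum.cong[OF refl])
      fix \<mu> assume "\<mu> \<in> of_degree \<Lambda> (diag n)"
      then have "S_op \<Lambda> M \<mu> (f \<mu>) p = (\<Sum>\<eta>\<in>extensions \<mu> (diag 1). s \<mu> * (d \<mu> \<eta> * chi \<Lambda> (cmp \<Lambda> \<mu> \<eta>) p))"
        using Sp by (simp add: sum_distrib_left)
      also have "\<dots> = (\<Sum>\<eta>\<in>extensions \<mu> (diag 1). c (cmp \<Lambda> \<mu> \<eta>) * chi \<Lambda> (cmp \<Lambda> \<mu> \<eta>) p)"
        by (rule sum.cong[OF refl]) (use s in \<open>auto simp: d_def dest: extensionsD(3)\<close>)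
      finally show "(\<Sum>\<eta>\<in>extensions \<mu> (diag 1). c (cmp \<Lambda> \<mu> \<eta>) * chi \<Lambda> (cmp \<Lambda> \<mu> \<eta>) p) = S_op \<Lambda> M \<mu> (f \<mu>) p"
        by simp
    qed
    finally show "g p = (\<Sum>\<mu>\<in>of_degree \<Lambda> (diag n). S_op \<Lambda> M \<mu> (f \<mu>) p)" .
  qed
  moreover have "(\<lambda>p. \<Sum>\<mu>\<in>of_degree \<Lambda> (diag n). S_op \<Lambda> M \<mu> (f \<mu>) p) \<in> L2_span M ?B"
    by (rule L2_subspace_sum[OF S]) (rule L2_span_base[OF B SL2[OF _ fL2]])
  ultimately show ?thesis using L2_subspace_AE[OF S _ gL2] by blast
qed

lemma W_eq_layer: "W_space \<Lambda> M q = V (Suc q) \<inter> L2_perp M (V q)"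
proof (cases q)
  case 0
  then show ?thesis by simp
next
  case (Suc n)
  let ?B = "{S_op \<Lambda> M \<mu> f |\<mu> f. \<mu> \<in> of_degree \<Lambda> (diag q) \<and> f \<in> V 1 \<inter> L2_perp M (V 0)}"
  have W: "W_space \<Lambda> M q = L2_span M ?B" by (simp add: Suc)
  have "L2_subspace M (V (Suc q) \<inter> L2_perp M (V q))"
    by (intro L2_subspace_Int V_subspace L2_complemented_perp_subspace V_complemented)
  moreover have "?B \<subseteq> V (Suc q) \<inter> L2_perp M (V q)" using S_op_layer by blast
  ultimately have "L2_span M ?B \<subseteq> V (Suc q) \<inter> L2_perp M (V q)" by (rule L2_span_minimal)
  then show ?thesis unfolding W using layer_sub_span_S_op by blast
qed

end

section \<open>The wavelet decomposition and the eigenspaces of D\<close>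

theorem theorem5p5:
  fixes \<Lambda> :: "('a, 'k::finite) kgraph"
    and x :: "'a \<Rightarrow> real"
    and M :: "('a, 'k) path measure"
    and \<alpha> :: "nat \<Rightarrow> real"
    and C :: real
  assumes "k_graph \<Lambda>" and "finite_kgraph \<Lambda>" and "strongly_connected \<Lambda>" and "no_sources \<Lambda>"
    and "perron_frobenius_vector \<Lambda> x"
    and "path_measure \<Lambda> x M"
    and "\<And>q. \<alpha> q > 0" and "incseq \<alpha>" and "filterlim \<alpha> at_top sequentially"
    and "C \<ge> 0" and "\<And>q. \<bar>\<alpha> (q + 1) - \<alpha> q\<bar> \<le> C"
  shows "L2_hilbert_sum M (L2 M) (case_nat (V_space \<Lambda> M 0) (W_space \<Lambda> M))
    \<and> L2_direct_sum M (V_space \<Lambda> M 0)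
        (R_space \<Lambda> M 0 \<inter> L2_perp M (R_space \<Lambda> M (-1))) (R_space \<Lambda> M (-1))
    \<and> (\<forall>q::nat. W_space \<Lambda> M q =
         R_space \<Lambda> M (int q + 1) \<inter> L2_perp M (R_space \<Lambda> M (int q)))
    \<and> dirac_eigenspace \<Lambda> M \<alpha> 0 = R_space \<Lambda> M (-1)
    \<and> (\<forall>c. c \<noteq> 0 \<longrightarrow> dirac_eigenspace \<Lambda> M \<alpha> c =
         L2_span M (\<Union>q\<in>{q. complex_of_real (\<alpha> q) = c}.
           R_space \<Lambda> M (int q) \<inter> L2_perp M (R_space \<Lambda> M (int q - 1))))
    \<and> (strict_mono \<alpha> \<longrightarrow>
         dirac_eigenspace \<Lambda> M \<alpha> (complex_of_real (\<alpha> 0)) =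
           R_space \<Lambda> M 0 \<inter> L2_perp M (R_space \<Lambda> M (-1))
         \<and> (\<forall>q::nat. dirac_eigenspace \<Lambda> M \<alpha> (complex_of_real (\<alpha> (q + 1))) = W_space \<Lambda> M q))"
proof -
  interpret path_space \<Lambda> x M using assms(1,2,4-6) by unfold_locales
  interpret V: L2_filtration M V by (rule V_filtration)
  interpret R: L2_filtration M R_chain by (rule R_filtration)
  have R0: "R_space \<Lambda> M 0 = V 0" using R_eq_V[of 0] by simp
  have R_Suc: "R_space \<Lambda> M (int q + 1) = V (Suc q)" for q using R_eq_V[of "Suc q"] by (simp add: add.commute)
  have W_layer: "W_space \<Lambda> M = V.layer" by (rule ext) (simp add: W_eq_layer V.layer_def)
  have R_layer: "R.layer q = R_space \<Lambda> M (int q) \<inter> L2_perp M (R_space \<Lambda> M (int q - 1))" for q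
    by (simp add: R.layer_def)
  \<comment> \<open>The chain R begins one stage before the chain V, so W_q, the q-th layer of V, is
    layer q + 1 here.\<close>
  have R_layer_Suc: "R.layer (Suc q) = W_space \<Lambda> M q" for q
    unfolding R_layer W_eq_layer by (simp only: R_eq_V of_nat_Suc add_diff_cancel_left' R_Suc add.commute[of 1])
      (simp add: R_eq_V)
  have Xi_hat: "Xi_hat \<Lambda> M q f = R.increment q f" for q f
    by (simp add: Xi_hat_def Xi_def R.increment_def)
  have eigenspace: "dirac_eigenspace \<Lambda> M \<alpha> c = {f. R.eigenvector \<alpha> c f}" for c
    by (auto simp: dirac_eigenspace_def dirac_def R.eigenvector_def Xi_hat L2_scale)
  have nonzero: "dirac_eigenspace \<Lambda> M \<alpha> c = L2_span M (\<Union>q\<in>{q. complex_of_real (\<alpha> q) = c}. R.layer q)"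
    if "c \<noteq> 0" for c
    unfolding eigenspace by (rule R.eigenspace_nonzero[OF assms(9) that])
  have simple: "dirac_eigenspace \<Lambda> M \<alpha> (complex_of_real (\<alpha> n)) = R.layer n" if "strict_mono \<alpha>" for n
  proof -
    \<comment> \<open>Strict monotonicity leaves one layer in the union, and the span of a subspace
      is that subspace.\<close>
    have "{q. complex_of_real (\<alpha> q) = complex_of_real (\<alpha> n)} = {n}"
      using strict_mono_eq[OF that] by auto
    moreover have "complex_of_real (\<alpha> n) \<noteq> 0" using assms(7)[of n] by simp
    ultimately show ?thesis
      using nonzero[of "complex_of_real (\<alpha> n)"] L2_span_subspace[OF R.layer_subspace] by simp
  qed
  show ?thesis
  proof (intro conjI allI impI)
    show "L2_hilbert_sum M (L2 M) (case_nat (V 0) (W_space \<Lambda> M))"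
      unfolding W_layer by (rule V.hilbert_sum)
    show "L2_direct_sum M (V 0) (R_space \<Lambda> M 0 \<inter> L2_perp M (R_space \<Lambda> M (- 1))) (R_space \<Lambda> M (- 1))"
      unfolding R0 by (rule L2_direct_sum_complement[OF R_minus_1_complemented V_subspace R_minus_1_sub_V])
    show "W_space \<Lambda> M q = R_space \<Lambda> M (int q + 1) \<inter> L2_perp M (R_space \<Lambda> M (int q))" for q
      by (simp add: W_eq_layer R_eq_V R_Suc)
    show "dirac_eigenspace \<Lambda> M \<alpha> 0 = R_space \<Lambda> M (- 1)"
      unfolding eigenspace using R.eigenspace_0[of \<alpha>] assms(7) by (simp add: less_imp_neq[symmetric])
    show "dirac_eigenspace \<Lambda> M \<alpha> c = L2_span M (\<Union>q\<in>{q. complex_of_real (\<alpha> q) = c}.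
           R_space \<Lambda> M (int q) \<inter> L2_perp M (R_space \<Lambda> M (int q - 1)))" if "c \<noteq> 0" for c
      using nonzero[OF that] unfolding R_layer .
    show "dirac_eigenspace \<Lambda> M \<alpha> (complex_of_real (\<alpha> 0)) = R_space \<Lambda> M 0 \<inter> L2_perp M (R_space \<Lambda> M (- 1))"
      if "strict_mono \<alpha>"
      using simple[OF that, of 0] R_layer[of 0] by simp
    show "dirac_eigenspace \<Lambda> M \<alpha> (complex_of_real (\<alpha> (q + 1))) = W_space \<Lambda> M q" if "strict_mono \<alpha>" for q
      using simple[OF that, of "q + 1"] R_layer_Suc by simp
  qed
qed

end
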